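(* Let $G\in H^\infty_{m\times p}$ and $K\in H^\infty_{m\times q}$ be such that $T_GT_G^*-T_KT_K^*$ is positive, and assume that the function $R\in L^\infty_{m\times m}$ defined by $R(e^{it})=G(e^{it})G(e^{it})^*-K(e^{it})K(e^{it})^*$ for a.e. $t\in[0,2\pi]$ admits an outer spectral factor. Then there exists a function $F\in H^\infty_{m\times k}$, for some $k\le m$, such that: (i) $T_GT_G^*-T_KT_K^*-T_FT_F^*$ is positive; (ii) $\operatorname{rank}\big(T_GT_G^*-T_KT_K^*-T_FT_F^*\big)\le \dim\Big(\overline{\operatorname{Im}H_G+\operatorname{Im}H_K}\Big)$.
   Context: $\mathbb D$ is the open unit disc, $\mathbb T$ the unit circle. $H^\infty_{m\times p}$ is the space of bounded analytic $m\times p$ matrix-valued functions on $\mathbb D$, and $L^\infty_{m\times p}$ the space of essentially bounded measurable $m\times p$ matrix functions on $\mathbb T$; $H^\infty_{m\times p}$ is viewed as a subspace of $L^\infty_{m\times p}$ via boundary values. $\ell^2_+(\mathbb C^k)$ is the Hilbert space of square summable unilateral sequences $(x_0,x_1,\dots)$ in $\mathbb C^k$. For $Z\in L^\infty_{m\times p}$ with Fourier coefficients $(Z_j)_{j\in\mathbb Z}$, the Toeplitz operator is $T_Z=[Z_{i-j}]_{i,j\ge0}$, and for $V\in H^\infty_{m\times p}$ with Taylor coefficients $V_0,V_1,\dots$ the Hankel operator is $H_V=[V_{i+j+1}]_{i,j\ge0}$; both are bounded operators $\ell^2_+(\mathbb C^p)\to\ell^2_+(\mathbb C^m)$. An operator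 $T$ on a Hilbert space is positive ($T\ge0$) if $\langle Tu,u\rangle\ge0$ for all $u$. The dimension of a (closed) subspace is its Hilbert space dimension, and the rank of an operator is the dimension of the closure of its range. An outer spectral factor of $R\in L^\infty_{m\times m}$ is a function $\Phi\in H^\infty_{r\times m}$, for some integer $0\le r\le m$, such that $T_R=T_\Phi^*T_\Phi$ and $\ker T_\Phi^*=\{0\}$. The size $k$ is a nonnegative integer; sizes $0$ are allowed for $r$ and $k$ (if $k=0$ then $T_FT_F^*=0$). *)

theory Defs
  imports "HOL-Analysis.Analysis" "Jordan_Normal_Form.Schur_Decomposition"
begin

unbundle no vec_syntax
unbundle no inner_syntax
unbundle cardinal_syntax

text \<open>
  Matrices and vectors are those of \<open>Jordan_Normal_Form\<close>, so all sizes are natural numbers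
  (possibly 0). An order relation on complex numbers, as in \<open>0 \<le> z\<close>, means that \<open>z\<close> is real and
  nonnegative. Functions on the unit circle are given on complex numbers of modulus one, and
  almost everywhere statements refer to the parametrisation \<open>cis\<close> of the circle by \<open>[0, 2 \<pi>]\<close>.
\<close>

definition Hinf :: "nat \<Rightarrow> nat \<Rightarrow> (complex \<Rightarrow> complex mat) set" where
  "Hinf m p = {V.
     (\<forall>z\<in>ball 0 1. V z \<in> carrier_mat m p) \<and>
     (\<forall>a<m. \<forall>b<p. (\<lambda>z. V z $$ (a, b)) holomorphic_on ball 0 1) \<and>
     (\<exists>C. \<forall>z\<in>ball 0 1. \<forall>a<m. \<forall>b<p. cmod (V z $$ (a, b)) \<le> C)}"

definition Linf :: "nat \<Rightarrow> nat \<Rightarrow> (complex \<Rightarrow> complex mat) set" where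
  "Linf m p = {Z.
     (\<forall>z\<in>sphere 0 1. Z z \<in> carrier_mat m p) \<and>
     (\<forall>a<m. \<forall>b<p. (\<lambda>t. Z (cis t) $$ (a, b)) \<in> borel_measurable (lebesgue_on {0..2*pi})) \<and>
     (\<exists>C. AE t in lebesgue_on {0..2*pi}. \<forall>a<m. \<forall>b<p. cmod (Z (cis t) $$ (a, b)) \<le> C)}"

text \<open>
  The embedding of \<open>H\<^sup>\<infinity>\<close> into \<open>L\<^sup>\<infinity>\<close>: entrywise radial limits, which exist almost everywhere on
  the circle by Fatou's theorem. On the exceptional null set the value of \<^const>\<open>Lim\<close> is
  unspecified and irrelevant.
\<close>

definition bdry :: "nat \<Rightarrow> nat \<Rightarrow> (complex \<Rightarrow> complex mat) \<Rightarrow> complex \<Rightarrow> complex mat" where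
  "bdry m p V z = mat m p (\<lambda>ab. Lim (at_left (1::real)) (\<lambda>r. V (of_real r * z) $$ ab))"

definition fourier_coeff :: "nat \<Rightarrow> nat \<Rightarrow> (complex \<Rightarrow> complex mat) \<Rightarrow> int \<Rightarrow> complex mat" where
  "fourier_coeff m p Z j = mat m p (\<lambda>ab.
     (LINT t|lebesgue_on {0..2*pi}. Z (cis t) $$ ab * cis (- of_int j * t)) / (2 * of_real pi))"

definition taylor_coeff :: "nat \<Rightarrow> nat \<Rightarrow> (complex \<Rightarrow> complex mat) \<Rightarrow> nat \<Rightarrow> complex mat" where
  "taylor_coeff m p V j = mat m p (\<lambda>ab. (deriv ^^ j) (\<lambda>z. V z $$ ab) 0 / fact j)"


definition ell2 :: "nat \<Rightarrow> (nat \<Rightarrow> complex vec) set" where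
  "ell2 k = {x. (\<forall>n. x n \<in> carrier_vec k) \<and> summable (\<lambda>n. \<Sum>a<k. (cmod (x n $ a))\<^sup>2)}"

definition ell2_inner :: "(nat \<Rightarrow> complex vec) \<Rightarrow> (nat \<Rightarrow> complex vec) \<Rightarrow> complex" where
  "ell2_inner x y = (\<Sum>n. x n \<bullet>c y n)"

definition ell2_norm :: "(nat \<Rightarrow> complex vec) \<Rightarrow> real" where
  "ell2_norm x = sqrt (Re (ell2_inner x x))"

definition ell2_zero :: "nat \<Rightarrow> nat \<Rightarrow> complex vec" where
  "ell2_zero k = (\<lambda>n. 0\<^sub>v k)"

definition ell2_closure :: "nat \<Rightarrow> (nat \<Rightarrow> complex vec) set \<Rightarrow> (nat \<Rightarrow> complex vec) set" where
  "ell2_closure k S = {x \<in> ell2 k. \<forall>e>0. \<exists>y\<in>S. ell2_norm (x - y) < e}"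

definition set_sum ::
  "(nat \<Rightarrow> complex vec) set \<Rightarrow> (nat \<Rightarrow> complex vec) set \<Rightarrow> (nat \<Rightarrow> complex vec) set" where
  "set_sum S S' = {\<lambda>n. x n + y n |x y. x \<in> S \<and> y \<in> S'}"

definition orthonormal :: "(nat \<Rightarrow> complex vec) set \<Rightarrow> bool" where
  "orthonormal B \<longleftrightarrow> (\<forall>x\<in>B. \<forall>y\<in>B. ell2_inner x y = (if x = y then 1 else 0))"

text \<open>An orthonormal basis of a closed subspace is a maximal orthonormal subset of it.\<close>

definition orthonormal_basis ::
  "(nat \<Rightarrow> complex vec) set \<Rightarrow> (nat \<Rightarrow> complex vec) set \<Rightarrow> bool" where
  "orthonormal_basis B S \<longleftrightarrow> B \<subseteq> S \<and> orthonormal B \<and>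
     (\<forall>B'. B \<subseteq> B' \<and> B' \<subseteq> S \<and> orthonormal B' \<longrightarrow> B' = B)"

text \<open>The Hilbert space dimension of a closed subspace, a cardinal (compared by \<open>\<le>o\<close>).\<close>

definition hilbert_dim :: "(nat \<Rightarrow> complex vec) set \<Rightarrow> (nat \<Rightarrow> complex vec) rel" where
  "hilbert_dim S = |SOME B. orthonormal_basis B S|"


text \<open>
  Operators are functions on sequences, of which only the restriction to the domain space
  \<^const>\<open>ell2\<close> matters. Differences of operators are the pointwise ones of the function and vector
  types.
\<close>

type_synonym oper = "(nat \<Rightarrow> complex vec) \<Rightarrow> nat \<Rightarrow> complex vec"

definition adjoint_op :: "nat \<Rightarrow> oper \<Rightarrow> oper" where
  "adjoint_op p T y =
     (THE x. x \<in> ell2 p \<and> (\<forall>u\<in>ell2 p. ell2_inner (T u) y = ell2_inner u x))"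

definition positive_op :: "nat \<Rightarrow> oper \<Rightarrow> bool" where
  "positive_op m T \<longleftrightarrow> (\<forall>u\<in>ell2 m. 0 \<le> ell2_inner (T u) u)"

definition kernel_op :: "nat \<Rightarrow> nat \<Rightarrow> oper \<Rightarrow> (nat \<Rightarrow> complex vec) set" where
  "kernel_op r m T = {y \<in> ell2 r. T y = ell2_zero m}"

text \<open>Rank of an operator with domain \<open>ell2 p\<close> and codomain \<open>ell2 m\<close>.\<close>

definition rank_op :: "nat \<Rightarrow> nat \<Rightarrow> oper \<Rightarrow> (nat \<Rightarrow> complex vec) rel" where
  "rank_op m p T = hilbert_dim (ell2_closure m (T ` ell2 p))"

text \<open>The operator with block matrix \<open>[A i j]\<close>, \<open>i, j \<ge> 0\<close>, whose blocks are of size \<open>m \<times> p\<close>.\<close>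

definition block_op :: "nat \<Rightarrow> (nat \<Rightarrow> nat \<Rightarrow> complex mat) \<Rightarrow> oper" where
  "block_op m A x = (\<lambda>i. vec m (\<lambda>a. \<Sum>j. (A i j *\<^sub>v x j) $ a))"

definition toeplitz :: "nat \<Rightarrow> nat \<Rightarrow> (complex \<Rightarrow> complex mat) \<Rightarrow> oper" where
  "toeplitz m p Z = block_op m (\<lambda>i j. fourier_coeff m p Z (int i - int j))"

definition hankel :: "nat \<Rightarrow> nat \<Rightarrow> (complex \<Rightarrow> complex mat) \<Rightarrow> oper" where
  "hankel m p V = block_op m (\<lambda>i j. taylor_coeff m p V (i + j + 1))"

text \<open>\<open>T\<^sub>V\<close> and \<open>T\<^sub>V T\<^sub>V\<^sup>*\<close> for \<open>V \<in> Hinf m p\<close>, seen as an element of \<open>Linf m p\<close>.\<close>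

definition toeplitz_H :: "nat \<Rightarrow> nat \<Rightarrow> (complex \<Rightarrow> complex mat) \<Rightarrow> oper" where
  "toeplitz_H m p V = toeplitz m p (bdry m p V)"

definition toeplitz_sq :: "nat \<Rightarrow> nat \<Rightarrow> (complex \<Rightarrow> complex mat) \<Rightarrow> oper" where
  "toeplitz_sq m p V = toeplitz_H m p V \<circ> adjoint_op p (toeplitz_H m p V)"

definition outer_spectral_factor ::
  "nat \<Rightarrow> (complex \<Rightarrow> complex mat) \<Rightarrow> nat \<Rightarrow> (complex \<Rightarrow> complex mat) \<Rightarrow> bool" where
  "outer_spectral_factor m R r \<Phi> \<longleftrightarrow>
     r \<le> m \<and> \<Phi> \<in> Hinf r m \<and>
     (\<forall>x\<in>ell2 m. toeplitz m m R x = adjoint_op m (toeplitz_H r m \<Phi>) (toeplitz_H r m \<Phi> x)) \<and>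
     kernel_op r m (adjoint_op m (toeplitz_H r m \<Phi>)) = {ell2_zero r}"

end

theory Submission
  imports Defs "HOL-Complex_Analysis.Complex_Analysis"
begin

text \<open>
  Let \<open>S\<close> be the unilateral shift, \<open>A = T\<^sub>G T\<^sub>G\<^sup>* - T\<^sub>K T\<^sub>K\<^sup>*\<close>, \<open>M\<close> the closure of
  \<open>Im H\<^sub>G + Im H\<^sub>K\<close> and \<open>L\<close> the orthogonal complement of \<open>M\<close>. The operator \<open>A\<close> need not be
  Toeplitz, but it behaves like one on \<open>L\<close>. For a constant vector \<open>e\<close> the sequence \<open>S\<^sup>* T\<^sub>G e\<close> is
  a column of \<open>H\<^sub>G\<close>, hence in \<open>M\<close>. So for \<open>x\<close> in \<open>L\<close> the first block of \<open>T\<^sub>G\<^sup>* S x\<close> vanishes, and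
  the same holds with \<open>K\<close> for \<open>G\<close>; it follows that \<open>A S x = S A x\<close>
  (\<open>intertwining_square_commutes\<close>). Since \<open>M\<close> is invariant under
  \<open>S\<^sup>*\<close>, \<open>L\<close> is invariant under \<open>S\<close>, and the compressions of \<open>A\<close> by the powers of \<open>S\<close> all agree
  with \<open>A\<close> on \<open>L\<close>. On the whole space these compressions converge to the Toeplitz operator of the
  symbol, \<open>T\<^sub>R = T\<^sub>\<Phi>\<^sup>* T\<^sub>\<Phi>\<close>. Therefore \<open>A = T\<^sub>\<Phi>\<^sup>* T\<^sub>\<Phi>\<close> on \<open>L\<close> (\<open>asymptotic_symbol\<close>).

  Let \<open>N\<close> be the closure of \<open>T\<^sub>\<Phi> L\<close>, which is invariant under \<open>S\<close>. By the Wold decomposition it has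
  an orthonormal basis of vectors \<open>S\<^sup>n w\<^sub>b\<close> with \<open>b < k\<close>, and counting coordinates with Bessel's
  inequality gives \<open>k \<le> r \<le> m\<close> (\<open>wandering_basis\<close>). Let \<open>V\<close> map a vector to its coefficients
  in this basis, so that \<open>V\<^sup>* V\<close> is the orthogonal projection onto \<open>N\<close>, and put
  \<open>\<Gamma> = T\<^sub>\<Phi>\<^sup>* V\<^sup>*\<close>. This operator commutes with \<open>S\<close>, because on \<open>T\<^sub>\<Phi> L\<close> the operator \<open>T\<^sub>\<Phi>\<^sup>*\<close>
  takes the values of \<open>A\<close>; hence \<open>\<Gamma> = T\<^sub>F\<close> for a bounded analytic \<open>F\<close>
  (\<open>shift_commuting_is_toeplitz\<close>). For every \<open>y\<close> the number \<open>\<langle>\<Gamma> \<Gamma>\<^sup>* y, y\<rangle>\<close> is the square of the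
  norm of the projection of \<open>T\<^sub>\<Phi> y\<close> to \<open>N\<close>. It is found by pairing \<open>T\<^sub>\<Phi> y\<close> with the vectors \<open>T\<^sub>\<Phi> x\<close>
  for \<open>x\<close> in \<open>L\<close>; the result is \<open>\<langle>y, A x\<rangle>\<close>, while \<open>T\<^sub>\<Phi> x\<close> has the squared norm \<open>\<langle>A x, x\<rangle>\<close>. The
  Cauchy-Schwarz inequality for the positive form of \<open>A\<close> thus gives \<open>\<Gamma> \<Gamma>\<^sup>* \<le> A\<close>. On \<open>L\<close> the two
  operators are equal. So \<open>A - T\<^sub>F T\<^sub>F\<^sup>*\<close> is positive and selfadjoint and vanishes on \<open>L\<close>; its range
  lies in \<open>M\<close>, which bounds its rank (\<open>toeplitz_square_splitting\<close>, \<open>hilbert_dim_mono\<close>).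

  The analytic part is the identification of the limit of the compressions. Their entries are
  partial sums of the series of products of Taylor coefficients whose sums are to be the Fourier
  coefficients of \<open>G G\<^sup>* - K K\<^sup>*\<close>, a function built from radial limits. Dominated convergence along
  the radii reduces this to the existence of radial limits almost everywhere
  (\<open>fatou_radial_limit\<close>), which follows from a maximal inequality. The Poisson integral is
  bounded by the largest one-sided average (\<open>dilation_le_one_sided_averages\<close>), and the set where
  these averages are large is estimated with the Vitali covering lemma (\<open>vitali_measure_le\<close>). The
  dilations of a function approximate it in square mean, and the maximal inequality turns this into
  approximation along whole radii off small sets.

  All operators act on a single Hilbert space, the square summable families over pairs of a block
  number and a component number. Sequences in \<open>\<complex>\<^sup>m\<close> are the families whose components from \<open>m\<close> on
  vanish, and \<open>represents\<close> relates the operators on the two kinds of spaces.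
\<close>

section \<open>The complex Hilbert space of square summable families\<close>

typedef 'a l2 = "{x :: 'a \<Rightarrow> complex. (\<lambda>i. (cmod (x i))\<^sup>2) summable_on UNIV}"
  morphisms coord mk_l2
  by (rule exI[of _ "\<lambda>_. 0"]) auto

setup_lifting type_definition_l2

lemma coord_summable: "(\<lambda>i. (cmod (coord x i))\<^sup>2) summable_on UNIV"
  using coord[of x] by simp

lemma l2_eqI: "(\<And>i. coord x i = coord y i) \<Longrightarrow> x = y"
  by (metis coord_inject ext)

lemma square_sum_le: "(cmod (a + b))\<^sup>2 \<le> 2 * (cmod a)\<^sup>2 + 2 * (cmod b)\<^sup>2"
proof -
  have "(cmod (a + b))\<^sup>2 \<le> (cmod a + cmod b)\<^sup>2"
    by (simp add: norm_triangle_ineq power_mono)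
  also have "\<dots> \<le> 2 * (cmod a)\<^sup>2 + 2 * (cmod b)\<^sup>2"
    using sum_squares_bound[of "cmod a" "cmod b"] by (simp add: power2_sum)
  finally show ?thesis .
qed

lemma summable_square_add:
  assumes "(\<lambda>i. (cmod (x i))\<^sup>2) summable_on UNIV" "(\<lambda>i. (cmod (y i))\<^sup>2) summable_on UNIV"
  shows "(\<lambda>i. (cmod (x i + y i))\<^sup>2) summable_on UNIV"
  by (rule summable_on_comparison_test[where f="\<lambda>i. 2 * (cmod (x i))\<^sup>2 + 2 * (cmod (y i))\<^sup>2"])
     (auto intro!: summable_on_add summable_on_cmult_right assms square_sum_le)

lemma summable_square_cmult:
  assumes "(\<lambda>i. (cmod (x i))\<^sup>2) summable_on UNIV"
  shows "(\<lambda>i. (cmod (c * x i))\<^sup>2) summable_on UNIV"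
  unfolding norm_mult power_mult_distrib by (intro summable_on_cmult_right assms)

lift_definition cscale :: "complex \<Rightarrow> 'a l2 \<Rightarrow> 'a l2" is "\<lambda>c x i. c * x i"
  by (rule summable_square_cmult)

lift_definition cinner :: "'a l2 \<Rightarrow> 'a l2 \<Rightarrow> complex" is "\<lambda>x y. \<Sum>\<^sub>\<infinity>i. x i * cnj (y i)" .

lemma summable_on_cinner: "(\<lambda>i. coord x i * cnj (coord y i)) summable_on UNIV"
proof (rule abs_summable_summable)
  show "(\<lambda>i. norm (coord x i * cnj (coord y i))) summable_on UNIV"
  proof (rule summable_on_comparison_test[where f="\<lambda>i. (cmod (coord x i))\<^sup>2 + (cmod (coord y i))\<^sup>2"])
    show "(\<lambda>i. (cmod (coord x i))\<^sup>2 + (cmod (coord y i))\<^sup>2) summable_on UNIV"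
      by (intro summable_on_add coord_summable)
    show "norm (coord x i * cnj (coord y i)) \<le> (cmod (coord x i))\<^sup>2 + (cmod (coord y i))\<^sup>2" for i
      using sum_squares_bound[of "cmod (coord x i)" "cmod (coord y i)"]
        mult_nonneg_nonneg[OF norm_ge_zero[of "coord x i"] norm_ge_zero[of "coord y i"]]
      unfolding norm_mult complex_mod_cnj by linarith
  qed auto
qed

text \<open>The real part of the complex inner product provides norm and topology, which makes the results
  on real inner product spaces available.\<close>

instantiation l2 :: (type) real_inner
begin

lift_definition zero_l2 :: "'a l2" is "\<lambda>_. 0" by simp
lift_definition plus_l2 :: "'a l2 \<Rightarrow> 'a l2 \<Rightarrow> 'a l2" is "\<lambda>x y i. x i + y i"
  by (rule summable_square_add)
lift_definition uminus_l2 :: "'a l2 \<Rightarrow> 'a l2" is "\<lambda>x i. - x i" by simp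
definition minus_l2 :: "'a l2 \<Rightarrow> 'a l2 \<Rightarrow> 'a l2" where "minus_l2 x y = x + - y"
definition scaleR_l2 :: "real \<Rightarrow> 'a l2 \<Rightarrow> 'a l2" where "scaleR_l2 r x = cscale (of_real r) x"
definition inner_l2 :: "'a l2 \<Rightarrow> 'a l2 \<Rightarrow> real" where "inner_l2 x y = Re (cinner x y)"
definition norm_l2 :: "'a l2 \<Rightarrow> real" where "norm_l2 x = sqrt (inner x x)"
definition sgn_l2 :: "'a l2 \<Rightarrow> 'a l2" where "sgn_l2 x = inverse (norm x) *\<^sub>R x"
definition dist_l2 :: "'a l2 \<Rightarrow> 'a l2 \<Rightarrow> real" where "dist_l2 x y = norm (x - y)"
definition uniformity_l2 :: "('a l2 \<times> 'a l2) filter"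
  where "uniformity_l2 = (INF e\<in>{0<..}. principal {(x, y). dist x y < e})"
definition open_l2 :: "'a l2 set \<Rightarrow> bool"
  where "open_l2 U = (\<forall>x\<in>U. eventually (\<lambda>(x', y). x' = x \<longrightarrow> y \<in> U) uniformity)"

lemma coord_zero [simp]: "coord 0 i = 0" by transfer simp
lemma coord_add [simp]: "coord (x + y) i = coord x i + coord y i" by transfer simp
lemma coord_uminus [simp]: "coord (- x) i = - coord x i" by transfer simp
lemma coord_diff [simp]: "coord (x - y) i = coord x i - coord y i" by (simp add: minus_l2_def)
lemma coord_cscale [simp]: "coord (cscale c x) i = c * coord x i" by transfer simp
lemma coord_scaleR [simp]: "coord (r *\<^sub>R x) i = of_real r * coord x i" by (simp add: scaleR_l2_def)

lemma cinner_eq: "cinner x y = (\<Sum>\<^sub>\<infinity>i. coord x i * cnj (coord y i))"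
  by transfer simp

lemma cinner_add_left: "cinner (x + y) z = cinner x z + cinner y z"
  by (simp add: cinner_eq algebra_simps infsum_add summable_on_cinner)

lemma cinner_cscale_left: "cinner (cscale c x) y = c * cinner x y"
  by (simp add: cinner_eq mult.assoc infsum_cmult_right')

lemma cinner_commute: "cinner x y = cnj (cinner y x)"
  unfolding cinner_eq infsum_cnj[symmetric] by (simp add: mult.commute)

lemma inner_self_l2: "inner x x = (\<Sum>\<^sub>\<infinity>i. (cmod (coord x i))\<^sup>2)" for x :: "'a l2"
proof -
  have "cinner x x = (\<Sum>\<^sub>\<infinity>i. of_real ((cmod (coord x i))\<^sup>2))"
    unfolding cinner_eq by (intro infsum_cong) (metis complex_norm_square)
  also have "\<dots> = of_real (\<Sum>\<^sub>\<infinity>i. (cmod (coord x i))\<^sup>2)"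
    by (intro infsumI has_sum_of_real has_sum_infsum coord_summable)
  finally show ?thesis by (simp add: inner_l2_def)
qed

lemma coord_square_le: "(cmod (coord x i))\<^sup>2 \<le> inner x x" for x :: "'a l2"
proof -
  have "infsum (\<lambda>i. (cmod (coord x i))\<^sup>2) {i} \<le> infsum (\<lambda>i. (cmod (coord x i))\<^sup>2) UNIV"
    by (intro infsum_mono_neutral coord_summable) (auto)
  then show ?thesis by (simp add: inner_self_l2)
qed

instance
proof
  fix x y z :: "'a l2" and a b :: real
  show "x - y = x + - y" by (rule minus_l2_def)
  show "x + y + z = x + (y + z)" by (rule l2_eqI) (simp add: add.assoc)
  show "x + y = y + x" by (rule l2_eqI) (simp add: add.commute)
  show "0 + x = x" "- x + x = 0" "1 *\<^sub>R x = x" by (rule l2_eqI, simp)+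
  show "a *\<^sub>R (x + y) = a *\<^sub>R x + a *\<^sub>R y" by (rule l2_eqI) (simp add: distrib_left)
  show "(a + b) *\<^sub>R x = a *\<^sub>R x + b *\<^sub>R x" by (rule l2_eqI) (simp add: distrib_right)
  show "a *\<^sub>R b *\<^sub>R x = (a * b) *\<^sub>R x" by (rule l2_eqI) (simp add: mult.assoc)
  show "dist x y = norm (x - y)" by (rule dist_l2_def)
  show "sgn x = inverse (norm x) *\<^sub>R x" by (rule sgn_l2_def)
  show "uniformity = (INF e\<in>{0<..}. principal {(x :: 'a l2, y). dist x y < e})"
    by (rule uniformity_l2_def)
  show "open U = (\<forall>x\<in>U. \<forall>\<^sub>F (x', y) in uniformity. x' = x \<longrightarrow> y \<in> U)" for U :: "'a l2 set"
    by (rule open_l2_def)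
  show "inner x y = inner y x" using cinner_commute[of x y] by (simp add: inner_l2_def)
  show "inner (x + y) z = inner x z + inner y z" by (simp add: inner_l2_def cinner_add_left)
  show "inner (a *\<^sub>R x) y = a * inner x y"
    by (simp add: inner_l2_def scaleR_l2_def cinner_cscale_left)
  show "0 \<le> inner x x" unfolding inner_self_l2 by (rule infsum_nonneg) simp
  have "coord x i = 0" if "inner x x = 0" for i
    using coord_square_le[of x i] that by simp
  then have "inner x x = 0 \<Longrightarrow> x = 0" by (intro l2_eqI) simp
  moreover have "inner (0 :: 'a l2) 0 = 0" by (simp add: inner_self_l2)
  ultimately show "(inner x x = 0) = (x = 0)" by blast
  show "norm x = sqrt (inner x x)" by (rule norm_l2_def)
qed

end

lemma norm_coord_le: "cmod (coord x i) \<le> norm x"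
  using coord_square_le[of x i] by (simp add: norm_eq_sqrt_inner real_le_rsqrt)

lemma norm_square_l2: "(norm x)\<^sup>2 = (\<Sum>\<^sub>\<infinity>i. (cmod (coord x i))\<^sup>2)" for x :: "'a l2"
  by (simp add: power2_norm_eq_inner inner_self_l2)

text \<open>Operators given by a formula for the coordinates obtain their values and their norm bounds in
  this way, from estimates of finite sums.\<close>

lemma l2_from_bounded_sums:
  assumes "\<And>F. finite F \<Longrightarrow> (\<Sum>i\<in>F. (cmod (x i))\<^sup>2) \<le> C\<^sup>2" and "C \<ge> 0"
  obtains y where "coord y = x" and "norm y \<le> C"
proof -
  have s: "(\<lambda>i. (cmod (x i))\<^sup>2) summable_on UNIV"
    by (rule nonneg_bdd_above_summable_on) (auto intro!: bdd_aboveI2 assms)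
  then have c: "coord (mk_l2 x) = x" by (simp add: mk_l2_inverse)
  have "(norm (mk_l2 x))\<^sup>2 \<le> C\<^sup>2"
    unfolding norm_square_l2 c by (rule infsum_le_finite_sums[OF s]) (use assms in auto)
  then have "norm (mk_l2 x) \<le> C" using assms(2) by (rule power2_le_imp_le)
  with c that show ?thesis by blast
qed

lemma sum_coord_square_le: "finite F \<Longrightarrow> (\<Sum>i\<in>F. (cmod (coord x i))\<^sup>2) \<le> (norm x)\<^sup>2"
  unfolding norm_square_l2 by (rule finite_sum_le_infsum[OF coord_summable]) auto

instance l2 :: (type) complete_space
proof
  fix X :: "nat \<Rightarrow> 'a l2" assume X: "Cauchy X"
  have "Cauchy (\<lambda>n. coord (X n) i)" for i
  proof (rule metric_CauchyI)
    fix e :: real assume "e > 0"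
    then obtain N where "\<And>m n. m \<ge> N \<Longrightarrow> n \<ge> N \<Longrightarrow> dist (X m) (X n) < e"
      using metric_CauchyD[OF X] by blast
    moreover have "dist (coord (X m) i) (coord (X n) i) \<le> dist (X m) (X n)" for m n
      using norm_coord_le[of "X m - X n" i] by (simp add: dist_norm)
    ultimately show "\<exists>M. \<forall>m\<ge>M. \<forall>n\<ge>M. dist (coord (X m) i) (coord (X n) i) < e"
      by (meson le_less_trans)
  qed
  then have "\<exists>l. (\<lambda>n. coord (X n) i) \<longlonglongrightarrow> l" for i
    by (simp add: Cauchy_convergent convergentD)
  then obtain x where x: "\<And>i. (\<lambda>n. coord (X n) i) \<longlonglongrightarrow> x i" by metis
  \<comment> \<open>the finite sums for \<open>X n - x\<close> are limits of those for \<open>X n - X m\<close>, hence uniformly small\<close>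
  have tail: "\<exists>y. coord y = (\<lambda>i. coord (X n) i - x i) \<and> norm y \<le> e"
    if "e > 0" and N: "\<And>m. m \<ge> N \<Longrightarrow> dist (X n) (X m) < e" for e n N
  proof -
    have "(\<Sum>i\<in>F. (cmod (coord (X n) i - x i))\<^sup>2) \<le> e\<^sup>2" if "finite F" for F
    proof (rule LIMSEQ_le_const2)
      show "(\<lambda>m. \<Sum>i\<in>F. (cmod (coord (X n) i - coord (X m) i))\<^sup>2)
              \<longlonglongrightarrow> (\<Sum>i\<in>F. (cmod (coord (X n) i - x i))\<^sup>2)"
        by (intro tendsto_intros x)
      have "(\<Sum>i\<in>F. (cmod (coord (X n) i - coord (X m) i))\<^sup>2) \<le> e\<^sup>2" if "m \<ge> N" for m
      proof -
        have "(\<Sum>i\<in>F. (cmod (coord (X n) i - coord (X m) i))\<^sup>2) \<le> (norm (X n - X m))\<^sup>2"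
          using sum_coord_square_le[OF \<open>finite F\<close>, of "X n - X m"] by simp
        also have "\<dots> \<le> e\<^sup>2"
          using N[OF that] by (intro power_mono) (auto simp: dist_norm)
        finally show ?thesis .
      qed
      then show "\<exists>N. \<forall>m\<ge>N. (\<Sum>i\<in>F. (cmod (coord (X n) i - coord (X m) i))\<^sup>2) \<le> e\<^sup>2" by blast
    qed
    then obtain y where "coord y = (\<lambda>i. coord (X n) i - x i)" "norm y \<le> e"
      using l2_from_bounded_sums[of "\<lambda>i. coord (X n) i - x i" e] \<open>e > 0\<close> by auto
    then show ?thesis by blast
  qed
  obtain N1 where "\<And>m n. m \<ge> N1 \<Longrightarrow> n \<ge> N1 \<Longrightarrow> dist (X m) (X n) < 1"
    using metric_CauchyD[OF X, of 1] by auto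
  then have "\<exists>y. coord y = (\<lambda>i. coord (X N1) i - x i) \<and> norm y \<le> 1"
    by (intro tail[of 1 N1 N1]) simp_all
  then obtain y1 where y1: "coord y1 = (\<lambda>i. coord (X N1) i - x i)" by blast
  have c: "coord (X N1 - y1) = x" by (rule ext) (simp add: y1)
  have "X \<longlonglongrightarrow> X N1 - y1"
  proof (rule metric_LIMSEQ_I)
    fix e :: real assume e: "e > 0"
    then obtain N where N: "\<And>m n. m \<ge> N \<Longrightarrow> n \<ge> N \<Longrightarrow> dist (X m) (X n) < e/2"
      using metric_CauchyD[OF X, of "e/2"] by auto
    have "dist (X n) (X N1 - y1) < e" if "n \<ge> N" for n
    proof -
      have "\<exists>y. coord y = (\<lambda>i. coord (X n) i - x i) \<and> norm y \<le> e/2"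
        by (rule tail[of "e/2" N n]) (use N that e in simp_all)
      then obtain y where y: "coord y = (\<lambda>i. coord (X n) i - x i)" "norm y \<le> e/2" by blast
      have "X n - (X N1 - y1) = y" using c by (intro l2_eqI) (simp add: y(1) y1)
      then show ?thesis using y(2) e by (simp add: dist_norm)
    qed
    then show "\<exists>no. \<forall>n\<ge>no. dist (X n) (X N1 - y1) < e" by blast
  qed
  then show "convergent X" by (rule convergentI)
qed

subsection \<open>Complex structure\<close>

lemma cinner_cscale_right: "cinner x (cscale c y) = cnj c * cinner x y"
  unfolding cinner_commute[of x "cscale c y"] cinner_cscale_left complex_cnj_mult
    cinner_commute[symmetric] ..

lemma cinner_add_right: "cinner x (y + z) = cinner x y + cinner x z"
  unfolding cinner_commute[of x "y + z"] cinner_add_left complex_cnj_add cinner_commute[symmetric] ..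

lemma cinner_diff_left: "cinner (x - y) z = cinner x z - cinner y z"
  using cinner_add_left[of "x - y" y z] by simp

lemma cinner_diff_right: "cinner x (y - z) = cinner x y - cinner x z"
  using cinner_add_right[of x "y - z" z] by simp

lemma cinner_zero [simp]: "cinner 0 x = 0" "cinner x 0 = 0"
  using cinner_diff_left[of x x x] cinner_diff_right[of x x x] by simp_all

lemma cinner_sum_left: "cinner (sum f A) y = (\<Sum>i\<in>A. cinner (f i) y)"
  by (induction A rule: infinite_finite_induct) (auto simp: cinner_add_left)

lemma cinner_self: "cinner x x = of_real ((norm x)\<^sup>2)"
proof -
  have "cinner x x = cnj (cinner x x)" by (rule cinner_commute)
  then have "Im (cinner x x) = 0" by (simp add: complex_eq_iff)
  then show ?thesis by (simp add: complex_eq_iff power2_norm_eq_inner inner_l2_def)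
qed

lemma norm_cscale [simp]: "norm (cscale c x) = cmod c * norm x"
proof -
  have "cinner (cscale c x) (cscale c x) = (c * cnj c) * cinner x x"
    by (simp add: cinner_cscale_left cinner_cscale_right)
  also have "\<dots> = of_real ((cmod c * norm x)\<^sup>2)"
    by (simp add: complex_norm_square[symmetric] cinner_self power_mult_distrib)
  finally have "(norm (cscale c x))\<^sup>2 = (cmod c * norm x)\<^sup>2"
    by (simp only: cinner_self of_real_eq_iff)
  then show ?thesis by (simp add: power2_eq_iff_nonneg)
qed

lemma norm_cinner_le: "cmod (cinner x y) \<le> norm x * norm y"
proof (cases "cinner x y = 0")
  case False
  \<comment> \<open>rotating \<open>x\<close> makes the inner product real and reduces the claim to the real inequality\<close>
  define c where "c = cnj (cinner x y) / cmod (cinner x y)"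
  have "cmod c = 1" using False by (simp add: c_def norm_divide)
  have "cinner (cscale c x) y = of_real (cmod (cinner x y))"
    using False by (simp add: cinner_cscale_left c_def mult.commute[of "cnj _"] complex_norm_square[symmetric] power2_eq_square)
  then have "cmod (cinner x y) = inner (cscale c x) y" by (simp add: inner_l2_def)
  also have "\<dots> \<le> norm (cscale c x) * norm y" by (rule norm_cauchy_schwarz)
  finally show ?thesis using \<open>cmod c = 1\<close> by simp
qed simp

lemma cscale_simps [simp]:
  "cscale c (x + y) = cscale c x + cscale c y" "cscale c (x - y) = cscale c x - cscale c y"
  "cscale c (cscale d x) = cscale (c * d) x" "cscale 1 x = x" "cscale 0 x = 0" "cscale c 0 = 0"
  "cscale (-1) x = - x" "cscale (of_real r) x = r *\<^sub>R x"
  by (rule l2_eqI; simp add: algebra_simps)+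

lemma bounded_linear_coord: "bounded_linear (\<lambda>x. coord x i)"
  by (rule bounded_linear_intro[where K=1]) (auto simp: norm_coord_le scaleR_conv_of_real)

lemma continuous_coord: "continuous_on UNIV (\<lambda>x. coord x i)"
  using linear_continuous_on[OF bounded_linear_coord] .

lemma summable_square_unit: "(\<lambda>j. (cmod (if i = j then 1 else 0))\<^sup>2) summable_on UNIV"
proof -
  have "(\<lambda>j. (cmod (if i = j then 1 else 0))\<^sup>2) summable_on {i}" by simp
  then show ?thesis
    by (rule summable_on_cong_neutral[THEN iffD1, rotated -1]) auto
qed

lift_definition unit_l2 :: "'a \<Rightarrow> 'a l2" is "\<lambda>i j. if i = j then 1 else 0"
  by (rule summable_square_unit)

lemma coord_unit: "coord (unit_l2 i) j = (if i = j then 1 else 0)"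
  by transfer simp

lemma cinner_unit_right: "cinner x (unit_l2 i) = coord x i"
proof -
  have "cinner x (unit_l2 i) = (\<Sum>\<^sub>\<infinity>j\<in>{i}. coord x j * cnj (coord (unit_l2 i) j))"
    unfolding cinner_eq by (rule infsum_cong_neutral) (auto simp: coord_unit)
  then show ?thesis by (simp add: coord_unit)
qed

lemma cinner_unit_left: "cinner (unit_l2 i) x = cnj (coord x i)"
  by (subst cinner_commute) (simp add: cinner_unit_right)

lemma norm_unit [simp]: "norm (unit_l2 i) = 1"
proof -
  have "of_real ((norm (unit_l2 i))\<^sup>2) = (1::complex)"
    by (simp only: cinner_self[symmetric]) (simp add: cinner_unit_right coord_unit)
  then have "(norm (unit_l2 i))\<^sup>2 = 1" by (metis of_real_1 of_real_eq_iff)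
  then show ?thesis by (simp add: power2_eq_1_iff) (metis norm_ge_zero neg_0_le_iff_le not_one_le_zero)
qed

subsection \<open>Closed subspaces\<close>

definition csubspace :: "'a l2 set \<Rightarrow> bool" where
  "csubspace N \<longleftrightarrow> 0 \<in> N \<and> (\<forall>x\<in>N. \<forall>y\<in>N. x + y \<in> N) \<and> (\<forall>c. \<forall>x\<in>N. cscale c x \<in> N)"

definition orth_compl :: "'a l2 set \<Rightarrow> 'a l2 set" where
  "orth_compl N = {x. \<forall>y\<in>N. cinner x y = 0}"

lemma csubspaceI:
  assumes "0 \<in> N" "\<And>x y. x \<in> N \<Longrightarrow> y \<in> N \<Longrightarrow> x + y \<in> N" "\<And>c x. x \<in> N \<Longrightarrow> cscale c x \<in> N"
  shows "csubspace N"
  unfolding csubspace_def using assms by auto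

lemma csubspaceD:
  assumes "csubspace N"
  shows "0 \<in> N" "x \<in> N \<Longrightarrow> y \<in> N \<Longrightarrow> x + y \<in> N" "x \<in> N \<Longrightarrow> cscale c x \<in> N"
    "x \<in> N \<Longrightarrow> y \<in> N \<Longrightarrow> x - y \<in> N" "x \<in> N \<Longrightarrow> r *\<^sub>R x \<in> N"
proof -
  show "0 \<in> N" "x \<in> N \<Longrightarrow> y \<in> N \<Longrightarrow> x + y \<in> N" "x \<in> N \<Longrightarrow> cscale c x \<in> N"
    using assms by (auto simp: csubspace_def)
  show "x \<in> N \<Longrightarrow> r *\<^sub>R x \<in> N"
    using assms by (auto simp: csubspace_def scaleR_l2_def simp del: cscale_simps)
  have "x \<in> N \<Longrightarrow> y \<in> N \<Longrightarrow> x + cscale (-1) y \<in> N"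
    using assms unfolding csubspace_def by blast
  then show "x \<in> N \<Longrightarrow> y \<in> N \<Longrightarrow> x - y \<in> N" by simp
qed

lemma csubspace_orth_compl: "csubspace (orth_compl N)"
  by (rule csubspaceI) (auto simp: orth_compl_def cinner_add_left cinner_cscale_left)

lemma bounded_linear_cscale: "bounded_linear (cscale c)"
  by (rule bounded_linear_intro[where K="cmod c"])
     (auto simp: scaleR_l2_def mult.commute simp del: cscale_simps(8))

lemma csubspace_closure:
  assumes N: "csubspace N" shows "csubspace (closure N)"
proof (rule csubspaceI)
  show "0 \<in> closure N" using csubspaceD(1)[OF N] closure_subset by blast
next
  fix x y assume "x \<in> closure N" "y \<in> closure N"
  then obtain X Y where "\<And>n. X n \<in> N" "X \<longlonglongrightarrow> x" "\<And>n. Y n \<in> N" "Y \<longlonglongrightarrow> y"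
    unfolding closure_sequential by metis
  then show "x + y \<in> closure N"
    unfolding closure_sequential using csubspaceD(2)[OF N] tendsto_add
    by (intro exI[of _ "\<lambda>n. X n + Y n"]) auto
next
  fix c x assume "x \<in> closure N"
  then obtain X where "\<And>n. X n \<in> N" "X \<longlonglongrightarrow> x" unfolding closure_sequential by metis
  then show "cscale c x \<in> closure N"
    unfolding closure_sequential
    using csubspaceD(3)[OF N] bounded_linear.tendsto[OF bounded_linear_cscale]
    by (intro exI[of _ "\<lambda>n. cscale c (X n)"]) auto
qed

lemma inner_diff_self: "(norm (x - y))\<^sup>2 = (norm x)\<^sup>2 - 2 * inner x y + (norm y)\<^sup>2"
  for x y :: "'b::real_inner"
  unfolding power2_norm_eq_inner by (simp add: inner_diff inner_commute)

text \<open>A minimizing sequence for the distance is Cauchy by the parallelogram law.\<close>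

lemma closest_point_csubspace:
  assumes N: "csubspace N" and cl: "closed N"
  obtains p where "p \<in> N" "\<And>y. y \<in> N \<Longrightarrow> norm (x - p) \<le> norm (x - y)"
proof -
  define d where "d = (INF y\<in>N. (norm (x - y))\<^sup>2)"
  have bdd: "bdd_below ((\<lambda>y. (norm (x - y))\<^sup>2) ` N)" by (rule bdd_belowI2[of _ 0]) simp
  have d: "d \<le> (norm (x - y))\<^sup>2" if "y \<in> N" for y
    unfolding d_def by (rule cINF_lower[OF bdd that])
  have "\<exists>y\<in>N. (norm (x - y))\<^sup>2 < d + 1 / Suc n" for n
  proof (rule ccontr)
    assume "\<not> ?thesis"
    then have "d + 1 / Suc n \<le> d"
      unfolding d_def using csubspaceD(1)[OF N] by (intro cINF_greatest) (auto simp: not_less)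
    then show False by simp
  qed
  then obtain Y where Y: "\<And>n. Y n \<in> N" "\<And>n. (norm (x - Y n))\<^sup>2 < d + 1 / Suc n" by metis
  have par: "(norm (Y m - Y n))\<^sup>2 \<le> 2 / Suc m + 2 / Suc n" for m n
  proof -
    have "(norm (Y m - Y n))\<^sup>2 + 4 * (norm (x - (1/2) *\<^sub>R (Y m + Y n)))\<^sup>2
        = 2 * (norm (x - Y m))\<^sup>2 + 2 * (norm (x - Y n))\<^sup>2"
      unfolding power2_norm_eq_inner by (simp add: inner_diff inner_add inner_commute algebra_simps)
    moreover have "d \<le> (norm (x - (1/2) *\<^sub>R (Y m + Y n)))\<^sup>2"
      by (intro d csubspaceD[OF N] Y)
    ultimately show ?thesis using Y(2)[of m] Y(2)[of n] by simp
  qed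
  have "Cauchy Y"
  proof (rule metric_CauchyI)
    fix e :: real assume e: "e > 0"
    obtain k where k: "4 / Suc k < e\<^sup>2"
    proof -
      obtain k where "inverse (real (Suc k)) < e\<^sup>2 / 4"
        using reals_Archimedean[of "e\<^sup>2 / 4"] e by auto
      then show ?thesis by (intro that[of k]) (simp add: field_simps)
    qed
    have "dist (Y m) (Y n) < e" if "m \<ge> k" "n \<ge> k" for m n
    proof -
      have "2 / Suc m + 2 / Suc n \<le> 2 / Suc k + 2 / Suc k"
        using that by (intro add_mono divide_left_mono) auto
      then have "(norm (Y m - Y n))\<^sup>2 < e\<^sup>2" using par[of m n] k by simp
      then show ?thesis using e by (simp add: dist_norm power2_less_imp_less)
    qed
    then show "\<exists>M. \<forall>m\<ge>M. \<forall>n\<ge>M. dist (Y m) (Y n) < e" by blast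
  qed
  then obtain p where p: "Y \<longlonglongrightarrow> p" using Cauchy_convergent convergent_def by blast
  have "(norm (x - p))\<^sup>2 \<le> d"
  proof (rule LIMSEQ_le)
    show "(\<lambda>n. (norm (x - Y n))\<^sup>2) \<longlonglongrightarrow> (norm (x - p))\<^sup>2" by (intro tendsto_intros p)
    show "(\<lambda>n. d + 1 / Suc n) \<longlonglongrightarrow> d"
      using tendsto_add[OF tendsto_const[of d] LIMSEQ_inverse_real_of_nat] by (simp add: inverse_eq_divide)
    show "\<exists>N. \<forall>n\<ge>N. (norm (x - Y n))\<^sup>2 \<le> d + 1 / Suc n" using Y(2) less_imp_le by blast
  qed
  moreover have "p \<in> N" using closed_sequentially[OF cl Y(1) p] .
  ultimately show ?thesis
    using that d by (meson norm_ge_zero order_trans power2_le_imp_le)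
qed

lemma orthogonal_decomposition:
  assumes N: "csubspace N" and cl: "closed N"
  obtains p where "p \<in> N" "x - p \<in> orth_compl N"
proof -
  obtain p where p: "p \<in> N" "\<And>y. y \<in> N \<Longrightarrow> norm (x - p) \<le> norm (x - y)"
    using closest_point_csubspace[OF assms] by metis
  have "cinner (x - p) y = 0" if y: "y \<in> N" for y
  proof (rule ccontr)
    define z c where "z = x - p" and "c = cinner z y"
    assume "cinner (x - p) y \<noteq> 0"
    then have c: "c \<noteq> 0" and y0: "norm y > 0" by (auto simp: z_def c_def)
    \<comment> \<open>moving from \<open>p\<close> by the component of \<open>z\<close> along \<open>y\<close> would get closer to \<open>x\<close>\<close>
    define t where "t = 1 / (norm y)\<^sup>2"
    have "norm z \<le> norm (z - cscale (t * c) y)"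
      using p(2)[of "p + cscale (t * c) y"] p(1) y N by (simp add: z_def csubspaceD diff_diff_eq)
    then have "(norm z)\<^sup>2 \<le> (norm (z - cscale (t * c) y))\<^sup>2" by simp
    also have "\<dots> = (norm z)\<^sup>2 - 2 * inner z (cscale (t * c) y) + t\<^sup>2 * (cmod c)\<^sup>2 * (norm y)\<^sup>2"
      unfolding inner_diff_self by (simp add: norm_mult power_mult_distrib)
    also have "inner z (cscale (t * c) y) = t * (cmod c)\<^sup>2"
      unfolding inner_l2_def cinner_cscale_right c_def[symmetric]
      unfolding cmod_power2 by (simp add: power2_eq_square algebra_simps)
    also have "t\<^sup>2 * (cmod c)\<^sup>2 * (norm y)\<^sup>2 = t * (cmod c)\<^sup>2"
      using y0 by (simp add: t_def power2_eq_square)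
    finally have "t * (cmod c)\<^sup>2 \<le> 0" by simp
    moreover have "t * (cmod c)\<^sup>2 > 0" using c y0 by (simp add: t_def)
    ultimately show False by simp
  qed
  with p(1) that show ?thesis by (auto simp: orth_compl_def)
qed

lemma orth_compl_orth_compl:
  assumes "csubspace N" "closed N" "x \<in> orth_compl (orth_compl N)"
  shows "x \<in> N"
proof -
  obtain p where p: "p \<in> N" "x - p \<in> orth_compl N" using orthogonal_decomposition assms by metis
  have "cinner x (x - p) = 0" using assms(3) p(2) by (auto simp: orth_compl_def)
  moreover have "cinner p (x - p) = 0"
    using p by (subst cinner_commute) (auto simp: orth_compl_def)
  ultimately have "cinner (x - p) (x - p) = 0" by (simp only: cinner_diff_left) simp
  then have "x = p" by (simp add: cinner_self)
  with p show ?thesis by simp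
qed

subsection \<open>Bounded operators\<close>

definition cbounded :: "('a l2 \<Rightarrow> 'b l2) \<Rightarrow> bool" where
  "cbounded T \<longleftrightarrow> bounded_linear T \<and> (\<forall>c x. T (cscale c x) = cscale c (T x))"

lemma cboundedI:
  assumes "\<And>x y. T (x + y) = T x + T y" "\<And>c x. T (cscale c x) = cscale c (T x)"
    and "\<And>x. norm (T x) \<le> C * norm x"
  shows "cbounded T"
  unfolding cbounded_def
proof (intro conjI)
  show "bounded_linear T"
    using assms by (intro bounded_linear_intro[where K=C])
      (auto simp: scaleR_l2_def mult.commute simp del: cscale_simps(8))
qed (use assms in blast)

lemma cbounded_simps:
  assumes T: "cbounded T"
  shows "T (x + y) = T x + T y" "T (x - y) = T x - T y" "T 0 = 0" "T (cscale c x) = cscale c (T x)"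
    "T (sum f A) = (\<Sum>i\<in>A. T (f i))"
proof -
  interpret bounded_linear T using T by (simp add: cbounded_def)
  show "T (x + y) = T x + T y" by (rule add)
  show "T (x - y) = T x - T y" by (rule diff)
  show "T 0 = 0" by (rule zero)
  show "T (sum f A) = (\<Sum>i\<in>A. T (f i))" by (rule sum)
  show "T (cscale c x) = cscale c (T x)" using T by (simp add: cbounded_def)
qed

lemma cbounded_continuous: "cbounded T \<Longrightarrow> continuous_on S T"
  by (rule linear_continuous_on) (simp add: cbounded_def)

lemma cbounded_bound: "cbounded T \<Longrightarrow> \<exists>C\<ge>0. \<forall>x. norm (T x) \<le> C * norm x"
  using bounded_linear.nonneg_bounded[of T] by (auto simp: cbounded_def mult.commute)

lemma cbounded_compose: "cbounded T \<Longrightarrow> cbounded U \<Longrightarrow> cbounded (\<lambda>x. T (U x))"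
  by (simp add: cbounded_def bounded_linear_compose[of T U])

lemma cbounded_diff: "cbounded T \<Longrightarrow> cbounded U \<Longrightarrow> cbounded (\<lambda>x. T x - U x)"
  by (simp add: cbounded_def bounded_linear_sub[of T U])

text \<open>The representing vector is a multiple of any vector \<open>z\<close> that is orthogonal to the kernel and
  outside of it: \<open>f(z) y - f(y) z\<close> is in the kernel, hence orthogonal to \<open>z\<close>.\<close>

lemma riesz_representation:
  assumes add: "\<And>x y. f (x + y) = f x + f y" and scale: "\<And>c x. f (cscale c x) = c * f x"
    and bound: "\<And>x. cmod (f x) \<le> C * norm x"
  shows "\<exists>v. \<forall>x. f x = cinner x v"
proof (cases "\<forall>x. f x = 0")
  case False
  define N where "N = {x. f x = 0}"
  have bl: "bounded_linear f"
    by (rule bounded_linear_intro[where K=C])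
       (auto simp: add scale bound scaleR_l2_def scaleR_conv_of_real mult.commute simp del: cscale_simps(8))
  have zero: "f 0 = 0" and diff: "f (x - y) = f x - f y" for x y
    using bounded_linear.linear[OF bl] by (auto simp: linear_0 linear_diff)
  have N: "csubspace N"
    by (intro csubspaceI) (auto simp: N_def add scale zero)
  have "closed N"
    using continuous_closed_preimage[OF linear_continuous_on[OF bl, of UNIV], of "{0}"]
    by (simp add: N_def vimage_def)
  obtain x where x: "f x \<noteq> 0" using False by blast
  obtain p where p: "p \<in> N" "x - p \<in> orth_compl N" using orthogonal_decomposition N \<open>closed N\<close> by metis
  define z where "z = x - p"
  have fz: "f z = f x" using p(1) by (simp add: z_def diff N_def)
  then have z0: "norm z \<noteq> 0" using x by (auto simp: zero)
  define a where "a = cnj (f z) / of_real ((norm z)\<^sup>2)"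
  have "f y = cinner y (cscale a z)" for y
  proof -
    have "f (cscale (f z) y - cscale (f y) z) = 0"
      by (simp add: diff scale)
    then have "cinner z (cscale (f z) y - cscale (f y) z) = 0"
      using p(2) by (simp add: orth_compl_def N_def z_def)
    then have "cinner (cscale (f z) y - cscale (f y) z) z = 0"
      by (subst cinner_commute) simp
    then have "f z * cinner y z = f y * of_real ((norm z)\<^sup>2)"
      by (simp add: cinner_diff_left cinner_cscale_left cinner_self)
    then show ?thesis using z0 by (simp add: cinner_cscale_right a_def field_simps)
  qed
  then show ?thesis by blast
next
  case True
  then show ?thesis by (intro exI[of _ 0]) simp
qed

lemma eq_from_cinner: "(\<And>z. cinner z x = cinner z y) \<Longrightarrow> x = y"
  by (rule l2_eqI) (metis cinner_unit_left complex_cnj_cnj)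

definition cadj :: "('a l2 \<Rightarrow> 'b l2) \<Rightarrow> 'b l2 \<Rightarrow> 'a l2" where
  "cadj T y = (SOME v. \<forall>x. cinner (T x) y = cinner x v)"

lemma cadj:
  assumes T: "cbounded T"
  shows "cinner (T x) y = cinner x (cadj T y)"
proof -
  obtain C where C: "C \<ge> 0" "\<And>x. norm (T x) \<le> C * norm x" using cbounded_bound[OF T] by blast
  have "\<exists>v. \<forall>x. cinner (T x) y = cinner x v"
  proof (rule riesz_representation)
    show "cmod (cinner (T x) y) \<le> (C * norm y) * norm x" for x
    proof -
      have "cmod (cinner (T x) y) \<le> norm (T x) * norm y" by (rule norm_cinner_le)
      also have "\<dots> \<le> C * norm x * norm y" by (intro mult_right_mono C) simp
      finally show ?thesis by (simp add: mult_ac)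
    qed
  qed (simp_all add: cbounded_simps(1,4)[OF T] cinner_add_left cinner_cscale_left)
  then have "\<forall>x. cinner (T x) y = cinner x (cadj T y)"
    unfolding cadj_def by (rule someI_ex)
  then show ?thesis by blast
qed

lemma cadj':
  assumes T: "cbounded T"
  shows "cinner (cadj T y) x = cinner y (T x)"
  using cadj[OF T, of x y] cinner_commute by metis

lemma cbounded_cadj:
  assumes T: "cbounded T"
  shows "cbounded (cadj T)"
proof -
  obtain C where C: "C \<ge> 0" "\<And>x. norm (T x) \<le> C * norm x" using cbounded_bound[OF T] by blast
  show ?thesis
  proof (rule cboundedI)
    show "cadj T (x + y) = cadj T x + cadj T y" for x y
      by (rule eq_from_cinner) (simp add: cadj[OF T, symmetric] cinner_add_right)
    show "cadj T (cscale c x) = cscale c (cadj T x)" for c x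
      by (rule eq_from_cinner) (simp add: cadj[OF T, symmetric] cinner_cscale_right)
    show "norm (cadj T y) \<le> C * norm y" for y
    proof (cases "cadj T y = 0")
      case False
      have "(norm (cadj T y))\<^sup>2 = cmod (cinner (T (cadj T y)) y)"
        by (simp add: cadj[OF T] cinner_self norm_power)
      also have "\<dots> \<le> norm (T (cadj T y)) * norm y" by (rule norm_cinner_le)
      also have "\<dots> \<le> C * norm (cadj T y) * norm y" by (intro mult_right_mono C) simp
      finally show ?thesis using False by (simp add: power2_eq_square mult_ac)
    qed (use C in simp)
  qed
qed

text \<open>A vector orthogonal to all unit vectors has zero coordinates, so the unit vectors span a dense
  subspace. Equalities and limits of bounded operators are extended from unit vectors by this rule.\<close>

lemma l2_induct:
  assumes N: "csubspace N" "closed N" and u: "\<And>i. unit_l2 i \<in> N"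
  shows "x \<in> N"
proof (rule orth_compl_orth_compl[OF N])
  have "z = 0" if "z \<in> orth_compl N" for z
  proof (rule l2_eqI)
    fix i
    have "cinner z (unit_l2 i) = 0" using that u[of i] by (simp add: orth_compl_def)
    then show "coord z i = coord 0 i" by (simp add: cinner_unit_right)
  qed
  then have "cinner x z = 0" if "z \<in> orth_compl N" for z using that by fastforce
  then show "x \<in> orth_compl (orth_compl N)" by (simp add: orth_compl_def[of "orth_compl N"])
qed

lemma closed_eq_cbounded:
  assumes T: "cbounded T" and U: "cbounded U"
  shows "closed {x. T x = U x}" "csubspace {x. T x = U x}"
proof -
  show "closed {x. T x = U x}"
    by (rule closed_Collect_eq) (auto intro: cbounded_continuous T U)
  show "csubspace {x. T x = U x}"
    by (rule csubspaceI) (simp_all add: cbounded_simps(1,3,4)[OF T] cbounded_simps(1,3,4)[OF U])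
qed

lemma cbounded_eqI:
  assumes "cbounded T" "cbounded U" "\<And>i. T (unit_l2 i) = U (unit_l2 i)"
  shows "T x = U x"
  using l2_induct[OF closed_eq_cbounded(2,1)[OF assms(1,2)], of x] assms(3) by simp

lemma cbounded_0: "cbounded (\<lambda>x. 0)"
  by (rule cboundedI[where C=0]) auto

lemma cadj_unique:
  assumes "\<And>x y. cinner (T x) y = cinner x (U y)" "cbounded T"
  shows "cadj T = U"
  by (rule ext, rule eq_from_cinner) (simp add: cadj[OF assms(2), symmetric] assms(1))

section \<open>Orthonormal families\<close>

definition onfamily :: "('i \<Rightarrow> 'a l2) \<Rightarrow> 'i set \<Rightarrow> bool" where
  "onfamily u J \<longleftrightarrow> (\<forall>i\<in>J. \<forall>j\<in>J. cinner (u i) (u j) = (if i = j then 1 else 0))"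

lemma onfamilyD: "onfamily u J \<Longrightarrow> i \<in> J \<Longrightarrow> j \<in> J \<Longrightarrow> cinner (u i) (u j) = (if i = j then 1 else 0)"
  by (auto simp: onfamily_def)

lemma onfamily_subset: "onfamily u J \<Longrightarrow> I \<subseteq> J \<Longrightarrow> onfamily u I"
  unfolding onfamily_def by blast

lemma cinner_onfamily_sum:
  assumes "onfamily u I" "finite I" "j \<in> I"
  shows "cinner (\<Sum>i\<in>I. cscale (c i) (u i)) (u j) = c j"
proof -
  have "cinner (\<Sum>i\<in>I. cscale (c i) (u i)) (u j) = (\<Sum>i\<in>I. if i = j then c i else 0)"
    unfolding cinner_sum_left cinner_cscale_left
    by (intro sum.cong) (auto simp: onfamilyD[OF assms(1) _ assms(3)])
  then show ?thesis using assms by simp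
qed

lemma cinner_onfamily_sum_right:
  "cinner x (\<Sum>i\<in>I. cscale (c i) (u i)) = (\<Sum>i\<in>I. cnj (c i) * cinner x (u i))"
  unfolding cinner_commute[of x "sum _ _"] cinner_sum_left cinner_cscale_left cnj_sum complex_cnj_mult
    cinner_commute[symmetric] ..

text \<open>For \<open>p = \<Sum> \<langle>x, u\<^sub>i\<rangle> u\<^sub>i\<close> the sum in question is both \<open>\<langle>x, p\<rangle>\<close> and \<open>\<langle>p, p\<rangle>\<close>, and the
  Cauchy-Schwarz inequality compares them.\<close>

lemma bessel:
  assumes u: "onfamily u I" and I: "finite I"
  shows "(\<Sum>i\<in>I. (cmod (cinner x (u i)))\<^sup>2) \<le> (norm x)\<^sup>2"
proof -
  define c where "c i = cinner x (u i)" for i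
  define p where "p = (\<Sum>i\<in>I. cscale (c i) (u i))"
  define s where "s = (\<Sum>i\<in>I. (cmod (c i))\<^sup>2)"
  have s0: "s \<ge> 0" by (simp add: s_def sum_nonneg)
  have sc: "(\<Sum>i\<in>I. cnj (c i) * c i) = of_real s"
    unfolding s_def of_real_sum by (intro sum.cong[OF refl]) (metis complex_norm_square mult.commute)
  have "cinner x p = of_real s" unfolding p_def cinner_onfamily_sum_right c_def[symmetric] by (rule sc)
  moreover have "cinner p p = of_real s"
  proof -
    have "cinner p p = (\<Sum>i\<in>I. cnj (c i) * cinner p (u i))"
      unfolding p_def by (rule cinner_onfamily_sum_right)
    also have "\<dots> = (\<Sum>i\<in>I. cnj (c i) * c i)"
      unfolding p_def by (intro sum.cong) (auto simp: cinner_onfamily_sum[OF u I])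
    finally show ?thesis using sc by simp
  qed
  then have "(norm p)\<^sup>2 = s" unfolding cinner_self of_real_eq_iff .
  ultimately have "s \<le> norm x * norm p" using norm_cinner_le[of x p] s0 by simp
  then have "s\<^sup>2 \<le> (norm x * norm p)\<^sup>2" using s0 by (rule power_mono)
  then have "s * s \<le> (norm x)\<^sup>2 * s"
    unfolding power_mult_distrib \<open>(norm p)\<^sup>2 = s\<close> by (simp add: power2_eq_square)
  then have "s \<le> (norm x)\<^sup>2" using s0 by (cases "s = 0") auto
  then show ?thesis by (simp add: s_def c_def)
qed

text \<open>The coefficients of a vector with respect to an orthonormal family. The values outside of \<open>J\<close>
  are 0, so that the adjoint sends the unit vector at \<open>j\<close> to \<open>u j\<close> or to 0.\<close>

definition coeff_op :: "('i \<Rightarrow> 'a l2) \<Rightarrow> 'i set \<Rightarrow> 'a l2 \<Rightarrow> 'i l2" where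
  "coeff_op u J y = mk_l2 (\<lambda>j. if j \<in> J then cinner y (u j) else 0)"

lemma coeff_op_aux:
  assumes "onfamily u J"
  shows "coord (coeff_op u J y) = (\<lambda>j. if j \<in> J then cinner y (u j) else 0)"
    and "norm (coeff_op u J y) \<le> norm y"
proof -
  let ?f = "\<lambda>j. if j \<in> J then cinner y (u j) else 0"
  have "(\<Sum>i\<in>F. (cmod (?f i))\<^sup>2) \<le> (norm y)\<^sup>2" if "finite F" for F
  proof -
    have "(\<Sum>i\<in>F. (cmod (?f i))\<^sup>2) = (\<Sum>i\<in>F \<inter> J. (cmod (cinner y (u i)))\<^sup>2)"
      using that by (intro sum.mono_neutral_cong_right) auto
    also have "\<dots> \<le> (norm y)\<^sup>2"
      using that by (intro bessel onfamily_subset[OF assms]) auto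
    finally show ?thesis .
  qed
  then obtain z where z: "coord z = ?f" "norm z \<le> norm y"
    by (rule l2_from_bounded_sums[of ?f "norm y"]) auto
  then have "coeff_op u J y = z" unfolding coeff_op_def using coord_inverse[of z] by simp
  with z show "coord (coeff_op u J y) = ?f" "norm (coeff_op u J y) \<le> norm y" by simp_all
qed

lemma coord_coeff_op:
  "onfamily u J \<Longrightarrow> coord (coeff_op u J y) j = (if j \<in> J then cinner y (u j) else 0)"
  by (simp add: coeff_op_aux)

lemma cbounded_coeff_op:
  assumes u: "onfamily u J" shows "cbounded (coeff_op u J)"
proof (rule cboundedI)
  show "coeff_op u J (x + y) = coeff_op u J x + coeff_op u J y" for x y
    by (rule l2_eqI) (simp add: coord_coeff_op[OF u] cinner_add_left)
  show "coeff_op u J (cscale c x) = cscale c (coeff_op u J x)" for c x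
    by (rule l2_eqI) (simp add: coord_coeff_op[OF u] cinner_cscale_left)
  show "norm (coeff_op u J x) \<le> 1 * norm x" for x using coeff_op_aux(2)[OF u] by simp
qed

lemma coeff_op_member:
  assumes u: "onfamily u J" and j: "j \<in> J" shows "coeff_op u J (u j) = unit_l2 j"
  using j by (intro l2_eqI) (auto simp: coord_coeff_op[OF u] coord_unit onfamilyD[OF u j])

lemma cadj_coeff_op_unit:
  assumes u: "onfamily u J"
  shows "cadj (coeff_op u J) (unit_l2 j) = (if j \<in> J then u j else 0)"
  by (rule eq_from_cinner)
     (simp add: cadj[OF cbounded_coeff_op[OF u], symmetric] cinner_unit_right coord_coeff_op[OF u])

text \<open>The vector \<open>cadj (coeff_op u J) (coeff_op u J z)\<close> is the projection of \<open>z\<close> to the closed span of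
  the family, which has the same coefficients as \<open>z\<close>.\<close>

lemma coeff_op_cadj_coeff_op:
  assumes u: "onfamily u J"
  shows "coeff_op u J (cadj (coeff_op u J) (coeff_op u J z)) = coeff_op u J z"
proof (rule l2_eqI)
  fix j
  show "coord (coeff_op u J (cadj (coeff_op u J) (coeff_op u J z))) j = coord (coeff_op u J z) j"
    by (simp add: coord_coeff_op[OF u, of "cadj _ _"] cadj'[OF cbounded_coeff_op[OF u]] coeff_op_member[OF u]
         cinner_unit_right) (simp add: coord_coeff_op[OF u])
qed

section \<open>The shift\<close>

text \<open>The index \<open>(n, a)\<close> stands for component \<open>a\<close> of block \<open>n\<close>. Only finitely many components will be
  in use, but leaving their number open lets all operators act on one space.\<close>

type_synonym seq2 = "(nat \<times> nat) l2"

abbreviation succ_fst :: "nat \<times> nat \<Rightarrow> nat \<times> nat" where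
  "succ_fst i \<equiv> (Suc (fst i), snd i)"

lemma inj_succ_fst: "inj succ_fst"
  by (auto simp: inj_on_def prod_eq_iff)

lemma range_succ_fst: "range succ_fst = {i. fst i \<noteq> 0}"
proof (intro equalityI subsetI)
  fix i :: "nat \<times> nat" assume "i \<in> {i. fst i \<noteq> 0}"
  then have "i = succ_fst (fst i - 1, snd i)" by (simp add: prod_eq_iff)
  then show "i \<in> range succ_fst" by blast
qed auto

lemma summable_on_succ_fst:
  fixes f :: "nat \<times> nat \<Rightarrow> real"
  assumes "f summable_on UNIV"
  shows "(\<lambda>i. f (succ_fst i)) summable_on UNIV"
proof -
  have "f summable_on range succ_fst" by (rule summable_on_subset_banach[OF assms]) simp
  then have "(f \<circ> succ_fst) summable_on UNIV" unfolding summable_on_reindex[OF inj_succ_fst] .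
  then show ?thesis by (simp only: o_def)
qed

lemma summable_on_pred_fst:
  fixes f :: "nat \<times> nat \<Rightarrow> real"
  assumes "f summable_on UNIV"
  shows "(\<lambda>i. if fst i = 0 then 0 else f (fst i - 1, snd i)) summable_on UNIV" (is "?g summable_on _")
proof -
  have "(?g \<circ> succ_fst) summable_on UNIV" using assms by (simp add: o_def)
  then have "?g summable_on range succ_fst" unfolding summable_on_reindex[OF inj_succ_fst] .
  then show ?thesis
    by (rule summable_on_cong_neutral[THEN iffD1, rotated -1]) (auto simp: range_succ_fst)
qed

lift_definition bshift :: "seq2 \<Rightarrow> seq2" is "\<lambda>x i. x (succ_fst i)"
  by (rule summable_on_succ_fst)

lift_definition shift :: "seq2 \<Rightarrow> seq2" is "\<lambda>x i. if fst i = 0 then 0 else x (fst i - 1, snd i)"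
proof -
  fix x :: "nat \<times> nat \<Rightarrow> complex"
  assume "(\<lambda>i. (cmod (x i))\<^sup>2) summable_on UNIV"
  from summable_on_pred_fst[OF this]
  show "(\<lambda>i. (cmod (if fst i = 0 then 0 else x (fst i - 1, snd i)))\<^sup>2) summable_on UNIV"
    by (rule summable_on_cong[THEN iffD1, rotated]) simp
qed

lemma coord_bshift [simp]: "coord (bshift x) i = coord x (succ_fst i)" by transfer simp
lemma coord_shift: "coord (shift x) i = (if fst i = 0 then 0 else coord x (fst i - 1, snd i))"
  by transfer simp
lemma bshift_shift [simp]: "bshift (shift x) = x"
  by (rule l2_eqI) (simp add: coord_shift)

lemma cinner_shift: "cinner (shift x) y = cinner x (bshift y)"
proof -
  have "cinner (shift x) y = (\<Sum>\<^sub>\<infinity>i\<in>range succ_fst. coord (shift x) i * cnj (coord y i))"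
    unfolding cinner_eq by (rule infsum_cong_neutral) (auto simp: range_succ_fst coord_shift)
  also have "\<dots> = infsum ((\<lambda>i. coord (shift x) i * cnj (coord y i)) \<circ> succ_fst) UNIV"
    by (rule infsum_reindex[OF inj_succ_fst])
  also have "\<dots> = cinner x (bshift y)"
    unfolding cinner_eq by (rule infsum_cong) (simp add: coord_shift)
  finally show ?thesis .
qed

lemma cinner_bshift: "cinner (bshift x) y = cinner x (shift y)"
  unfolding cinner_commute[of "bshift x"] cinner_shift[symmetric] cinner_commute[symmetric] ..

lemma norm_shift [simp]: "norm (shift x) = norm x"
proof -
  have "cinner (shift x) (shift x) = cinner x x" by (simp add: cinner_shift)
  then have "(norm (shift x))\<^sup>2 = (norm x)\<^sup>2" unfolding cinner_self of_real_eq_iff .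
  then show ?thesis by (simp add: power2_eq_iff_nonneg)
qed

lemma cbounded_shift: "cbounded shift"
proof (rule cboundedI)
  show "shift (x + y) = shift x + shift y" for x y
    by (rule l2_eqI) (simp add: coord_shift)
  show "shift (cscale c x) = cscale c (shift x)" for c x
    by (rule l2_eqI) (simp add: coord_shift)
  show "norm (shift x) \<le> 1 * norm x" for x by simp
qed

lemma cadj_shift: "cadj shift = bshift"
  by (rule cadj_unique) (simp_all add: cinner_shift cbounded_shift)

lemma cbounded_bshift: "cbounded bshift"
  using cbounded_cadj[OF cbounded_shift] by (simp add: cadj_shift)

lemma coord_eq_0_if_fst: "(\<And>a. coord x (0, a) = 0) \<Longrightarrow> fst i = 0 \<Longrightarrow> coord x i = 0"
  by (cases i) simp

lemma shift_bshift: "(\<And>a. coord x (0, a) = 0) \<Longrightarrow> shift (bshift x) = x"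
  by (rule l2_eqI) (simp add: coord_shift coord_eq_0_if_fst)

lemma coord_shift_power: "coord ((shift ^^ k) x) (n, a) = (if n < k then 0 else coord x (n - k, a))"
  by (induction k arbitrary: n) (auto simp: coord_shift)

lemma shift_power_unit: "(shift ^^ k) (unit_l2 (n, a)) = unit_l2 (n + k, a)"
proof (rule l2_eqI)
  fix i
  show "coord ((shift ^^ k) (unit_l2 (n, a))) i = coord (unit_l2 (n + k, a)) i"
    by (cases i) (auto simp: coord_shift_power coord_unit)
qed

lemma cinner_shift_power: "cinner ((shift ^^ n) x) ((shift ^^ n) y) = cinner x y"
  by (induction n) (auto simp: cinner_shift)

lemma cinner_shift_power_le:
  "n \<le> m \<Longrightarrow> cinner ((shift ^^ n) x) ((shift ^^ m) y) = cinner x ((shift ^^ (m - n)) y)"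
  using cinner_shift_power[of n x "(shift ^^ (m - n)) y"]
  using fun_cong[OF funpow_add[of n "m - n" shift], of y] by simp

lemma norm_shift_power [simp]: "norm ((shift ^^ n) x) = norm x"
  by (induction n) auto

lemma cbounded_shift_power: "cbounded (shift ^^ n)"
proof (induction n)
  case 0 then show ?case by (intro cboundedI[where C=1]) auto
next
  case (Suc n)
  then show ?case using cbounded_compose[OF cbounded_shift Suc] by (simp add: o_def)
qed

section \<open>Wandering subspaces\<close>

text \<open>The inner products of the unit vector at \<open>(N, a)\<close> with \<open>S\<^sup>n w\<^sub>b\<close> for \<open>n \<le> N\<close> are the coordinates
  \<open>(N - n, a)\<close> of \<open>w\<^sub>b\<close>, up to conjugation. Bessel's inequality for this unit vector therefore
  bounds the first \<open>N + 1\<close> coordinates of component \<open>a\<close>, summed over all \<open>b\<close>, by 1. Summing over the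
  \<open>r\<close> components and letting \<open>N\<close> grow bounds the sum of the squared norms of the \<open>w\<^sub>b\<close>, which is
  \<open>k\<close>, by \<open>r\<close>.\<close>

lemma onfamily_shift_card_le:
  assumes on: "onfamily (\<lambda>(n, b). (shift ^^ n) (w b)) (UNIV \<times> {..<k})"
    and supp: "\<And>b n a. b < k \<Longrightarrow> a \<ge> r \<Longrightarrow> coord (w b) (n, a) = 0"
  shows "k \<le> r"
proof -
  have bes: "(\<Sum>b<k. \<Sum>j\<le>N. (cmod (coord (w b) (j, a)))\<^sup>2) \<le> 1" for N a
  proof -
    have "(\<Sum>b<k. \<Sum>j\<le>N. (cmod (coord (w b) (j, a)))\<^sup>2)
        = (\<Sum>b<k. \<Sum>n\<le>N. (cmod (cinner (unit_l2 (N, a)) ((shift ^^ n) (w b))))\<^sup>2)"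
    proof (rule sum.cong[OF refl])
      fix b
      show "(\<Sum>j\<le>N. (cmod (coord (w b) (j, a)))\<^sup>2)
          = (\<Sum>n\<le>N. (cmod (cinner (unit_l2 (N, a)) ((shift ^^ n) (w b))))\<^sup>2)"
        by (rule sum.reindex_bij_witness[of _ "\<lambda>n. N - n" "\<lambda>n. N - n"])
           (auto simp: cinner_unit_left coord_shift_power)
    qed
    also have "\<dots> = (\<Sum>i\<in>{..N} \<times> {..<k}. (cmod (cinner (unit_l2 (N, a)) ((\<lambda>(n, b). (shift ^^ n) (w b)) i)))\<^sup>2)"
      by (subst sum.swap) (simp add: sum.cartesian_product case_prod_unfold)
    also have "\<dots> \<le> (norm (unit_l2 (N, a)))\<^sup>2"
      by (rule bessel[OF onfamily_subset[OF on]]) auto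
    finally show ?thesis by simp
  qed
  \<comment> \<open>small enough for \<open>k (1 - e) \<le> r\<close> to imply \<open>k \<le> r\<close> for integers\<close>
  define e where "e = 1 / (real k + 1)"
  have e: "e > 0" by (simp add: e_def)
  have "\<exists>N. \<forall>N'\<ge>N. (\<Sum>j\<le>N'. \<Sum>a<r. (cmod (coord (w b) (j, a)))\<^sup>2) > 1 - e" if b: "b < k" for b
  proof -
    have "cinner (w b) (w b) = 1" using onfamilyD[OF on, of "(0, b)" "(0, b)"] b by simp
    then have nw: "(norm (w b))\<^sup>2 = 1" by (metis cinner_self of_real_eq_1_iff)
    have "\<exists>F. finite F \<and> (\<Sum>i\<in>F. (cmod (coord (w b) i))\<^sup>2) > 1 - e"
    proof (rule ccontr)
      assume "\<not> ?thesis"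
      then have "(norm (w b))\<^sup>2 \<le> 1 - e"
        unfolding norm_square_l2 by (intro infsum_le_finite_sums coord_summable) (auto simp: not_less)
      with nw e show False by simp
    qed
    then obtain F where F: "finite F" "(\<Sum>i\<in>F. (cmod (coord (w b) i))\<^sup>2) > 1 - e" by blast
    have "(\<Sum>j\<le>N'. \<Sum>a<r. (cmod (coord (w b) (j, a)))\<^sup>2) > 1 - e" if N': "N' \<ge> Max (fst ` F)" for N'
    proof -
      have out: "coord (w b) i = 0" if "i \<notin> {i. snd i < r}" for i
        using supp[OF b, of "snd i" "fst i"] that by simp
      have le: "fst i \<le> N'" if "i \<in> F" for i
        using Max_ge[OF finite_imageI[OF F(1)], of "fst i" fst] that N' by simp
      have "(\<Sum>i\<in>F. (cmod (coord (w b) i))\<^sup>2) = (\<Sum>i\<in>F \<inter> {i. snd i < r}. (cmod (coord (w b) i))\<^sup>2)"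
        using F(1) by (intro sum.mono_neutral_right) (auto intro!: out)
      also have "\<dots> \<le> (\<Sum>i\<in>{..N'} \<times> {..<r}. (cmod (coord (w b) i))\<^sup>2)"
        using le by (intro sum_mono2) (auto dest: le)
      also have "\<dots> = (\<Sum>j\<le>N'. \<Sum>a<r. (cmod (coord (w b) (j, a)))\<^sup>2)"
        by (simp add: sum.cartesian_product)
      finally show ?thesis using F(2) by simp
    qed
    then show ?thesis by blast
  qed
  then have "\<forall>b. \<exists>N. b < k \<longrightarrow> (\<forall>N'\<ge>N. (\<Sum>j\<le>N'. \<Sum>a<r. (cmod (coord (w b) (j, a)))\<^sup>2) > 1 - e)"
    by blast
  from choice[OF this] obtain Nf where Nf: "\<And>b N'. b < k \<Longrightarrow> N' \<ge> Nf b \<Longrightarrow>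
      (\<Sum>j\<le>N'. \<Sum>a<r. (cmod (coord (w b) (j, a)))\<^sup>2) > 1 - e" by blast
  define N where "N = (\<Sum>b<k. Nf b)"
  have "real k * (1 - e) = (\<Sum>b<k. 1 - e)" by simp
  also have "\<dots> \<le> (\<Sum>b<k. \<Sum>j\<le>N. \<Sum>a<r. (cmod (coord (w b) (j, a)))\<^sup>2)"
  proof (rule sum_mono)
    fix b assume b: "b \<in> {..<k}"
    then have "Nf b \<le> N" unfolding N_def by (intro member_le_sum) auto
    then show "1 - e \<le> (\<Sum>j\<le>N. \<Sum>a<r. (cmod (coord (w b) (j, a)))\<^sup>2)"
      using Nf[of b N] b by (intro less_imp_le) simp
  qed
  also have "\<dots> = (\<Sum>a<r. \<Sum>b<k. \<Sum>j\<le>N. (cmod (coord (w b) (j, a)))\<^sup>2)"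
    by (subst (2) sum.swap) (subst sum.swap, rule refl)
  also have "\<dots> \<le> (\<Sum>a<r. 1)" by (intro sum_mono bes)
  finally have "real k * (1 - e) \<le> real r" by simp
  moreover have "real k * e < 1" by (simp add: e_def)
  ultimately have "real k < real r + 1" by (simp add: algebra_simps)
  then show ?thesis by linarith
qed

text \<open>The shift is isometric, so common powers cancel; what remains is the inner product of some \<open>w\<^sub>b\<close>
  either with another one or with a vector shifted from \<open>N\<close>.\<close>

lemma shift_orthonormal:
  assumes on: "onfamily w I" and w: "\<And>b y. b \<in> I \<Longrightarrow> y \<in> N \<Longrightarrow> cinner (w b) (shift y) = 0"
    and wN: "\<And>b. b \<in> I \<Longrightarrow> w b \<in> N" and inv: "\<And>y. y \<in> N \<Longrightarrow> shift y \<in> N"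
  shows "onfamily (\<lambda>(n, b). (shift ^^ n) (w b)) (UNIV \<times> I)"
proof -
  have inv': "(shift ^^ n) y \<in> N" if "y \<in> N" for n y
    using that by (induction n) (auto intro: inv)
  have 1: "cinner ((shift ^^ n) (w b)) ((shift ^^ m) (w c)) = (if n = m \<and> b = c then 1 else 0)"
    if "n \<le> m" "b \<in> I" "c \<in> I" for n m b c
  proof (cases "m - n")
    case 0
    then show ?thesis using that onfamilyD[OF on] by (simp add: cinner_shift_power)
  next
    case (Suc d)
    then have "cinner ((shift ^^ n) (w b)) ((shift ^^ m) (w c)) = cinner (w b) (shift ((shift ^^ d) (w c)))"
      using that by (simp add: cinner_shift_power_le)
    also have "\<dots> = 0" using that by (intro w inv' wN)
    finally show ?thesis using Suc by auto
  qed
  have "cinner ((shift ^^ n) (w b)) ((shift ^^ m) (w c)) = (if n = m \<and> b = c then 1 else 0)"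
    if "b \<in> I" "c \<in> I" for n m b c
  proof (cases "n \<le> m")
    case False
    then have "cinner ((shift ^^ m) (w c)) ((shift ^^ n) (w b)) = 0" using 1[of m n c b] that by auto
    then show ?thesis using False cinner_commute[of "(shift ^^ n) (w b)"] by simp
  qed (use 1 that in simp)
  then show ?thesis unfolding onfamily_def by auto
qed

text \<open>The Wold decomposition of the shift on \<open>N\<close>. The vectors \<open>w\<^sub>b\<close> form a maximal orthonormal family in
  the orthogonal complement of \<open>S N\<close> in \<open>N\<close>. An element of \<open>N\<close> orthogonal to all \<open>S\<^sup>n w\<^sub>b\<close> lies in
  \<open>S\<^sup>n N\<close> for every \<open>n\<close>, so its first \<open>n\<close> blocks vanish for every \<open>n\<close>.\<close>

lemma wandering_basis:
  assumes N: "csubspace N" "closed N" and inv: "\<And>y. y \<in> N \<Longrightarrow> shift y \<in> N"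
    and supp: "\<And>y n a. y \<in> N \<Longrightarrow> a \<ge> r \<Longrightarrow> coord y (n, a) = 0"
  obtains k w where "k \<le> r" "\<And>b. b < k \<Longrightarrow> w b \<in> N"
    "onfamily (\<lambda>(n, b). (shift ^^ n) (w b)) (UNIV \<times> {..<k})"
    "\<And>v. v \<in> N \<Longrightarrow> (\<And>n b. b < k \<Longrightarrow> cinner v ((shift ^^ n) (w b)) = 0) \<Longrightarrow> v = 0"
proof -
  define W where "W = {w \<in> N. \<forall>y\<in>N. cinner w (shift y) = 0}"
  define P where "P k \<longleftrightarrow> (\<exists>w. (\<forall>b<k. w b \<in> W) \<and> onfamily w {..<k})" for k :: nat
  have on: "onfamily (\<lambda>(n, b). (shift ^^ n) (w b)) (UNIV \<times> {..<k})"
    if "\<forall>b<k. w b \<in> W" "onfamily w {..<k}" for w k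
    using that by (intro shift_orthonormal[where N=N] inv) (auto simp: W_def)
  have le: "k \<le> r" if Pk: "P k" for k
  proof -
    obtain w where "\<forall>b<k. w b \<in> W" "onfamily w {..<k}" using Pk by (auto simp: P_def)
    with on[OF this] supp show ?thesis by (intro onfamily_shift_card_le[of w]) (auto simp: W_def)
  qed
  have "P 0" by (simp add: P_def onfamily_def)
  \<comment> \<open>the number of orthonormal vectors in \<open>W\<close> is at most \<open>r\<close>, so there is a largest one\<close>
  have "\<exists>k. P k \<and> \<not> P (Suc k)"
  proof (rule ccontr)
    assume "\<not> ?thesis"
    then have "P n" for n using \<open>P 0\<close> by (induction n) auto
    then show False using le[of "Suc r"] by simp
  qed
  then obtain k where k: "P k" "\<not> P (Suc k)" by blast
  then obtain w where w: "\<forall>b<k. w b \<in> W" "onfamily w {..<k}" by (auto simp: P_def)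
  have max: "v = 0" if v: "v \<in> W" "\<And>b. b < k \<Longrightarrow> cinner v (w b) = 0" for v
  proof (rule ccontr)
    assume v0: "v \<noteq> 0"
    define v' where "v' = cscale (of_real (1 / norm v)) v"
    have "v' \<in> W"
      using v(1) N(1) unfolding v'_def W_def by (auto simp del: cscale_simps(8) simp: csubspaceD cinner_cscale_left)
    moreover have "norm v' = 1" using v0 by (simp add: v'_def norm_divide)
    then have "cinner v' v' = 1" by (simp add: cinner_self)
    moreover have "cinner v' (w b) = 0" "cinner (w b) v' = 0" if "b < k" for b
    proof -
      show *: "cinner v' (w b) = 0"
        using v(2)[OF that] unfolding v'_def cinner_cscale_left by simp
      show "cinner (w b) v' = 0" using cinner_commute[of "w b" v'] * by simp
    qed
    ultimately have "(\<forall>b<Suc k. (w(k := v')) b \<in> W) \<and> onfamily (w(k := v')) {..<Suc k}"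
      using w by (auto simp: onfamily_def less_Suc_eq)
    then have "P (Suc k)" unfolding P_def by blast
    with k show False by simp
  qed
  \<comment> \<open>the image of \<open>N\<close> under the shift, in a form that shows that it is closed\<close>
  define SN where "SN = {x. bshift x \<in> N \<and> (\<forall>a. coord x (0, a) = 0)}"
  have SN: "csubspace SN"
    using csubspaceD[OF N(1)]
    by (intro csubspaceI) (auto simp: SN_def cbounded_simps(1,3,4)[OF cbounded_bshift])
  have "closed SN"
  proof -
    have "SN = (bshift -` N) \<inter> (\<Inter>a. (\<lambda>x. coord x (0, a)) -` {0})" by (auto simp: SN_def)
    moreover have "closed (bshift -` N)"
      using continuous_closed_preimage[OF cbounded_continuous[OF cbounded_bshift, of UNIV] closed_UNIV N(2)]
      by simp
    moreover have "closed ((\<lambda>x. coord x (0, a)) -` {0})" for a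
      using continuous_closed_preimage[OF continuous_coord[of "(0, a)"] closed_UNIV, of "{0}"] by simp
    ultimately show ?thesis by (auto intro!: closed_INT closed_Int)
  qed
  have SNshift: "x = shift (bshift x)" if "x \<in> SN" for x using that by (simp add: SN_def shift_bshift)
  have step: "y \<in> SN" if y: "y \<in> N" "\<And>b. b < k \<Longrightarrow> cinner y (w b) = 0" for y
  proof -
    obtain p where p: "p \<in> SN" "y - p \<in> orth_compl SN"
      using orthogonal_decomposition[OF SN \<open>closed SN\<close>] by metis
    have pN: "p \<in> N" using SNshift[OF p(1)] p(1) inv unfolding SN_def by (metis (lifting) mem_Collect_eq)
    have "y - p \<in> W"
      using p(2) y(1) pN csubspaceD(4)[OF N(1)] unfolding W_def orth_compl_def by (auto simp: SN_def coord_shift)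
    moreover have "cinner (y - p) (w b) = 0" if "b < k" for b
    proof -
      have "cinner (w b) (shift (bshift p)) = 0"
        using w(1) that p(1) by (auto simp: W_def SN_def)
      then have "cinner (w b) p = 0" using SNshift[OF p(1)] by simp
      then have "cinner p (w b) = 0" using cinner_commute[of p "w b"] by simp
      then show ?thesis using y(2)[OF that] by (simp add: cinner_diff_left)
    qed
    ultimately have "y - p = 0" by (rule max)
    then show ?thesis using p(1) by simp
  qed
  have final: "v = 0" if v: "v \<in> N" "\<And>n b. b < k \<Longrightarrow> cinner v ((shift ^^ n) (w b)) = 0" for v
  proof -
    have "\<exists>z\<in>N. v = (shift ^^ n) z" for n
    proof (induction n)
      case (Suc n)
      then obtain z where z: "z \<in> N" "v = (shift ^^ n) z" by blast
      have "cinner z (w b) = 0" if "b < k" for b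
        using v(2)[OF that, of n] z(2) by (simp add: cinner_shift_power)
      then have "z \<in> SN" using step z(1) by blast
      then have "z = shift (bshift z)" "bshift z \<in> N" using SNshift by (auto simp: SN_def)
      then have "v = (shift ^^ n) (shift (bshift z))" using z(2) by simp
      then have "v = (shift ^^ Suc n) (bshift z)" by (simp add: funpow_swap1)
      with \<open>bshift z \<in> N\<close> show ?case by blast
    qed (use v in auto)
    then have "coord v (n, a) = 0" for n a
      by (metis (no_types) coord_shift_power lessI)
    then show ?thesis by (intro l2_eqI) auto
  qed
  show ?thesis
    by (rule that[of k w]) (use w final le k on in \<open>auto simp: W_def\<close>)
qed

section \<open>Splitting off an analytic Toeplitz square\<close>

lemma nonneg_quadratic_discriminant:
  fixes a b c :: real
  assumes q: "\<And>t. 0 \<le> a + 2 * t * b + t\<^sup>2 * c" and c: "c \<ge> 0"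
  shows "b\<^sup>2 \<le> a * c"
proof (cases "c = 0")
  case True
  have "b = 0"
  proof (rule ccontr)
    assume b: "b \<noteq> 0"
    \<comment> \<open>here the affine function takes the value \<open>-1\<close>\<close>
    define t where "t = - (a + 1) / (2 * b)"
    have "2 * t * b = - (a + 1)" using b by (simp add: t_def)
    then show False using q[of t] True by simp
  qed
  then show ?thesis using True by simp
next
  case False
  then have "c > 0" using c by simp
  \<comment> \<open>the minimum of the quadratic function\<close>
  define t where "t = - b / c"
  have "t * c = - b" using \<open>c > 0\<close> by (simp add: t_def)
  have "c * (a + 2 * t * b + t\<^sup>2 * c) = a * c + 2 * b * (t * c) + (t * c)\<^sup>2"
    by (simp add: power2_eq_square algebra_simps)
  also have "\<dots> = a * c - b\<^sup>2"
    unfolding \<open>t * c = - b\<close> by (simp add: power2_eq_square)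
  finally have "c * (a + 2 * t * b + t\<^sup>2 * c) = a * c - b\<^sup>2" .
  moreover have "0 \<le> c * (a + 2 * t * b + t\<^sup>2 * c)" using q[of t] c by simp
  ultimately show ?thesis by simp
qed

lemma inner_cadj: "cbounded T \<Longrightarrow> inner (T x) y = inner x (cadj T y)"
  by (simp add: inner_l2_def cadj)

lemma inner_cadj': "cbounded T \<Longrightarrow> inner (cadj T x) y = inner x (T y)"
  by (simp add: inner_l2_def cadj')

lemma positive_cauchy_schwarz:
  assumes A: "cbounded A" and sa: "\<And>x y. inner (A x) y = inner x (A y)"
    and pos: "\<And>y. 0 \<le> inner (A y) y"
  shows "(inner (A x) y)\<^sup>2 \<le> inner (A x) x * inner (A y) y"
proof (rule nonneg_quadratic_discriminant)
  fix t :: real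
  have "A (x + t *\<^sub>R y) = A x + t *\<^sub>R A y"
    using cbounded_simps(1,4)[OF A] by (simp add: scaleR_l2_def del: cscale_simps(8))
  then have "inner (A (x + t *\<^sub>R y)) (x + t *\<^sub>R y)
      = inner (A x) x + 2 * t * inner (A x) y + t\<^sup>2 * inner (A y) y"
    using sa[of y x] by (simp add: inner_add inner_commute power2_eq_square algebra_simps)
  with pos[of "x + t *\<^sub>R y"] show "0 \<le> inner (A x) x + 2 * t * inner (A x) y + t\<^sup>2 * inner (A y) y"
    by simp
qed (rule pos)

text \<open>As \<open>T\<close> commutes with the shift \<open>S\<close>, one has \<open>S\<^sup>* T\<^sup>* S = T\<^sup>*\<close>. The condition on \<open>x\<close> makes the first
  block of \<open>T\<^sup>* S x\<close> vanish. This block is all that \<open>S\<^sup>*\<close> loses, so \<open>T\<^sup>* S x = S T\<^sup>* x\<close>.\<close>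

lemma intertwining_square_commutes:
  assumes T: "cbounded T" and comm: "\<And>x. T (shift x) = shift (T x)"
    and x: "\<And>b. cinner x (bshift (T (unit_l2 (0, b)))) = 0"
  shows "T (cadj T (shift x)) = shift (T (cadj T x))"
proof -
  have adj: "bshift (cadj T y) = cadj T (bshift y)" for y
    by (rule eq_from_cinner) (simp add: cinner_shift[symmetric] cadj[OF T, symmetric] comm)
  have "coord (cadj T (shift x)) (0, b) = 0" for b
  proof -
    have "coord (cadj T (shift x)) (0, b) = cinner (shift x) (T (unit_l2 (0, b)))"
      by (simp add: cinner_unit_right[symmetric] cadj'[OF T])
    then show ?thesis using x[of b] by (simp add: cinner_shift)
  qed
  then have "cadj T (shift x) = shift (bshift (cadj T (shift x)))" by (simp add: shift_bshift)
  also have "\<dots> = shift (cadj T x)" by (simp add: adj)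
  finally show ?thesis by (simp add: comm)
qed

text \<open>The compressions of \<open>A\<close> by the powers of the shift all take the value \<open>A x\<close> at \<open>x\<close>, so \<open>A x\<close> is
  the value of their limit at \<open>x\<close>. The limit is given on unit vectors only; the compressions are
  bounded uniformly in \<open>n\<close>, so it extends to \<open>x\<close> by density.\<close>

lemma asymptotic_symbol:
  assumes A: "cbounded A" and P: "cbounded P"
    and lim: "\<And>i j. (\<lambda>n. cinner (A ((shift ^^ n) (unit_l2 i))) ((shift ^^ n) (unit_l2 j)))
                \<longlonglongrightarrow> cinner (P (unit_l2 i)) (P (unit_l2 j))"
    and x: "\<And>n. A ((shift ^^ n) x) = (shift ^^ n) (A x)"
  shows "A x = cadj P (P x)"
proof -
  obtain C where C: "C \<ge> 0" "\<And>x. norm (A x) \<le> C * norm x" using cbounded_bound[OF A] by blast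
  define f where "f j n z = cinner (A ((shift ^^ n) z)) ((shift ^^ n) (unit_l2 j))" for j n z
  have fadd: "f j n (y + z) = f j n y + f j n z" "f j n (y - z) = f j n y - f j n z"
    "f j n (cscale c z) = c * f j n z" "f j n 0 = 0" for j n y z c
    unfolding f_def cbounded_simps(1,2,3,4)[OF cbounded_shift_power] cbounded_simps(1,2,3,4)[OF A]
    by (simp_all add: cinner_add_left cinner_diff_left cinner_cscale_left)
  have fb: "cmod (f j n z) \<le> C * norm z" for j n z
  proof -
    have "cmod (f j n z) \<le> norm (A ((shift ^^ n) z)) * norm ((shift ^^ n) (unit_l2 j))"
      unfolding f_def by (rule norm_cinner_le)
    also have "\<dots> \<le> C * norm z" using C(2)[of "(shift ^^ n) z"] by simp
    finally show ?thesis .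
  qed
  have conv: "(\<lambda>n. f j n z) \<longlonglongrightarrow> cinner (P z) (P (unit_l2 j))" for j z
  proof -
    define N where "N = {z. (\<lambda>n. f j n z) \<longlonglongrightarrow> cinner (P z) (P (unit_l2 j))}"
    have 1: "csubspace N"
      by (rule csubspaceI)
         (auto simp: N_def fadd cbounded_simps(1,3,4)[OF P] cinner_add_left cinner_cscale_left
               intro!: tendsto_intros)
    have 2: "closed N"
      unfolding closed_sequential_limits
    proof (intro allI impI, elim conjE)
      fix X y assume X: "\<forall>n. X n \<in> N" "X \<longlonglongrightarrow> y"
      obtain D where D: "D \<ge> 0" "\<And>x. norm (P x) \<le> D * norm x" using cbounded_bound[OF P] by blast
      define g where "g z = cinner (P z) (P (unit_l2 j))" for z
      have g: "cmod (g y - g (X k)) \<le> D * norm (y - X k) * D" for k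
      proof -
        have "cmod (g y - g (X k)) = cmod (cinner (P (y - X k)) (P (unit_l2 j)))"
          by (simp add: g_def cinner_diff_left cbounded_simps(2)[OF P])
        also have "\<dots> \<le> norm (P (y - X k)) * norm (P (unit_l2 j))" by (rule norm_cinner_le)
        also have "\<dots> \<le> (D * norm (y - X k)) * D"
          using D(2)[of "unit_l2 j"] D by (intro mult_mono) auto
        finally show ?thesis .
      qed
      have "(\<lambda>n. f j n y) \<longlonglongrightarrow> g y"
      proof (rule metric_LIMSEQ_I)
        fix e :: real assume e: "e > 0"
        \<comment> \<open>replacing \<open>y\<close> by \<open>X k\<close> changes both sides by at most \<open>B\<close> times their distance\<close>
        define B where "B = C + D * D + 1"
        have B: "B > 0" using C(1) D(1) by (simp add: B_def add_nonneg_pos)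
        then obtain k where k: "norm (y - X k) < e / (2 * B)"
          using metric_LIMSEQ_D[OF X(2), of "e / (2 * B)"] e
          by (auto simp: dist_norm norm_minus_commute)
        have "(\<lambda>n. f j n (X k)) \<longlonglongrightarrow> g (X k)" using X(1) by (auto simp: N_def g_def)
        from metric_LIMSEQ_D[OF this, of "e / 2"] e obtain M
          where M: "\<And>n. n \<ge> M \<Longrightarrow> dist (f j n (X k)) (g (X k)) < e / 2" by auto
        have "dist (f j n y) (g y) < e" if "n \<ge> M" for n
        proof -
          have "cmod (f j n y - f j n (X k)) \<le> C * norm (y - X k)"
            using fb[of j n "y - X k"] by (simp add: fadd)
          moreover have "C * norm (y - X k) + D * norm (y - X k) * D \<le> B * norm (y - X k)"
            by (simp add: B_def algebra_simps)
          moreover have "B * norm (y - X k) < e / 2"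
            using k B by (simp add: field_simps)
          moreover have "cmod (f j n y - g y) \<le> cmod (f j n y - f j n (X k))
              + cmod (f j n (X k) - g (X k)) + cmod (g (X k) - g y)"
            using norm_triangle_ineq[of "f j n y - f j n (X k)" "f j n (X k) - g y"]
              norm_triangle_ineq[of "f j n (X k) - g (X k)" "g (X k) - g y"] by simp
          ultimately show ?thesis
            using g[of k] M[OF that] by (simp add: dist_norm norm_minus_commute)
        qed
        then show "\<exists>no. \<forall>n\<ge>no. dist (f j n y) (g y) < e" by blast
      qed
      then show "y \<in> N" by (simp add: N_def g_def)
    qed
    have "z \<in> N"
      by (rule l2_induct[OF 1 2]) (simp add: N_def f_def lim)
    then show ?thesis by (simp add: N_def)
  qed
  show ?thesis
  proof (rule l2_eqI)
    fix j
    have "f j n x = cinner (A x) (unit_l2 j)" for n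
      unfolding f_def x by (rule cinner_shift_power)
    then have "(\<lambda>n. f j n x) \<longlonglongrightarrow> cinner (A x) (unit_l2 j)" by simp
    from LIMSEQ_unique[OF this conv] have "cinner (A x) (unit_l2 j) = cinner (P x) (P (unit_l2 j))" .
    then show "coord (A x) j = coord (cadj P (P x)) j"
      by (simp add: cinner_unit_right[symmetric] cadj'[OF P])
  qed
qed

text \<open>In the application \<open>P\<close> is \<open>T\<^sub>\<Phi>\<close> and \<open>M\<close> is the closure of \<open>Im H\<^sub>G + Im H\<^sub>K\<close>. With \<open>L\<close> the
  orthogonal complement of \<open>M\<close>, \<open>N\<close> the closure of \<open>P L\<close> and \<open>V\<close> the coefficient operator of a
  wandering basis of \<open>N\<close>, the choice \<open>\<Gamma> = P\<^sup>* V\<^sup>*\<close> makes \<open>\<Gamma> \<Gamma>\<^sup>* = P\<^sup>* V\<^sup>* V P\<close>, where \<open>V\<^sup>* V\<close>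
  is the projection onto \<open>N\<close>. The lower bound on \<open>A\<close> follows by testing against \<open>P L\<close>.\<close>

theorem toeplitz_square_splitting:
  fixes TG TK P A :: "seq2 \<Rightarrow> seq2"
  assumes TG: "cbounded TG" and TK: "cbounded TK" and P: "cbounded P"
    and commG: "\<And>x. TG (shift x) = shift (TG x)" and commK: "\<And>x. TK (shift x) = shift (TK x)"
    and commP: "\<And>x. P (shift x) = shift (P x)"
    and A_def: "A = (\<lambda>y. TG (cadj TG y) - TK (cadj TK y))"
    and pos: "\<And>y. 0 \<le> inner (A y) y"
    and lim: "\<And>i j. (\<lambda>n. cinner (A ((shift ^^ n) (unit_l2 i))) ((shift ^^ n) (unit_l2 j)))
                \<longlonglongrightarrow> cinner (P (unit_l2 i)) (P (unit_l2 j))"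
    and M: "csubspace M" "closed M" and M_inv: "\<And>x. x \<in> M \<Longrightarrow> bshift x \<in> M"
    and MG: "\<And>b. bshift (TG (unit_l2 (0, b))) \<in> M" and MK: "\<And>b. bshift (TK (unit_l2 (0, b))) \<in> M"
    and P_range: "\<And>x n a. a \<ge> r \<Longrightarrow> coord (P x) (n, a) = 0"
    and P_dom: "\<And>n a. a \<ge> m \<Longrightarrow> P (unit_l2 (n, a)) = 0"
  obtains k \<Gamma> where "k \<le> r" "cbounded \<Gamma>" "\<And>x. \<Gamma> (shift x) = shift (\<Gamma> x)"
    "\<And>n b. b \<ge> k \<Longrightarrow> \<Gamma> (unit_l2 (n, b)) = 0"
    "\<And>x n a. a \<ge> m \<Longrightarrow> coord (\<Gamma> x) (n, a) = 0"
    "\<And>y. 0 \<le> inner (A y - \<Gamma> (cadj \<Gamma> y)) y"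
    "\<And>y. A y - \<Gamma> (cadj \<Gamma> y) \<in> M"
proof -
  have A: "cbounded A"
    unfolding A_def by (intro cbounded_diff cbounded_compose[OF TG] cbounded_compose[OF TK] cbounded_cadj TG TK)
  have A_sa: "cinner (A x) y = cinner x (A y)" for x y
    by (simp add: A_def cinner_diff_left cinner_diff_right cadj[OF TG] cadj[OF TK] cadj'[OF TG] cadj'[OF TK])
  have A_sa': "inner (A x) y = inner x (A y)" for x y by (simp add: inner_l2_def A_sa)
  define L where "L = orth_compl M"
  have L: "csubspace L" unfolding L_def by (rule csubspace_orth_compl)
  have L_inv: "shift x \<in> L" if "x \<in> L" for x
    using that M_inv by (auto simp: L_def orth_compl_def cinner_shift)
  have AL: "A (shift x) = shift (A x)" if "x \<in> L" for x
    using that MG MK unfolding A_def cbounded_simps(2)[OF cbounded_shift]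
    by (auto simp: L_def orth_compl_def intertwining_square_commutes[OF TG commG] intertwining_square_commutes[OF TK commK])
  have Aeq: "A x = cadj P (P x)" if "x \<in> L" for x
  proof (rule asymptotic_symbol[OF A P lim])
    have 1: "(shift ^^ n) x \<in> L" for n using that by (induction n) (auto intro: L_inv)
    show "A ((shift ^^ n) x) = (shift ^^ n) (A x)" for n
      by (induction n) (simp_all add: AL[OF 1])
  qed

  define N where "N = closure (P ` L)"
  have "csubspace (P ` L)"
  proof (rule csubspaceI)
    show "0 \<in> P ` L" using cbounded_simps(3)[OF P] csubspaceD(1)[OF L] by force
    show "x + y \<in> P ` L" if "x \<in> P ` L" "y \<in> P ` L" for x y
      using that csubspaceD(2)[OF L] cbounded_simps(1)[OF P, symmetric] by auto
    show "cscale c x \<in> P ` L" if "x \<in> P ` L" for c x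
      using that csubspaceD(3)[OF L] cbounded_simps(4)[OF P, symmetric] by auto
  qed
  then have N: "csubspace N" "closed N" unfolding N_def by (auto intro: csubspace_closure)
  have N_least: "N \<subseteq> Z" if "closed Z" "\<And>x. x \<in> L \<Longrightarrow> P x \<in> Z" for Z
    unfolding N_def using that by (intro closure_minimal) auto
  have PN: "P x \<in> N" if "x \<in> L" for x 
    unfolding N_def using closure_subset[of "P ` L"] imageI[OF that, of P] by (rule subsetD)
  have N_inv: "shift y \<in> N" if "y \<in> N" for y
  proof -
    have "N \<subseteq> shift -` N"
    proof (rule N_least)
      show "closed (shift -` N)"
        using continuous_closed_preimage[OF cbounded_continuous[OF cbounded_shift, of UNIV] closed_UNIV N(2)]
        by simp
    qed (auto simp: commP[symmetric] intro: PN L_inv)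
    then show ?thesis using that by blast
  qed
  have N_supp: "coord y (n, a) = 0" if "y \<in> N" "a \<ge> r" for y n a
  proof -
    have "N \<subseteq> (\<lambda>y. coord y (n, a)) -` {0}"
    proof (rule N_least)
      show "closed ((\<lambda>y. coord y (n, a)) -` {0})"
        using continuous_closed_preimage[OF continuous_coord[of "(n, a)"] closed_UNIV, of "{0}"] by simp
    qed (simp add: P_range[OF that(2)])
    then show ?thesis using that by blast
  qed
  obtain k w where k: "k \<le> r" and wN: "\<And>b. b < k \<Longrightarrow> w b \<in> N"
    and on: "onfamily (\<lambda>(n, b). (shift ^^ n) (w b)) (UNIV \<times> {..<k})"
    and complete: "\<And>v. v \<in> N \<Longrightarrow> (\<And>n b. b < k \<Longrightarrow> cinner v ((shift ^^ n) (w b)) = 0) \<Longrightarrow> v = 0"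
    by (rule wandering_basis[OF N N_inv N_supp]) blast+
  define V where "V = coeff_op (\<lambda>(n, b). (shift ^^ n) (w b)) (UNIV \<times> {..<k})"
  have V: "cbounded V" unfolding V_def by (rule cbounded_coeff_op[OF on])
  note V' = cbounded_cadj[OF V]
  have coordV: "coord (V y) (n, b) = (if b < k then cinner y ((shift ^^ n) (w b)) else 0)" for y n b
    by (simp add: V_def coord_coeff_op[OF on])
  have wN': "(shift ^^ n) (w b) \<in> N" if "b < k" for n b
    using wN[OF that] by (induction n) (auto intro: N_inv)
  have V'N: "cadj V x \<in> N" for x
  proof (rule orth_compl_orth_compl[OF N])
    have "V e = 0" if e: "e \<in> orth_compl N" for e
    proof (rule l2_eqI)
      fix i show "coord (V e) i = coord 0 i"
        using e wN' by (cases i) (auto simp: coordV orth_compl_def)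
    qed
    then show "cadj V x \<in> orth_compl (orth_compl N)" by (auto simp: orth_compl_def[of "orth_compl N"] cadj'[OF V])
  qed
  have V'V: "cadj V (V v) = v" if v: "v \<in> N" for v
  proof -
    have "v - cadj V (V v) = 0"
    proof (rule complete)
      show "v - cadj V (V v) \<in> N" using csubspaceD(4)[OF N(1) v V'N] .
      fix n b assume b: "b < k"
      have "V ((shift ^^ n) (w b)) = unit_l2 (n, b)"
        using coeff_op_member[OF on, of "(n, b)"] b by (simp add: V_def)
      then have "cinner (cadj V (V v)) ((shift ^^ n) (w b)) = coord (V v) (n, b)"
        by (simp add: cadj'[OF V] cinner_unit_right)
      then show "cinner (v - cadj V (V v)) ((shift ^^ n) (w b)) = 0"
        using b by (simp add: cinner_diff_left coordV)
    qed
    then show ?thesis by simp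
  qed
  have Vb: "V (bshift v) = bshift (V v)" for v
  proof (rule l2_eqI)
    fix i show "coord (V (bshift v)) i = coord (bshift (V v)) i"
      by (cases i) (simp add: coordV cinner_bshift)
  qed
  have V'shift: "cadj V (shift x) = shift (cadj V x)" for x
    by (rule eq_from_cinner)
       (simp add: cadj[OF V, symmetric] cinner_bshift[symmetric] Vb)

  define \<Gamma> where "\<Gamma> x = cadj P (cadj V x)" for x
  have \<Gamma>: "cbounded \<Gamma>" unfolding \<Gamma>_def by (rule cbounded_compose[OF cbounded_cadj[OF P] V'])
  have \<Gamma>': "cadj \<Gamma> y = V (P y)" for y
  proof (rule eq_from_cinner)
    fix z
    have "cinner z (cadj \<Gamma> y) = cinner (\<Gamma> z) y" by (rule cadj[OF \<Gamma>, symmetric])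
    also have "\<dots> = cinner z (V (P y))" unfolding \<Gamma>_def cadj'[OF P] cadj'[OF V] ..
    finally show "cinner z (cadj \<Gamma> y) = cinner z (V (P y))" .
  qed
  \<comment> \<open>on \<open>P L\<close> the adjoint of \<open>P\<close> takes the values of \<open>A\<close>, which commutes with the shift on \<open>L\<close>\<close>
  have P'shift: "cadj P (shift v) = shift (cadj P v)" if v: "v \<in> N" for v
  proof -
    have "N \<subseteq> {v. cadj P (shift v) = shift (cadj P v)}"
    proof (rule N_least)
      show "closed {v. cadj P (shift v) = shift (cadj P v)}"
        by (rule closed_eq_cbounded(1)[OF cbounded_compose[OF cbounded_cadj[OF P] cbounded_shift]
              cbounded_compose[OF cbounded_shift cbounded_cadj[OF P]]])
      fix x assume x: "x \<in> L"
      have "cadj P (shift (P x)) = A (shift x)" using Aeq[OF L_inv[OF x]] by (simp add: commP)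
      also have "\<dots> = shift (cadj P (P x))" using AL[OF x] Aeq[OF x] by simp
      finally show "P x \<in> {v. cadj P (shift v) = shift (cadj P v)}" by simp
    qed
    then show ?thesis using v by blast
  qed
  have comm: "\<Gamma> (shift x) = shift (\<Gamma> x)" for x
    unfolding \<Gamma>_def V'shift by (rule P'shift[OF V'N])
  have dom: "\<Gamma> (unit_l2 (n, b)) = 0" if "b \<ge> k" for n b
  proof -
    have "cadj V (unit_l2 (n, b)) = 0" using that by (simp add: V_def cadj_coeff_op_unit[OF on])
    then show ?thesis by (simp add: \<Gamma>_def cbounded_simps(3)[OF cbounded_cadj[OF P]])
  qed
  have ran: "coord (\<Gamma> x) (n, a) = 0" if "a \<ge> m" for x n a
    unfolding \<Gamma>_def cinner_unit_right[symmetric] cadj'[OF P] P_dom[OF that] by simp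

  have pos': "0 \<le> inner (A y - \<Gamma> (cadj \<Gamma> y)) y" for y
  proof -
    define z where "z = P y"
    define v where "v = cadj V (V z)"
    \<comment> \<open>pairing \<open>P y\<close> with \<open>P x\<close> for \<open>x\<close> in \<open>L\<close> is the form of \<open>A\<close>; the estimate extends to the closure\<close>
    have CS: "(inner z v')\<^sup>2 \<le> (norm v')\<^sup>2 * inner (A y) y" if "v' \<in> N" for v'
    proof -
      have "N \<subseteq> {v'. (inner z v')\<^sup>2 \<le> (norm v')\<^sup>2 * inner (A y) y}"
      proof (rule N_least)
        show "closed {v'. (inner z v')\<^sup>2 \<le> (norm v')\<^sup>2 * inner (A y) y}"
          by (intro closed_Collect_le continuous_intros)
        fix x assume x: "x \<in> L"
        have 1: "inner z (P x) = inner (A x) y"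
          unfolding z_def inner_cadj[OF P] Aeq[OF x] by (rule inner_commute)
        have 2: "(norm (P x))\<^sup>2 = inner (A x) x"
          unfolding power2_norm_eq_inner inner_cadj[OF P] Aeq[OF x] by (rule inner_commute)
        show "P x \<in> {v'. (inner z v')\<^sup>2 \<le> (norm v')\<^sup>2 * inner (A y) y}"
          unfolding mem_Collect_eq 1 2 by (rule positive_cauchy_schwarz[OF A A_sa' pos])
      qed
      then show ?thesis using that by blast
    qed
    have Vv: "V v = V z" unfolding v_def V_def by (rule coeff_op_cadj_coeff_op[OF on])
    have zv: "inner z v = (norm (V z))\<^sup>2"
      unfolding v_def inner_cadj[OF V, symmetric] by (simp add: power2_norm_eq_inner)
    have vv: "(norm v)\<^sup>2 = (norm (V z))\<^sup>2"
    proof -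
      have "(norm v)\<^sup>2 = inner (cadj V (V z)) v" unfolding power2_norm_eq_inner v_def ..
      also have "\<dots> = (norm (V z))\<^sup>2" unfolding inner_cadj'[OF V] Vv power2_norm_eq_inner ..
      finally show ?thesis .
    qed
    define s where "s = (norm (V z))\<^sup>2"
    have "s\<^sup>2 \<le> s * inner (A y) y"
      using CS[of v] V'N unfolding zv vv s_def[symmetric] by (simp add: v_def)
    moreover have "s \<ge> 0" by (simp add: s_def)
    ultimately have "s \<le> inner (A y) y"
      using pos[of y] by (cases "s = 0") (auto simp: power2_eq_square)
    moreover have "inner (\<Gamma> (cadj \<Gamma> y)) y = s"
      unfolding inner_cadj[OF \<Gamma>] \<Gamma>' s_def z_def power2_norm_eq_inner ..
    ultimately show ?thesis by (simp add: inner_diff_left)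
  qed

  \<comment> \<open>the difference is selfadjoint and vanishes on \<open>L\<close>\<close>
  have inM: "A y - \<Gamma> (cadj \<Gamma> y) \<in> M" for y
  proof (rule orth_compl_orth_compl[OF M])
    have "cinner (A y - \<Gamma> (cadj \<Gamma> y)) x = 0" if "x \<in> L" for x
    proof -
      have "\<Gamma> (cadj \<Gamma> x) = A x" unfolding \<Gamma>' \<Gamma>_def V'V[OF PN[OF that]] Aeq[OF that] ..
      moreover have "cinner (\<Gamma> (cadj \<Gamma> y)) x = cinner y (\<Gamma> (cadj \<Gamma> x))"
        by (simp add: cadj[OF \<Gamma>] cadj'[OF \<Gamma>])
      ultimately show ?thesis by (simp add: cinner_diff_left A_sa)
    qed
    then show "A y - \<Gamma> (cadj \<Gamma> y) \<in> orth_compl (orth_compl M)" 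
      unfolding L_def[symmetric] orth_compl_def[of L] by blast
  qed
  show ?thesis by (rule that[OF k \<Gamma> comm dom ran pos' inM])
qed

section \<open>Absolutely convergent Fourier series on the circle\<close>

abbreviation circle :: "real measure" where "circle \<equiv> lebesgue_on {0..2*pi}"

definition fseries :: "(nat \<Rightarrow> complex) \<Rightarrow> real \<Rightarrow> complex" where
  "fseries c t = (\<Sum>n. c n * cis (real n * t))"

lemma summable_fseries: "summable (\<lambda>n. norm (c n)) \<Longrightarrow> summable (\<lambda>n. c n * cis (real n * t))"
  by (rule summable_norm_cancel) (simp add: norm_mult)

lemma continuous_fseries:
  assumes "summable (\<lambda>n. norm (c n))"
  shows "continuous_on S (fseries c)"
proof -
  have "uniform_limit UNIV (\<lambda>n t. \<Sum>i<n. c i * cis (real i * t)) (\<lambda>t. \<Sum>i. c i * cis (real i * t)) sequentially"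
    by (rule Weierstrass_m_test[OF _ assms]) (simp add: norm_mult)
  then have "continuous_on UNIV (\<lambda>t. \<Sum>i. c i * cis (real i * t))"
    by (rule uniform_limit_theorem[rotated]) (auto intro!: always_eventually continuous_intros)
  then have "continuous_on UNIV (fseries c)" by (simp add: fseries_def[abs_def])
  then show ?thesis by (rule continuous_on_subset) simp
qed

lemma fseries_add: "fseries c (t + s) = fseries (\<lambda>n. c n * cis (real n * t)) s"
  by (simp add: fseries_def ring_distribs cis_mult[symmetric] mult.assoc)

lemma fseries_periodic: "fseries c (t + 2 * pi) = fseries c t"
proof -
  have "cis (real n * (t + 2 * pi)) = cis (real n * t)" for n
    using cis_multiple_2pi[of "real n"] by (simp add: ring_distribs cis_mult[symmetric] mult_ac)
  then show ?thesis by (simp add: fseries_def)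
qed

lemma integrable_circle: "continuous_on {0..2*pi} f \<Longrightarrow> integrable circle f"
  for f :: "real \<Rightarrow> 'a::euclidean_space"
  by (rule continuous_imp_integrable_real)

lemma integral_circle: "continuous_on {0..2*pi} f \<Longrightarrow> integral\<^sup>L circle f = integral {0..2*pi} f"
  for f :: "real \<Rightarrow> 'a::euclidean_space"
  by (rule lebesgue_integral_eq_integral[OF integrable_circle]) auto

lemma integral_circle_const: "(LINT t|circle. c) = of_real (2 * pi) * c" for c :: complex
  by (subst integral_circle) (auto simp: scaleR_conv_of_real)

lemma integral_circle_cis:
  "(LINT t|circle. cis (of_int k * t)) = (if k = 0 then 2 * of_real pi else 0)"
proof (cases "k = 0")
  case False
  define F where "F t = - \<i> * cis (of_int k * t) / of_int k" for t
  have "((\<lambda>t. cis (of_int k * t)) has_integral (F (2*pi) - F 0)) {0..2*pi}"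
  proof (rule fundamental_theorem_of_calculus)
    fix x :: real
    show "(F has_vector_derivative cis (of_int k * x)) (at x within {0..2*pi})"
      unfolding F_def cis_conv_exp using False
      by (auto intro!: derivative_eq_intros has_vector_derivative_real_field simp: field_simps)
  qed simp
  moreover have "F (2*pi) = F 0"
    using cis_multiple_2pi[of "of_int k"] by (simp add: F_def mult_ac)
  ultimately have "integral {0..2*pi} (\<lambda>t. cis (of_int k * t)) = 0"
    by (simp add: integral_unique)
  then show ?thesis using False by (subst integral_circle) (auto intro!: continuous_intros)
qed (use integral_circle_const[of 1] in simp)

text \<open>Absolute convergence permits termwise integration.\<close>

lemma fseries_expand:
  assumes c: "summable (\<lambda>n. norm (c n))" and g: "continuous_on {0..2*pi} g"
  shows "(\<lambda>n. c n * (LINT t|circle. cis (real n * t) * g t)) sums (LINT t|circle. fseries c t * g t)"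
proof -
  define f where "f n t = c n * (cis (real n * t) * g t)" for n t
  have f: "integrable circle (f n)" for n
    unfolding f_def by (intro integrable_circle continuous_intros g)
  have 1: "(LINT t|circle. norm (f n t)) = norm (c n) * (LINT t|circle. norm (g t))" for n
    by (simp add: f_def norm_mult)
  have "(\<lambda>n. integral\<^sup>L circle (f n)) sums (LINT t|circle. (\<Sum>n. f n t))"
  proof (rule sums_integral[OF f])
    show "AE t in circle. summable (\<lambda>n. norm (f n t))"
      by (rule AE_I2) (simp add: f_def norm_mult summable_mult2[OF c])
    show "summable (\<lambda>n. LINT t|circle. norm (f n t))"
      unfolding 1 by (rule summable_mult2[OF c])
  qed
  moreover have "(\<Sum>n. f n t) = fseries c t * g t" for t
    unfolding f_def fseries_def mult.assoc[symmetric]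
    by (rule suminf_mult2[symmetric]) (rule summable_fseries[OF c])
  moreover have "integral\<^sup>L circle (f n) = c n * (LINT t|circle. cis (real n * t) * g t)" for n
    unfolding f_def by simp
  ultimately show ?thesis by simp
qed

text \<open>Coefficients over all integers, so that index shifts in either direction need no case
  distinction.\<close>

definition zero_ext :: "(nat \<Rightarrow> complex) \<Rightarrow> int \<Rightarrow> complex" where
  "zero_ext d i = (if i < 0 then 0 else d (nat i))"

lemma fseries_coeff:
  assumes c: "summable (\<lambda>n. norm (c n))"
  shows "(LINT t|circle. fseries c t * cis (- of_int j * t)) = 2 * of_real pi * zero_ext c j"
proof -
  have *: "(\<lambda>n. c n * (LINT t|circle. cis (real n * t) * cis (- of_int j * t)))
      sums (LINT t|circle. fseries c t * cis (- of_int j * t))"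
    by (rule fseries_expand[OF c]) (intro continuous_intros)
  have "(LINT t|circle. cis (real n * t) * cis (- of_int j * t)) = (if int n = j then 2 * of_real pi else 0)" for n
    using integral_circle_cis[of "int n - j"] by (simp add: cis_mult algebra_simps)
  then have "(\<lambda>n. c n * (if int n = j then 2 * of_real pi else 0))
      sums (LINT t|circle. fseries c t * cis (- of_int j * t))" using * by simp
  moreover have "(\<lambda>n. c n * (if int n = j then 2 * of_real pi else 0)) sums (2 * of_real pi * zero_ext c j)"
  proof (cases "j < 0")
    case True
    then have "(\<lambda>n. c n * (if int n = j then 2 * of_real pi else 0)) = (\<lambda>n. 0)" by auto
    then show ?thesis using True by (simp add: zero_ext_def)
  next
    case False
    then have "(\<lambda>n. c n * (if int n = j then 2 * of_real pi else 0))
        = (\<lambda>n. if n = nat j then c n * (2 * of_real pi) else 0)" by (intro ext) auto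
    moreover have "2 * of_real pi * zero_ext c j = c (nat j) * (2 * of_real pi)"
      using False by (simp add: zero_ext_def)
    ultimately show ?thesis using sums_single[of "nat j" "\<lambda>n. c n * (2 * of_real pi)"] by (simp only:)
  qed
  ultimately show ?thesis by (rule sums_unique2)
qed

text \<open>Expanding the first factor only leaves the Fourier coefficients of the second.\<close>

lemma fseries_inner:
  assumes c: "summable (\<lambda>n. norm (c n))" and d: "summable (\<lambda>n. norm (d n))"
  shows "(\<lambda>n. 2 * of_real pi * (c n * cnj (zero_ext d (int n - j))))
           sums (LINT t|circle. fseries c t * (cnj (fseries d t) * cis (- of_int j * t)))"
proof -
  have *: "(\<lambda>n. c n * (LINT t|circle. cis (real n * t) * (cnj (fseries d t) * cis (- of_int j * t))))
      sums (LINT t|circle. fseries c t * (cnj (fseries d t) * cis (- of_int j * t)))"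
    by (rule fseries_expand[OF c]) (intro continuous_intros continuous_fseries[OF d])
  have "(LINT t|circle. cis (real n * t) * (cnj (fseries d t) * cis (- of_int j * t)))
      = 2 * of_real pi * cnj (zero_ext d (int n - j))" for n
  proof -
    have "cis (real n * t) * (cnj (fseries d t) * cis (- of_int j * t))
        = cnj (fseries d t * cis (- of_int (int n - j) * t))" for t
      by (simp add: cis_cnj cis_mult algebra_simps)
    then have "(LINT t|circle. cis (real n * t) * (cnj (fseries d t) * cis (- of_int j * t)))
        = (LINT t|circle. cnj (fseries d t * cis (- of_int (int n - j) * t)))" by (simp only:)
    also have "\<dots> = cnj (LINT t|circle. fseries d t * cis (- of_int (int n - j) * t))"
      by (rule integral_bounded_linear[OF bounded_linear_cnj])
         (intro integrable_circle continuous_intros continuous_fseries[OF d])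
    finally show ?thesis unfolding fseries_coeff[OF d] by simp
  qed
  with * show ?thesis by (simp add: mult_ac)
qed

lemma parseval:
  assumes c: "summable (\<lambda>n. norm (c n))"
  shows "(\<lambda>n. 2 * pi * (cmod (c n))\<^sup>2) sums (LINT t|circle. (cmod (fseries c t))\<^sup>2)"
proof -
  have "(\<lambda>n. 2 * of_real pi * (c n * cnj (zero_ext c (int n - 0))))
      sums (LINT t|circle. fseries c t * (cnj (fseries c t) * cis (- of_int 0 * t)))"
    by (rule fseries_inner[OF c c])
  moreover have "2 * of_real pi * (c n * cnj (zero_ext c (int n - 0))) = complex_of_real (2 * pi * (cmod (c n))\<^sup>2)" for n
    by (simp add: zero_ext_def complex_norm_square[symmetric])
  moreover have "fseries c t * (cnj (fseries c t) * cis (- of_int 0 * t)) = complex_of_real ((cmod (fseries c t))\<^sup>2)" for t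
    by (simp add: complex_norm_square[symmetric])
  ultimately have "(\<lambda>n. complex_of_real (2 * pi * (cmod (c n))\<^sup>2)) sums (LINT t|circle. of_real ((cmod (fseries c t))\<^sup>2))"
    by (simp only:)
  then show ?thesis by (simp only: integral_complex_of_real sums_of_real_iff)
qed

section \<open>Poisson kernel and maximal function\<close>

definition poisson :: "real \<Rightarrow> real \<Rightarrow> real" where
  "poisson r s = (1 - r\<^sup>2) / (1 - 2 * r * cos s + r\<^sup>2)"

lemma poisson_denom_pos:
  fixes r s :: real
  assumes "0 \<le> r" "r < 1" shows "1 - 2 * r * cos s + r\<^sup>2 > 0"
proof -
  have "r * cos s \<le> r" using mult_left_le[of "cos s" r] assms by simp
  moreover have "(1 - r)\<^sup>2 > 0" using assms by simp
  ultimately show ?thesis by (simp add: power2_eq_square algebra_simps)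
qed

lemma poisson_nonneg: "0 \<le> r \<Longrightarrow> r < 1 \<Longrightarrow> 0 \<le> poisson r s"
  unfolding poisson_def using poisson_denom_pos[of r s] by (intro divide_nonneg_pos) (auto simp: power_le_one)

lemma continuous_poisson: "0 \<le> r \<Longrightarrow> r < 1 \<Longrightarrow> continuous_on S (poisson r)"
  unfolding poisson_def using poisson_denom_pos[of r] by (intro continuous_intros) (auto simp: less_imp_neq[symmetric])

lemma poisson_reflect: "poisson r (2 * pi - s) = poisson r s"
  by (simp add: poisson_def cos_diff)

lemma poisson_deriv:
  assumes r: "0 \<le> r" "r < 1"
  shows "(poisson r has_real_derivative
           (- ((1 - r\<^sup>2) * (2 * r * sin s)) / (1 - 2 * r * cos s + r\<^sup>2)\<^sup>2)) (at s)"
  unfolding poisson_def using poisson_denom_pos[OF r, of s]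
  by (auto intro!: derivative_eq_intros simp: power2_eq_square)

lemma fseries_geometric:
  assumes r: "0 \<le> r" "r < 1"
  shows "fseries (\<lambda>n. of_real r ^ n) s = 1 / (1 - of_real r * cis s)"
proof -
  have "of_real r ^ n * cis (real n * s) = (of_real r * cis s) ^ n" for n
    by (simp add: power_mult_distrib Complex.DeMoivre)
  moreover have "norm (of_real r * cis s) < 1" using r by (simp add: norm_mult)
  ultimately show ?thesis unfolding fseries_def by (simp add: suminf_geometric)
qed

text \<open>With \<open>z = r e\<^sup>i\<^sup>s\<close> both sides are \<open>(1 - z \<zeta>) / ((1 - z) (1 - \<zeta>))\<close>, where \<open>\<zeta>\<close> is the conjugate of
  \<open>z\<close>.\<close>

lemma poisson_eq:
  assumes r: "0 \<le> r" "r < 1"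
  shows "of_real (poisson r s) = fseries (\<lambda>n. of_real r ^ n) s + cnj (fseries (\<lambda>n. of_real r ^ n) s) - 1"
proof -
  define z where "z = of_real r * cis s"
  have "cmod z < 1" using r by (simp add: z_def norm_mult)
  then have z1: "1 - z \<noteq> 0" "1 - cnj z \<noteq> 0"
    by auto
  have quot: "(b + a - a * b) / (a * b) = 1 / a + 1 / b - 1" if "a \<noteq> 0" "b \<noteq> 0" for a b :: complex
    using that by (simp add: field_simps)
  have zz: "z * cnj z = of_real (r\<^sup>2)"
    using r unfolding complex_norm_square[symmetric] by (simp add: z_def norm_mult)
  have "(1 - z) * (1 - cnj z) = 1 - (z + cnj z) + z * cnj z" by (simp add: algebra_simps)
  also have "\<dots> = of_real (1 - 2 * r * cos s + r\<^sup>2)"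
    unfolding complex_add_cnj zz by (simp add: z_def)
  finally have d: "(1 - z) * (1 - cnj z) = of_real (1 - 2 * r * cos s + r\<^sup>2)" .
  have "of_real (poisson r s) = (1 - z * cnj z) / ((1 - z) * (1 - cnj z))"
    unfolding d zz poisson_def by simp
  also have "\<dots> = ((1 - cnj z) + (1 - z) - (1 - z) * (1 - cnj z)) / ((1 - z) * (1 - cnj z))"
    by (simp add: algebra_simps)
  also have "\<dots> = 1 / (1 - z) + 1 / (1 - cnj z) - 1"
    by (rule quot[OF z1])
  finally show ?thesis unfolding fseries_geometric[OF r] z_def[symmetric] by simp
qed

text \<open>Paired with an analytic function, the geometric series in the kernel and its constant term each
  give the constant coefficient and cancel. The conjugate geometric series gives the dilation.\<close>

lemma poisson_formula:
  assumes c: "summable (\<lambda>n. norm (c n))" and r: "0 \<le> r" "r < 1"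
  shows "(\<lambda>n. 2 * of_real pi * (c n * of_real r ^ n)) sums (LINT s|circle. of_real (poisson r s) * fseries c s)"
proof -
  let ?q = "fseries (\<lambda>n. of_real r ^ n)"
  have q: "summable (\<lambda>n. norm (complex_of_real r ^ n))" using r by (simp add: norm_power)
  have 1: "(LINT s|circle. ?q s * fseries c s) = 2 * of_real pi * c 0"
  proof -
    have "(\<lambda>n. of_real r ^ n * (LINT t|circle. cis (real n * t) * fseries c t)) sums (LINT t|circle. ?q t * fseries c t)"
      by (rule fseries_expand[OF q continuous_fseries[OF c]])
    moreover have "(LINT t|circle. cis (real n * t) * fseries c t) = (if n = 0 then 2 * of_real pi * c 0 else 0)" for n
      using fseries_coeff[OF c, of "- int n"] by (simp add: zero_ext_def mult.commute)
    ultimately have "(\<lambda>n. if n = 0 then 2 * of_real pi * c 0 else 0) sums (LINT t|circle. ?q t * fseries c t)"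
      by (simp add: if_distrib cong: if_cong)
    moreover have "(\<lambda>n. if n = 0 then 2 * of_real pi * c 0 else 0) sums (2 * of_real pi * c 0)"
      using sums_single[of 0 "\<lambda>n. 2 * of_real pi * c 0"] by simp
    ultimately show ?thesis by (rule sums_unique2)
  qed
  have 2: "(\<lambda>n. 2 * of_real pi * (c n * of_real r ^ n)) sums (LINT s|circle. cnj (?q s) * fseries c s)"
    using fseries_inner[OF c q, of 0] by (simp add: zero_ext_def mult.commute[of "fseries c _"])
  have 3: "(LINT s|circle. fseries c s) = 2 * of_real pi * c 0"
    using fseries_coeff[OF c, of 0] by (simp add: zero_ext_def)
  have "(LINT s|circle. of_real (poisson r s) * fseries c s)
      = (LINT s|circle. (?q s * fseries c s + cnj (?q s) * fseries c s) - fseries c s)"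
    unfolding poisson_eq[OF r] by (simp add: algebra_simps)
  also have "\<dots> = ((LINT s|circle. ?q s * fseries c s) + (LINT s|circle. cnj (?q s) * fseries c s)) - (LINT s|circle. fseries c s)"
    by (subst Bochner_Integration.integral_diff, (intro integrable_circle continuous_intros continuous_fseries c q)+,
        subst Bochner_Integration.integral_add, (intro integrable_circle continuous_intros continuous_fseries c q)+) simp
  also have "\<dots> = (LINT s|circle. cnj (?q s) * fseries c s)" by (simp add: 1 3)
  finally show ?thesis using 2 by simp
qed

lemma integral_reflect_circle:
  fixes w :: "real \<Rightarrow> real"
  shows "integral {0..pi} (\<lambda>s. w (2 * pi - s)) = integral {pi..2*pi} w"
proof -
  have "integral {0..pi} ((\<lambda>x. w (- x)) \<circ> ((+) (- 2 * pi))) = integral {0 + - 2 * pi..pi + - 2 * pi} (\<lambda>x. w (- x))"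
    by (rule integral_shift_Icc_real)
  also have "\<dots> = integral {- (2 * pi)..- pi} (\<lambda>x. w (- x))" by simp
  also have "\<dots> = integral {pi..2 * pi} w" by (rule Henstock_Kurzweil_Integration.integral_reflect_real)
  finally show ?thesis by (simp add: o_def)
qed

text \<open>A decreasing nonnegative kernel is a superposition of indicator functions of intervals
  \<open>[0, s]\<close>, and on each of these the mean of \<open>u\<close> is at most \<open>l\<close>. In the proof this is an integration
  by parts.\<close>

lemma kernel_average_le:
  fixes k k' u :: "real \<Rightarrow> real"
  assumes b: "0 \<le> b" and u: "continuous_on {0..b} u"
    and k: "\<And>s. s \<in> {0..b} \<Longrightarrow> (k has_real_derivative k' s) (at s)"
    and k': "\<And>s. s \<in> {0..b} \<Longrightarrow> k' s \<le> 0" and kb: "k b \<ge> 0"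
    and avg: "\<And>s. s \<in> {0..b} \<Longrightarrow> integral {0..s} u \<le> l * s"
  shows "integral {0..b} (\<lambda>s. k s * u s) \<le> l * integral {0..b} k"
proof -
  have ck: "continuous_on {0..b} k"
    by (intro continuous_at_imp_continuous_on ballI) (rule DERIV_isCont[OF k])
  define I where "I s = integral {0..s} (\<lambda>x. k x * (l - u x))" for s
  define U where "U s = integral {0..s} u" for s
  \<comment> \<open>the part of the integration by parts that remains an integral; \<open>G\<close> is nondecreasing\<close>
  define G where "G s = I s - (l * s - U s) * k s" for s
  have I: "(I has_real_derivative k s * (l - u s)) (at s within {0..b})" if "s \<in> {0..b}" for s
    unfolding I_def using that by (intro integral_has_real_derivative continuous_intros u ck)
  have U: "(U has_real_derivative u s) (at s within {0..b})" if "s \<in> {0..b}" for s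
    unfolding U_def using that by (intro integral_has_real_derivative u)
  have G: "(G has_real_derivative - ((l * s - U s) * k' s)) (at s within {0..b})" if "s \<in> {0..b}" for s
  proof -
    have "((\<lambda>s. (l * s - U s) * k s) has_real_derivative (l - u s) * k s + k' s * (l * s - U s))
        (at s within {0..b})"
      by (rule DERIV_mult[OF DERIV_diff[OF DERIV_cmult_Id U[OF that]]
            has_field_derivative_at_within[OF k[OF that]]])
    from DERIV_diff[OF I[OF that] this] show ?thesis
      unfolding G_def[abs_def] by (rule DERIV_cong) (simp add: algebra_simps)
  qed
  have "G 0 \<le> G b"
  proof (rule DERIV_nonneg_imp_increasing_open[OF b])
    fix s assume s: "0 < s" "s < b"
    then have "at s within {0..b} = at s" by (intro at_within_interior) simp
    then have "(G has_real_derivative - ((l * s - U s) * k' s)) (at s)" using G[of s] s by simp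
    moreover have "- ((l * s - U s) * k' s) \<ge> 0"
      using avg[of s] k'[of s] s by (simp add: U_def mult_nonneg_nonpos)
    ultimately show "\<exists>y. (G has_real_derivative y) (at s) \<and> 0 \<le> y" by blast
  next
    show "continuous_on {0..b} G" by (rule DERIV_continuous_on[OF G])
  qed
  moreover have "G 0 = 0" by (simp add: G_def I_def U_def)
  moreover have "(l * b - U b) * k b \<ge> 0" using avg[of b] kb b by (simp add: U_def)
  ultimately have "0 \<le> I b" by (simp add: G_def)
  also have "I b = integral {0..b} (\<lambda>s. l * k s - k s * u s)"
    unfolding I_def by (simp add: algebra_simps)
  also have "\<dots> = integral {0..b} (\<lambda>s. l * k s) - integral {0..b} (\<lambda>s. k s * u s)"
    by (intro Henstock_Kurzweil_Integration.integral_diff integrable_continuous_interval continuous_intros ck u)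
  finally show ?thesis by simp
qed

text \<open>The total mass is the Poisson integral of the constant function 1, and the kernel is symmetric.\<close>

lemma integral_poisson_half:
  assumes r: "0 \<le> r" "r < 1"
  shows "integral {0..pi} (poisson r) = pi"
proof -
  define c where "c n = (if n = 0 then 1 else 0 :: complex)" for n :: nat
  have c: "summable (\<lambda>n. norm (c n))" by (rule summable_finite[of "{0}"]) (auto simp: c_def)
  have "fseries c s = 1" for s
    unfolding fseries_def c_def using suminf_finite[of "{0}" "\<lambda>n. (if n = 0 then 1 else 0) * cis (real n * s)"] by simp
  then have "(\<lambda>n. 2 * of_real pi * (c n * of_real r ^ n)) sums (LINT s|circle. complex_of_real (poisson r s))"
    using poisson_formula[OF c r] by simp
  moreover have "(\<lambda>n. 2 * of_real pi * (c n * of_real r ^ n)) sums (2 * of_real pi)"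
  proof -
    have "(\<lambda>n. 2 * of_real pi * (c n * of_real r ^ n)) = (\<lambda>n. if n = 0 then 2 * complex_of_real pi else 0)"
      by (auto simp: c_def)
    then show ?thesis using sums_single[of 0 "\<lambda>n. 2 * complex_of_real pi"] by simp
  qed
  ultimately have "complex_of_real (LINT s|circle. poisson r s) = complex_of_real (2 * pi)"
    using sums_unique2 by fastforce
  then have "(LINT s|circle. poisson r s) = 2 * pi" by (metis of_real_eq_iff)
  then have "integral {0..2*pi} (poisson r) = 2 * pi"
    by (simp add: integral_circle[OF continuous_poisson[OF r]])
  moreover have "integral {0..pi} (poisson r) + integral {pi..2*pi} (poisson r) = integral {0..2*pi} (poisson r)"
    by (intro Henstock_Kurzweil_Integration.integral_combine integrable_continuous_interval continuous_poisson r) auto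
  moreover have "integral {pi..2*pi} (poisson r) = integral {0..pi} (poisson r)"
    unfolding integral_reflect_circle[symmetric] poisson_reflect ..
  ultimately show ?thesis by simp
qed

lemma poisson_average_le:
  assumes r: "0 \<le> r" "r < 1" and u: "continuous_on {0..pi} u"
    and avg: "\<And>s. s \<in> {0..pi} \<Longrightarrow> integral {0..s} u \<le> l * s"
  shows "integral {0..pi} (\<lambda>s. poisson r s * u s) \<le> l * pi"
proof -
  have "integral {0..pi} (\<lambda>s. poisson r s * u s) \<le> l * integral {0..pi} (poisson r)"
  proof (rule kernel_average_le[OF pi_ge_zero u poisson_deriv[OF r]])
    fix s assume s: "s \<in> {0..pi}"
    have "0 \<le> sin s" using s by (intro sin_ge_zero) auto
    moreover have "0 \<le> 1 - r\<^sup>2" using r by (simp add: power_le_one)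
    ultimately have "0 \<le> (1 - r\<^sup>2) * (2 * r * sin s) / (1 - 2 * r * cos s + r\<^sup>2)\<^sup>2"
      using r(1) by (intro divide_nonneg_nonneg mult_nonneg_nonneg) auto
    then show "- ((1 - r\<^sup>2) * (2 * r * sin s)) / (1 - 2 * r * cos s + r\<^sup>2)\<^sup>2 \<le> 0"
      unfolding minus_divide_left[symmetric] by linarith
  qed (use poisson_nonneg[OF r] avg in auto)
  then show ?thesis by (simp only: integral_poisson_half[OF r])
qed

text \<open>The value at radius \<open>r\<close> is the Poisson integral over the two half circles on either side of \<open>t\<close>.
  On each of them the kernel decreases away from \<open>t\<close> and has mass \<open>\<pi>\<close>, so its integral against
  \<open>\<bar>f\<bar>\<close> is at most \<open>l \<pi>\<close>, and the kernel is normalized by \<open>2 \<pi>\<close>.\<close>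

lemma dilation_le_one_sided_averages:
  assumes c: "summable (\<lambda>n. norm (c n))" and r: "0 \<le> r" "r < 1"
    and right: "\<And>s. s \<in> {0..pi} \<Longrightarrow> integral {0..s} (\<lambda>x. cmod (fseries c (t + x))) \<le> l * s"
    and left: "\<And>s. s \<in> {0..pi} \<Longrightarrow> integral {0..s} (\<lambda>x. cmod (fseries c (t - x))) \<le> l * s"
  shows "cmod (fseries (\<lambda>n. c n * of_real r ^ n) t) \<le> l"
proof -
  define d where "d n = c n * cis (real n * t)" for n
  have d: "summable (\<lambda>n. norm (d n))" using c by (simp add: d_def norm_mult)
  have fd: "fseries d s = fseries c (t + s)" for s unfolding d_def fseries_add ..
  have sumd: "fseries (\<lambda>n. c n * of_real r ^ n) t = (\<Sum>n. d n * of_real r ^ n)"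
    by (simp add: fseries_def d_def mult_ac)
  have "2 * of_real pi * fseries (\<lambda>n. c n * of_real r ^ n) t = (LINT s|circle. of_real (poisson r s) * fseries d s)"
  proof -
    have "summable (\<lambda>n. d n * of_real r ^ n)"
      by (rule summable_norm_cancel, rule summable_comparison_test'[OF d, of 0])
         (use r in \<open>simp add: norm_mult norm_power power_le_one mult_left_le\<close>)
    then have "(\<Sum>n. 2 * of_real pi * (d n * of_real r ^ n)) = 2 * of_real pi * (\<Sum>n. d n * of_real r ^ n)"
      by (rule suminf_mult)
    then show ?thesis using sums_unique[OF poisson_formula[OF d r]] sumd by simp
  qed
  then have "2 * pi * cmod (fseries (\<lambda>n. c n * of_real r ^ n) t) = cmod (LINT s|circle. of_real (poisson r s) * fseries d s)"
    by (simp add: norm_mult flip: \<open>2 * of_real pi * fseries _ t = _\<close>)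
  also have "\<dots> \<le> (LINT s|circle. cmod (of_real (poisson r s) * fseries d s))"
    by (rule integral_norm_bound)
  also have "\<dots> = (LINT s|circle. poisson r s * cmod (fseries d s))"
    by (simp add: norm_mult poisson_nonneg[OF r])
  also have "\<dots> = integral {0..2*pi} (\<lambda>s. poisson r s * cmod (fseries d s))"
    by (intro integral_circle continuous_intros continuous_poisson continuous_fseries r d)
  also have "\<dots> = integral {0..pi} (\<lambda>s. poisson r s * cmod (fseries d s)) + integral {pi..2*pi} (\<lambda>s. poisson r s * cmod (fseries d s))"
    by (intro Henstock_Kurzweil_Integration.integral_combine[symmetric] integrable_continuous_interval
        continuous_intros continuous_poisson continuous_fseries r d) auto
  also have "integral {pi..2*pi} (\<lambda>s. poisson r s * cmod (fseries d s)) = integral {0..pi} (\<lambda>s. poisson r s * cmod (fseries c (t - s)))"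
  proof -
    have "fseries d (2 * pi - s) = fseries c (t - s)" for s
      unfolding fd using fseries_periodic[of c "t - s"] by (simp add: algebra_simps)
    then show ?thesis unfolding integral_reflect_circle[symmetric] poisson_reflect by simp
  qed
  also have "integral {0..pi} (\<lambda>s. poisson r s * cmod (fseries d s)) \<le> l * pi"
    unfolding fd
    by (rule poisson_average_le[OF r _ right])
       (intro continuous_intros continuous_on_compose2[OF continuous_fseries[OF c, of UNIV]] subset_UNIV)
  also have "integral {0..pi} (\<lambda>s. poisson r s * cmod (fseries c (t - s))) \<le> l * pi"
    by (rule poisson_average_le[OF r _ left])
       (intro continuous_intros continuous_on_compose2[OF continuous_fseries[OF c, of UNIV]] subset_UNIV)
  finally show ?thesis by simp
qed

lemma sum_disjoint_interval_integrals_le: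
  fixes u :: "real \<Rightarrow> real"
  assumes F: "finite F" and u: "continuous_on {A..D} u" "\<And>x. x \<in> {A..D} \<Longrightarrow> 0 \<le> u x"
    and sub: "\<And>i. i \<in> F \<Longrightarrow> cball (a i) (e i) \<subseteq> {A..D}"
    and disj: "pairwise (\<lambda>i j. disjnt (cball (a i) (e i)) (cball (a j) (e j))) F"
  shows "(\<Sum>i\<in>F. integral (cball (a i) (e i)) u) \<le> integral {A..D} u"
proof -
  let ?I = "\<lambda>i. cball (a i) (e i)"
  have u_int: "u integrable_on ?I i" if "i \<in> F" for i
    using sub[OF that] u(1) unfolding cball_eq_atLeastAtMost
    by (intro integrable_continuous_interval) (rule continuous_on_subset)
  have r: "((\<lambda>x. if x \<in> ?I i then u x else 0) has_integral integral (?I i) u) {A..D}" if "i \<in> F" for i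
    by (rule iffD2[OF has_integral_restrict[OF sub[OF that]] integrable_integral[OF u_int[OF that]]])
  have "((\<lambda>x. \<Sum>i\<in>F. if x \<in> ?I i then u x else 0) has_integral (\<Sum>i\<in>F. integral (?I i) u)) {A..D}"
    by (intro has_integral_sum F r)
  moreover have "(u has_integral integral {A..D} u) {A..D}"
    by (intro integrable_integral integrable_continuous_interval u)
  moreover have "(\<Sum>i\<in>F. if x \<in> ?I i then u x else 0) \<le> u x" if x: "x \<in> {A..D}" for x
  proof (cases "\<exists>i\<in>F. x \<in> ?I i")
    case True
    then obtain i where i: "i \<in> F" "x \<in> ?I i" by blast
    have "(\<Sum>j\<in>F. if x \<in> ?I j then u x else 0) = (\<Sum>j\<in>{i}. if x \<in> ?I j then u x else 0)"
    proof (rule sum.mono_neutral_right[OF F])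
      show "\<forall>j\<in>F - {i}. (if x \<in> ?I j then u x else 0) = 0"
        using disj i unfolding pairwise_def disjnt_def by (metis DiffD1 DiffD2 IntI empty_iff singletonI)
    qed (use i in auto)
    then show ?thesis using i by simp
  next
    case False
    then have "(\<Sum>i\<in>F. if x \<in> ?I i then u x else 0) = 0" by (intro sum.neutral) auto
    then show ?thesis using u(2)[OF x] by simp
  qed
  ultimately show ?thesis by (rule has_integral_le)
qed

text \<open>The Vitali covering lemma selects disjoint intervals whose fivefold enlargements still cover \<open>E\<close>.
  The length of each interval is at most the integral of \<open>u\<close> over it divided by \<open>l\<close>, and by
  disjointness these integrals add up to at most the whole one.\<close>

lemma vitali_measure_le:
  fixes u :: "real \<Rightarrow> real" and a e :: "'i \<Rightarrow> real"
  assumes u: "continuous_on {A..D} u" "\<And>x. x \<in> {A..D} \<Longrightarrow> 0 \<le> u x" and l: "l > 0"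
    and cov: "E \<subseteq> (\<Union>i\<in>K. cball (a i) (e i))" and e: "\<And>i. i \<in> K \<Longrightarrow> 0 < e i \<and> e i \<le> B"
    and sub: "\<And>i. i \<in> K \<Longrightarrow> cball (a i) (e i) \<subseteq> {A..D}"
    and large: "\<And>i. i \<in> K \<Longrightarrow> l * (2 * e i) \<le> integral (cball (a i) (e i)) u"
  shows "emeasure lborel E \<le> ennreal (5 / l * integral {A..D} u)"
proof -
  have "\<exists>C. countable C \<and> C \<subseteq> K \<and>
      pairwise (\<lambda>i j. disjnt (cball (a i) (e i)) (cball (a j) (e j))) C \<and>
      E \<subseteq> (\<Union>i\<in>C. cball (a i) (5 * e i))"
    by (rule Vitali_covering_lemma_cballs[OF cov e]) (assumption, (intro exI conjI; assumption))
  then obtain C where C: "countable C" "C \<subseteq> K"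
      "pairwise (\<lambda>i j. disjnt (cball (a i) (e i)) (cball (a j) (e j))) C"
      "E \<subseteq> (\<Union>i\<in>C. cball (a i) (5 * e i))" by (elim exE conjE)
  let ?J = "\<lambda>i. cball (a i) (5 * e i)"
  have fin: "measure lborel (\<Union>i\<in>F. ?J i) \<le> 5 / l * integral {A..D} u" if F: "finite F" "F \<subseteq> C" for F
  proof -
    have FK: "F \<subseteq> K" using F C(2) by blast
    have "measure lborel (\<Union>i\<in>F. ?J i) \<le> (\<Sum>i\<in>F. measure lborel (?J i))"
      by (rule measure_UNION_le[OF F(1)]) auto
    also have "\<dots> \<le> (\<Sum>i\<in>F. 5 / l * integral (cball (a i) (e i)) u)"
    proof (rule sum_mono)
      fix i assume "i \<in> F"
      then have i: "i \<in> K" using FK by blast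
      have "measure lborel (?J i) = 10 * e i"
        using e[OF i] unfolding cball_eq_atLeastAtMost by (simp add: measure_lborel_Icc)
      also have "\<dots> = 5 / l * (l * (2 * e i))" using l by simp
      also have "\<dots> \<le> 5 / l * integral (cball (a i) (e i)) u"
        using l by (intro mult_left_mono large i) auto
      finally show "measure lborel (?J i) \<le> 5 / l * integral (cball (a i) (e i)) u" .
    qed
    also have "\<dots> = 5 / l * (\<Sum>i\<in>F. integral (cball (a i) (e i)) u)" by (simp add: sum_distrib_left)
    also have "\<dots> \<le> 5 / l * integral {A..D} u"
      using l F FK by (intro mult_left_mono sum_disjoint_interval_integrals_le u sub pairwise_subset[OF C(3)]) auto
    finally show ?thesis .
  qed
  show ?thesis
  proof (cases "C = {}")
    case True
    then show ?thesis using C(4) by simp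
  next
    case False
    define S where "S n = ?J (from_nat_into C n)" for n
    have SC: "from_nat_into C n \<in> C" for n by (rule from_nat_into[OF False])
    have S: "S n \<in> fmeasurable lborel" for n
      unfolding S_def using emeasure_lborel_cball_finite[of "a (from_nat_into C n)"]
      by (intro fmeasurableI) (simp_all add: infinity_ennreal_def)
    have B: "measure lborel (\<Union>i\<le>n. S i) \<le> 5 / l * integral {A..D} u" for n
    proof -
      have "(\<Union>i\<le>n. S i) = (\<Union>i\<in>from_nat_into C ` {..n}. ?J i)" by (auto simp: S_def)
      then show ?thesis using fin[of "from_nat_into C ` {..n}"] SC by auto
    qed
    have US: "(\<Union>n. S n) = (\<Union>i\<in>C. ?J i)"
    proof -
      have "(\<Union>n. S n) = (\<Union>i\<in>range (from_nat_into C). ?J i)" by (simp add: S_def)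
      then show ?thesis unfolding range_from_nat_into[OF False C(1)] .
    qed
    have fm: "(\<Union>n. S n) \<in> fmeasurable lborel" by (rule fmeasurable_countable_Union[OF S B])
    have "emeasure lborel E \<le> emeasure lborel (\<Union>n. S n)"
      using C(4) fm unfolding US by (intro emeasure_mono) (auto dest: fmeasurableD)
    also have "\<dots> = ennreal (measure lborel (\<Union>n. S n))" by (rule emeasure_eq_measure2[OF fm])
    also have "\<dots> \<le> ennreal (5 / l * integral {A..D} u)"
      by (rule ennreal_leI) (rule measure_countable_Union_le[OF S B])
    finally show ?thesis .
  qed
qed

lemma integral_periodic_twice:
  fixes u :: "real \<Rightarrow> real"
  assumes u: "continuous_on UNIV u" and per: "\<And>t. u (t + 2 * pi) = u t"
  shows "integral {-pi..3*pi} u = 2 * integral {0..2*pi} u"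
proof -
  have ui: "u integrable_on {a..b}" for a b
    by (intro integrable_continuous_interval continuous_on_subset[OF u]) auto
  have comp: "u \<circ> (+) (2 * pi) = u" by (rule ext) (simp add: per add.commute[of "2 * pi"])
  have "integral {-pi..0} u = integral {pi..2*pi} u"
    using integral_shift_Icc_real[of "-pi" 0 u "2 * pi"] comp by simp
  moreover have "integral {2*pi..3*pi} u = integral {0..pi} u"
    using integral_shift_Icc_real[of 0 pi u "2 * pi"] comp by simp
  moreover have "integral {-pi..0} u + integral {0..2*pi} u = integral {-pi..2*pi} u"
    by (intro Henstock_Kurzweil_Integration.integral_combine ui) auto
  moreover have "integral {-pi..2*pi} u + integral {2*pi..3*pi} u = integral {-pi..3*pi} u"
    by (intro Henstock_Kurzweil_Integration.integral_combine ui) auto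
  moreover have "integral {0..pi} u + integral {pi..2*pi} u = integral {0..2*pi} u"
    by (intro Henstock_Kurzweil_Integration.integral_combine ui) auto
  ultimately show ?thesis by simp
qed

text \<open>The set where the radial maximal function of the power series with coefficients \<open>c\<close> exceeds \<open>l\<close>.\<close>

definition exceptional :: "(nat \<Rightarrow> complex) \<Rightarrow> real \<Rightarrow> real set" where
  "exceptional c l = {t \<in> {0..2*pi}. \<exists>r\<in>{0..<1}. cmod (fseries (\<lambda>n. c n * of_real r ^ n) t) > l}"

lemma summable_dilation:
  assumes c: "summable (\<lambda>n. norm (c n))" and r: "0 \<le> r" "r \<le> 1"
  shows "summable (\<lambda>n. norm (c n * complex_of_real r ^ n))"
  by (rule summable_comparison_test'[OF c, of 0])
     (use r in \<open>simp add: norm_mult norm_power power_le_one mult_left_le\<close>)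

text \<open>The radii form an uncountable set, but the set of angles belonging to one radius is open.\<close>

lemma exceptional_sets:
  assumes c: "summable (\<lambda>n. norm (c n))"
  shows "exceptional c l \<in> sets borel"
proof -
  have "open {t. cmod (fseries (\<lambda>n. c n * of_real r ^ n) t) > l}" if "r \<in> {0..<1}" for r
    using that by (intro open_Collect_less continuous_intros continuous_fseries summable_dilation c) auto
  then have "open (\<Union>r\<in>{0..<1}. {t. cmod (fseries (\<lambda>n. c n * of_real r ^ n) t) > l})" by blast
  moreover have "exceptional c l = {0..2*pi} \<inter> (\<Union>r\<in>{0..<1}. {t. cmod (fseries (\<lambda>n. c n * of_real r ^ n) t) > l})"
    by (auto simp: exceptional_def)
  ultimately show ?thesis by simp
qed

text \<open>At an exceptional angle some one-sided average exceeds \<open>l\<close>, so the intervals with large average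
  cover the exceptional set. They leave \<open>[0, 2 \<pi>]\<close> by at most \<open>\<pi>\<close> on either side. The constant 10
  is the factor 5 of the covering lemma times the two periods over which the integral then extends.\<close>

lemma maximal_inequality:
  assumes c: "summable (\<lambda>n. norm (c n))" and l: "l > 0"
  shows "emeasure lborel (exceptional c l) \<le> ennreal (10 / l * integral {0..2*pi} (\<lambda>s. cmod (fseries c s)))"
proof -
  define u where "u s = cmod (fseries c s)" for s
  have u: "continuous_on S u" for S unfolding u_def by (intro continuous_intros continuous_fseries c)
  \<comment> \<open>the one-sided averages reach up to \<open>\<pi>\<close>, so the radii of these intervals reach up to \<open>\<pi> / 2\<close>\<close>
  define K where "K = {(a, e). 0 < e \<and> e \<le> pi / 2 \<and> cball a e \<subseteq> {-pi..3*pi} \<and>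
      l * (2 * e) \<le> integral (cball a e) u}"
  have cov: "exceptional c l \<subseteq> (\<Union>i\<in>K. cball (fst i) (snd i))"
  proof
    fix t assume "t \<in> exceptional c l"
    then obtain r where t: "t \<in> {0..2*pi}" and r: "0 \<le> r" "r < 1"
      and big: "cmod (fseries (\<lambda>n. c n * of_real r ^ n) t) > l" by (auto simp: exceptional_def)
    have "\<exists>s\<in>{0..pi}. l * s < integral {0..s} (\<lambda>x. u (t + x)) \<or> l * s < integral {0..s} (\<lambda>x. u (t - x))"
    proof (rule ccontr)
      assume "\<not> ?thesis"
      then have "cmod (fseries (\<lambda>n. c n * of_real r ^ n) t) \<le> l"
        by (intro dilation_le_one_sided_averages c r) (auto simp: u_def not_less)
      with big show False by simp
    qed
    then obtain s where s: "s \<in> {0..pi}"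
      and "l * s < integral {0..s} (\<lambda>x. u (t + x)) \<or> l * s < integral {0..s} (\<lambda>x. u (t - x))" by blast
    then consider (right) "l * s < integral {0..s} (\<lambda>x. u (t + x))" | (left) "l * s < integral {0..s} (\<lambda>x. u (t - x))"
      by blast
    then have "\<exists>a. cball a (s/2) \<subseteq> {-pi..3*pi} \<and> t \<in> cball a (s/2) \<and> l * s < integral (cball a (s/2)) u"
    proof cases
      case right
      have "integral {0..s} (u \<circ> (+) t) = integral {0 + t..s + t} u" by (rule integral_shift_Icc_real)
      moreover have "cball (t + s/2) (s/2) = {t..t + s}" by (simp add: cball_eq_atLeastAtMost)
      ultimately show ?thesis using right s t
        by (intro exI[of _ "t + s/2"]) (auto simp: o_def add.commute)
    next
      case left
      have "integral {0..s} ((\<lambda>x. u (- x)) \<circ> (+) (- t)) = integral {0 + - t..s + - t} (\<lambda>x. u (- x))"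
        by (rule integral_shift_Icc_real)
      also have "\<dots> = integral {- t..- (t - s)} (\<lambda>x. u (- x))" by simp
      also have "\<dots> = integral {t - s..t} u" by (rule Henstock_Kurzweil_Integration.integral_reflect_real)
      finally have "integral {0..s} (\<lambda>x. u (t - x)) = integral {t - s..t} u" by (simp add: o_def)
      moreover have "cball (t - s/2) (s/2) = {t - s..t}" by (simp add: cball_eq_atLeastAtMost)
      ultimately show ?thesis using left s t
        by (intro exI[of _ "t - s/2"]) auto
    qed
    then obtain a where a: "cball a (s/2) \<subseteq> {-pi..3*pi}" "t \<in> cball a (s/2)" "l * s < integral (cball a (s/2)) u"
      by blast
    have "s \<noteq> 0"
    proof
      assume "s = 0"
      then show False using a(3) by (simp add: cball_eq_atLeastAtMost)
    qed
    then have "(a, s/2) \<in> K" using a s by (auto simp: K_def)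
    then show "t \<in> (\<Union>i\<in>K. cball (fst i) (snd i))" using a(2) by force
  qed
  have "emeasure lborel (exceptional c l) \<le> ennreal (5 / l * integral {-pi..3*pi} u)"
  proof (rule vitali_measure_le[OF u _ l cov])
    fix i assume "i \<in> K"
    then show "0 < snd i \<and> snd i \<le> pi / 2" "cball (fst i) (snd i) \<subseteq> {-pi..3*pi}"
      "l * (2 * snd i) \<le> integral (cball (fst i) (snd i)) u"
      by (simp_all add: K_def case_prod_unfold)
  qed (simp add: u_def)
  also have "integral {-pi..3*pi} u = 2 * integral {0..2*pi} u"
    by (rule integral_periodic_twice[OF u]) (simp add: u_def fseries_periodic)
  finally show ?thesis by (simp add: u_def[abs_def])
qed

text \<open>The mean of \<open>\<bar>f\<bar>\<close> is estimated by its square mean through \<open>\<bar>f\<bar> \<le> h/2 + \<bar>f\<bar>\<^sup>2/(2 h)\<close>, which is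
  balanced when the square mean is \<open>h\<close>.\<close>

lemma maximal_inequality_l2:
  assumes c: "summable (\<lambda>n. norm (c n))" and l: "l > 0" and h: "h > 0"
    and s: "(\<Sum>n. (cmod (c n))\<^sup>2) \<le> h\<^sup>2"
  shows "emeasure lborel (exceptional c l) \<le> ennreal (20 * pi * h / l)"
proof -
  have P: "(\<lambda>n. 2 * pi * (cmod (c n))\<^sup>2) sums (LINT t|circle. (cmod (fseries c t))\<^sup>2)" by (rule parseval[OF c])
  then have "summable (\<lambda>n. (2 * pi) * (cmod (c n))\<^sup>2)" by (rule sums_summable)
  then have sc: "summable (\<lambda>n. (cmod (c n))\<^sup>2)" using summable_cmult_iff[of "2 * pi"] by simp
  have sq: "integral {0..2*pi} (\<lambda>t. (cmod (fseries c t))\<^sup>2) \<le> 2 * pi * h\<^sup>2"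
  proof -
    have "integral {0..2*pi} (\<lambda>t. (cmod (fseries c t))\<^sup>2) = (LINT t|circle. (cmod (fseries c t))\<^sup>2)"
      by (rule integral_circle[symmetric]) (intro continuous_intros continuous_fseries c)
    also have "\<dots> = (\<Sum>n. 2 * pi * (cmod (c n))\<^sup>2)" using P by (rule sums_unique)
    also have "\<dots> = 2 * pi * (\<Sum>n. (cmod (c n))\<^sup>2)" by (rule suminf_mult[OF sc])
    also have "\<dots> \<le> 2 * pi * h\<^sup>2" using s by simp
    finally show ?thesis .
  qed
  have ci: "continuous_on {0..2*pi} (\<lambda>t. (cmod (fseries c t))\<^sup>2 * (1 / (2 * h)))"
    by (intro continuous_intros continuous_fseries c)
  have "integral {0..2*pi} (\<lambda>t. cmod (fseries c t)) \<le> integral {0..2*pi} (\<lambda>t. h / 2 + (cmod (fseries c t))\<^sup>2 * (1 / (2 * h)))"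
  proof (rule integral_le)
    show "(\<lambda>t. cmod (fseries c t)) integrable_on {0..2*pi}"
      by (intro integrable_continuous_interval continuous_intros continuous_fseries c)
    show "(\<lambda>t. h / 2 + (cmod (fseries c t))\<^sup>2 * (1 / (2 * h))) integrable_on {0..2*pi}"
      by (intro integrable_continuous_interval continuous_on_add continuous_on_const ci)
    fix t
    show "cmod (fseries c t) \<le> h / 2 + (cmod (fseries c t))\<^sup>2 * (1 / (2 * h))"
      using sum_squares_bound[of "cmod (fseries c t)" h] h by (simp add: field_simps power2_eq_square)
  qed
  also have "\<dots> = integral {0..2*pi} (\<lambda>t. h / 2) + integral {0..2*pi} (\<lambda>t. (cmod (fseries c t))\<^sup>2 * (1 / (2 * h)))"
    by (intro Henstock_Kurzweil_Integration.integral_add integrable_continuous_interval continuous_on_const ci)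
  also have "\<dots> = pi * h + integral {0..2*pi} (\<lambda>t. (cmod (fseries c t))\<^sup>2) * (1 / (2 * h))"
    by simp
  also have "\<dots> \<le> pi * h + (2 * pi * h\<^sup>2) * (1 / (2 * h))"
    using sq h by (intro add_left_mono mult_right_mono) auto
  also have "\<dots> = 2 * pi * h" using h by (simp add: power2_eq_square)
  finally have I: "integral {0..2*pi} (\<lambda>t. cmod (fseries c t)) \<le> 2 * pi * h" .
  have "emeasure lborel (exceptional c l) \<le> ennreal (10 / l * integral {0..2*pi} (\<lambda>s. cmod (fseries c s)))"
    by (rule maximal_inequality[OF c l])
  also have "\<dots> \<le> ennreal (10 / l * (2 * pi * h))"
    using l I by (intro ennreal_leI mult_left_mono) auto
  finally show ?thesis by (simp add: mult_ac)
qed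

section \<open>Radial limits\<close>

lemma summable_dilation_l2:
  assumes a: "summable (\<lambda>n. (cmod (a n))\<^sup>2)" and r: "0 \<le> r" "r < 1"
  shows "summable (\<lambda>n. norm (a n * complex_of_real r ^ n))"
proof (rule summable_comparison_test'[where N=0])
  have "r\<^sup>2 < 1" using r by (simp add: power_less_one_iff abs_square_less_1)
  then show "summable (\<lambda>n. (cmod (a n))\<^sup>2 + (r\<^sup>2) ^ n)"
    by (intro summable_add a summable_geometric) simp
  fix n
  have "2 * (cmod (a n) * r ^ n) \<le> (cmod (a n))\<^sup>2 + (r ^ n)\<^sup>2"
    using sum_squares_bound[of "cmod (a n)" "r ^ n"] by simp
  moreover have "0 \<le> cmod (a n) * r ^ n" using r by simp
  moreover have "norm (norm (a n * complex_of_real r ^ n)) = cmod (a n) * r ^ n"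
    using r by (simp add: norm_mult norm_power)
  moreover have "(r ^ n)\<^sup>2 = (r\<^sup>2) ^ n" by (simp add: power_mult[symmetric] mult.commute)
  ultimately show "norm (norm (a n * complex_of_real r ^ n)) \<le> (cmod (a n))\<^sup>2 + (r\<^sup>2) ^ n"
    by linarith
qed

text \<open>Every term tends to 0 as \<open>\<rho>\<close> tends to 1 and is dominated by \<open>\<bar>a\<^sub>n\<bar>\<^sup>2\<close>, so Tannery's theorem
  applies.\<close>

lemma dilation_defect:
  assumes a: "summable (\<lambda>n. (cmod (a n))\<^sup>2)" and h: "h > 0"
  obtains \<rho> where "0 \<le> \<rho>" "\<rho> < 1" "(\<Sum>n. (cmod (a n * (1 - of_real \<rho> ^ n)))\<^sup>2) \<le> h"
proof -
  let ?f = "\<lambda>n \<rho>. (cmod (a n * (1 - complex_of_real \<rho> ^ n)))\<^sup>2"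
  have ev: "eventually (\<lambda>\<rho>::real. 0 < \<rho> \<and> \<rho> < 1) (at_left 1)"
    by (rule eventually_at_leftI[of 0]) auto
  have "((\<lambda>\<rho>. \<Sum>n. ?f n \<rho>) \<longlongrightarrow> (\<Sum>n. 0)) (at_left 1)"
  proof (rule tannerys_theorem[THEN conjunct2, THEN conjunct2])
    fix k
    have "((\<lambda>\<rho>. ?f k \<rho>) \<longlongrightarrow> (cmod (a k * (1 - complex_of_real 1 ^ k)))\<^sup>2) (at_left 1)"
      by (intro tendsto_intros tendsto_of_real tendsto_ident_at)
    then show "((\<lambda>\<rho>. ?f k \<rho>) \<longlongrightarrow> 0) (at_left 1)" by simp
  next
    have bound: "norm (?f k \<rho>) \<le> (cmod (a k))\<^sup>2" if r: "0 < \<rho>" "\<rho> < 1" for k and \<rho> :: real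
    proof -
      have "1 - complex_of_real \<rho> ^ k = complex_of_real (1 - \<rho> ^ k)" by simp
      then have "cmod (1 - complex_of_real \<rho> ^ k) = \<bar>1 - \<rho> ^ k\<bar>" by (simp only: norm_of_real)
      also have "\<dots> \<le> 1" using r by (simp add: power_le_one)
      finally have "cmod (a k) * cmod (1 - complex_of_real \<rho> ^ k) \<le> cmod (a k)"
        by (intro mult_left_le) auto
      then show ?thesis by (simp add: norm_mult power_mono)
    qed
    show "eventually (\<lambda>(k, \<rho>). norm (?f k \<rho>) \<le> (cmod (a k))\<^sup>2) (at_top \<times>\<^sub>F at_left 1)"
      unfolding eventually_prod_filter
    proof (intro exI conjI allI impI)
      show "eventually (\<lambda>_. True) (at_top :: nat filter)" by simp
      show "eventually (\<lambda>\<rho>::real. 0 < \<rho> \<and> \<rho> < 1) (at_left 1)" by (rule ev)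
    qed (use bound in auto)
  qed (use a in \<open>auto\<close>)
  then have "((\<lambda>\<rho>. \<Sum>n. ?f n \<rho>) \<longlongrightarrow> 0) (at_left 1)" by simp
  then have "eventually (\<lambda>\<rho>. (\<Sum>n. ?f n \<rho>) < h) (at_left 1)" using h by (rule order_tendstoD(2))
  with ev have "eventually (\<lambda>\<rho>. (0 < \<rho> \<and> \<rho> < 1) \<and> (\<Sum>n. ?f n \<rho>) < h) (at_left 1)"
    by (rule eventually_conj)
  then obtain \<rho> where "0 < \<rho>" "\<rho> < 1" "(\<Sum>n. ?f n \<rho>) < h"
    using eventually_happens'[OF trivial_limit_at_left_real] by blast
  then show ?thesis by (intro that[of \<rho>]) auto
qed

text \<open>The coefficients of a function in the Hardy space \<open>H\<^sup>2\<close> need not be absolutely summable, but those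
  of its dilations are. The exceptional set is the increasing union of those of the dilations by
  factors \<open>R\<^sub>j\<close> tending to 1, and the bound is uniform in \<open>j\<close>.\<close>

lemma maximal_inequality_hardy:
  assumes c: "summable (\<lambda>n. (cmod (c n))\<^sup>2)" and l: "l > 0" and h: "h > 0"
    and s: "(\<Sum>n. (cmod (c n))\<^sup>2) \<le> h\<^sup>2"
  shows "exceptional c l \<in> sets borel" "emeasure lborel (exceptional c l) \<le> ennreal (20 * pi * h / l)"
proof -
  define R :: "nat \<Rightarrow> real" where "R j = 1 - 1 / (real j + 2)" for j
  have R: "0 < R j" "R j < 1" for j by (auto simp: R_def)
  have R_mono: "R i \<le> R j" if "i \<le> j" for i j using that by (simp add: R_def frac_le)
  define d where "d j n = c n * complex_of_real (R j) ^ n" for j n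
  have d: "summable (\<lambda>n. norm (d j n))" for j
    unfolding d_def using R[of j] by (intro summable_dilation_l2 c) auto
  have dd: "fseries (\<lambda>n. d j n * of_real r ^ n) t = fseries (\<lambda>n. c n * of_real (R j * r) ^ n) t" for j r t
    by (simp add: d_def power_mult_distrib mult.assoc)
  have ex: "exceptional (d j) l = {t \<in> {0..2*pi}. \<exists>r\<in>{0..<R j}. cmod (fseries (\<lambda>n. c n * of_real r ^ n) t) > l}" for j
  proof -
    have eqv: "(\<exists>r\<in>{0..<1}. P (R j * r)) \<longleftrightarrow> (\<exists>r\<in>{0..<R j}. P r)" for P
    proof
      assume "\<exists>r\<in>{0..<1}. P (R j * r)"
      then obtain r where r: "0 \<le> r" "r < 1" "P (R j * r)" by auto
      have "R j * r < R j * 1" using R[of j] r by (intro mult_strict_left_mono) auto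
      then show "\<exists>r\<in>{0..<R j}. P r" using r R[of j] by (intro bexI[of _ "R j * r"]) auto
    next
      assume "\<exists>r\<in>{0..<R j}. P r"
      then obtain r where r: "0 \<le> r" "r < R j" "P r" by auto
      have "r / R j < 1" using r R[of j] by simp
      then show "\<exists>r\<in>{0..<1}. P (R j * r)" using r R[of j] by (intro bexI[of _ "r / R j"]) auto
    qed
    show ?thesis unfolding exceptional_def dd
      by (simp only: eqv[of "\<lambda>r. cmod (fseries (\<lambda>n. c n * of_real r ^ n) t) > l" for t])
  qed
  have U: "exceptional c l = (\<Union>j. exceptional (d j) l)"
  proof -
    have near: "\<exists>j. r < R j" if "r < 1" for r
    proof -
      obtain j where "1 / (1 - r) < real j" using reals_Archimedean2 by blast
      then have "1 / (real j + 2) < 1 - r" using that by (simp add: field_simps)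
      then show ?thesis by (intro exI[of _ j]) (simp add: R_def)
    qed
    show ?thesis
    proof (intro equalityI subsetI)
      fix t assume "t \<in> exceptional c l"
      then obtain r where r: "t \<in> {0..2*pi}" "0 \<le> r" "r < 1" "cmod (fseries (\<lambda>n. c n * of_real r ^ n) t) > l"
        by (auto simp: exceptional_def)
      obtain j where "r < R j" using near[OF r(3)] by blast
      then have "t \<in> exceptional (d j) l" unfolding ex using r by auto
      then show "t \<in> (\<Union>j. exceptional (d j) l)" by blast
    next
      fix t assume "t \<in> (\<Union>j. exceptional (d j) l)"
      then obtain j where "t \<in> exceptional (d j) l" by blast
      then obtain r where r: "t \<in> {0..2*pi}" "0 \<le> r" "r < R j" "cmod (fseries (\<lambda>n. c n * of_real r ^ n) t) > l"
        by (auto simp: ex)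
      have "r < 1" using r(3) R(2)[of j] by (rule less_trans)
      then show "t \<in> exceptional c l" using r by (auto simp: exceptional_def)
    qed
  qed
  have sets: "exceptional (d j) l \<in> sets borel" for j by (rule exceptional_sets[OF d])
  then show "exceptional c l \<in> sets borel" unfolding U by auto
  have sd: "(\<Sum>n. (cmod (d j n))\<^sup>2) \<le> h\<^sup>2" for j
  proof -
    have le: "(cmod (d j n))\<^sup>2 \<le> (cmod (c n))\<^sup>2" for n
      unfolding d_def using R[of j] by (intro power_mono) (auto simp: norm_mult norm_power power_le_one mult_left_le)
    have "(\<Sum>n. (cmod (d j n))\<^sup>2) \<le> (\<Sum>n. (cmod (c n))\<^sup>2)"
      by (intro suminf_le le c summable_comparison_test'[OF c, of 0]) (use le in auto)
    with s show ?thesis by simp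
  qed
  have inc: "incseq (\<lambda>j. exceptional (d j) l)"
    unfolding incseq_def
  proof (intro allI impI subsetI)
    fix i j t assume ij: "i \<le> j" and "t \<in> exceptional (d i) l"
    then obtain r where r: "t \<in> {0..2*pi}" "0 \<le> r" "r < R i" "cmod (fseries (\<lambda>n. c n * of_real r ^ n) t) > l"
      by (auto simp: ex)
    have "r < R j" using r(3) R_mono[OF ij] by (rule less_le_trans)
    then show "t \<in> exceptional (d j) l" using r by (auto simp: ex)
  qed
  have "emeasure lborel (exceptional c l) = (SUP j. emeasure lborel (exceptional (d j) l))"
    unfolding U using sets inc by (intro SUP_emeasure_incseq[symmetric]) auto
  also have "\<dots> \<le> ennreal (20 * pi * h / l)"
    by (intro SUP_least maximal_inequality_l2 d l h sd)
  finally show "emeasure lborel (exceptional c l) \<le> ennreal (20 * pi * h / l)" .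
qed

lemma AE_circle: "(AE t in lborel. t \<in> {0..2*pi} \<longrightarrow> P t) \<Longrightarrow> (AE t in circle. P t)"
  by (subst AE_restrict_space_iff) (auto intro: AE_completion)

lemma convergent_from_uniform_approximations:
  fixes f :: "'a \<Rightarrow> 'b::complete_space"
  assumes F: "F \<noteq> bot"
    and approx: "\<And>e. e > 0 \<Longrightarrow> \<exists>z. eventually (\<lambda>x. dist (f x) z < e) F"
  shows "\<exists>L. (f \<longlongrightarrow> L) F"
proof -
  have "cauchy_filter (filtermap f F)"
    unfolding cauchy_filter_metric_filtermap
  proof (intro allI impI)
    fix e :: real assume "e > 0"
    then obtain z where z: "eventually (\<lambda>x. dist (f x) z < e / 2) F" using approx[of "e / 2"] by auto
    show "\<exists>P. eventually P F \<and> (\<forall>x y. P x \<and> P y \<longrightarrow> dist (f x) (f y) < e)"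
      by (intro exI[of _ "\<lambda>x. dist (f x) z < e / 2"] conjI z allI impI)
         (elim conjE, rule dist_triangle_half_l)
  qed
  moreover have "filtermap f F \<noteq> bot" using F by (simp add: filtermap_bot_iff)
  ultimately have "\<exists>L\<in>UNIV. filtermap f F \<le> nhds L"
    using complete_UNIV[where 'a='b] unfolding complete_uniform by simp
  then show ?thesis by (auto simp: filterlim_def)
qed

text \<open>For absolutely summable coefficients the series converges uniformly in \<open>r \<in> [0, 1]\<close>.\<close>

lemma dilation_tendsto:
  assumes b: "summable (\<lambda>n. norm (b n))"
  shows "((\<lambda>r. fseries (\<lambda>n. b n * of_real r ^ n) t) \<longlongrightarrow> fseries b t) (at_left 1)"
proof -
  let ?g = "\<lambda>r. \<Sum>n. b n * complex_of_real r ^ n * cis (real n * t)"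
  have "uniform_limit {0..1::real} (\<lambda>n r. \<Sum>i<n. b i * complex_of_real r ^ i * cis (real i * t)) ?g sequentially"
    by (rule Weierstrass_m_test[OF _ b]) (auto simp: norm_mult norm_power power_le_one mult_left_le)
  then have "continuous_on {0..1} ?g"
    by (rule uniform_limit_theorem[rotated]) (auto intro!: always_eventually continuous_intros)
  then have "\<forall>x\<in>{0..1}. (?g \<longlongrightarrow> ?g x) (at x within {0..1})" unfolding continuous_on_def .
  then have "(?g \<longlongrightarrow> ?g 1) (at 1 within {0..1})" by (rule bspec) simp
  moreover have "at 1 within {0..1} = at_left (1::real)" by (rule at_within_Icc_at_left) simp
  ultimately show ?thesis by (simp add: fseries_def)
qed

text \<open>The dilation by a suitable factor \<open>\<rho>\<^sub>k\<close> has distance at most \<open>4\<^sup>-\<^sup>k\<close> from the function in square mean.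
  By the maximal inequality the error exceeds \<open>2\<^sup>-\<^sup>k\<close> somewhere on the radius of angle \<open>t\<close> only for
  \<open>t\<close> in a set \<open>E\<^sub>k\<close> of measure at most \<open>20 \<pi> 2\<^sup>-\<^sup>k\<close>. By the Borel-Cantelli lemma almost every \<open>t\<close>
  is in finitely many \<open>E\<^sub>k\<close>. For such \<open>t\<close> the function is uniformly close, along the radius, to
  functions that are continuous up to the boundary, and so satisfies the Cauchy criterion.\<close>

theorem fatou_radial_limit:
  assumes a: "summable (\<lambda>n. (cmod (a n))\<^sup>2)"
  shows "AE t in circle. \<exists>L. ((\<lambda>r. fseries (\<lambda>n. a n * of_real r ^ n) t) \<longlongrightarrow> L) (at_left 1)"
proof -
  have "\<exists>\<rho>. 0 \<le> \<rho> \<and> \<rho> < 1 \<and> (\<Sum>n. (cmod (a n * (1 - complex_of_real \<rho> ^ n)))\<^sup>2) \<le> ((1/4) ^ k)\<^sup>2" for k :: nat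
    by (rule dilation_defect[OF a, of "((1/4) ^ k)\<^sup>2"]) auto
  then obtain \<rho> where \<rho>: "\<And>k. 0 \<le> \<rho> k" "\<And>k. \<rho> k < 1"
      and def: "\<And>k. (\<Sum>n. (cmod (a n * (1 - complex_of_real (\<rho> k) ^ n)))\<^sup>2) \<le> ((1/4) ^ k)\<^sup>2"
    using choice[of "\<lambda>k \<rho>. 0 \<le> \<rho> \<and> \<rho> < 1 \<and> (\<Sum>n. (cmod (a n * (1 - complex_of_real \<rho> ^ n)))\<^sup>2) \<le> ((1/4) ^ k)\<^sup>2"]
    by blast
  \<comment> \<open>the coefficients of the error of the dilation by \<open>\<rho> k\<close>\<close>
  define c where "c k n = a n * (1 - complex_of_real (\<rho> k) ^ n)" for k n
  define E where "E k = exceptional (c k) ((1/2) ^ k)" for k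
  have c_le: "(cmod (c k n))\<^sup>2 \<le> (cmod (a n))\<^sup>2" for k n
  proof -
    have "1 - complex_of_real (\<rho> k) ^ n = complex_of_real (1 - \<rho> k ^ n)" by simp
    then have "cmod (1 - complex_of_real (\<rho> k) ^ n) = \<bar>1 - \<rho> k ^ n\<bar>" by (simp only: norm_of_real)
    also have "\<dots> \<le> 1" using \<rho>[of k] by (simp add: power_le_one)
    finally have "cmod (a n) * cmod (1 - complex_of_real (\<rho> k) ^ n) \<le> cmod (a n)"
      by (intro mult_left_le) auto
    then show ?thesis by (simp add: c_def norm_mult power_mono)
  qed
  have c: "summable (\<lambda>n. (cmod (c k n))\<^sup>2)" for k
    by (rule summable_comparison_test'[OF a, of 0]) (use c_le in auto)
  have E: "E k \<in> sets borel" "emeasure lborel (E k) \<le> ennreal (20 * pi * (1/2) ^ k)" for k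
  proof -
    have "20 * pi * (1/4) ^ k / (1/2) ^ k = 20 * pi * (1/2) ^ k" 
      by (simp add: power_divide power_mult_distrib[symmetric] field_simps)
    then show "E k \<in> sets borel" "emeasure lborel (E k) \<le> ennreal (20 * pi * (1/2) ^ k)"
      using maximal_inequality_hardy[OF c[of k], of "(1/2) ^ k" "(1/4) ^ k"] def[of k, folded c_def]
      by (simp_all add: E_def)
  qed
  have "AE t in lborel. eventually (\<lambda>k. t \<in> space lborel - E k) sequentially"
  proof (rule borel_cantelli_AE1)
    show "E k \<in> sets lborel" for k using E by simp
    show "emeasure lborel (E k) < \<infinity>" for k by (rule le_less_trans[OF E(2)]) simp
    have "measure lborel (E k) \<le> 20 * pi * (1/2) ^ k" for k
      using enn2real_mono[OF E(2)[of k]] by (simp add: measure_def)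
    then show "summable (\<lambda>k. measure lborel (E k))"
      by (intro summable_comparison_test'[OF summable_mult[OF summable_geometric[of "1/2 :: real"]], where N=0]) auto
  qed
  then have "AE t in lborel. t \<in> {0..2*pi} \<longrightarrow> (\<exists>L. ((\<lambda>r. fseries (\<lambda>n. a n * of_real r ^ n) t) \<longlongrightarrow> L) (at_left 1))"
  proof eventually_elim
    case (elim t)
    show ?case
    proof
      assume t: "t \<in> {0..2*pi}"
      show "\<exists>L. ((\<lambda>r. fseries (\<lambda>n. a n * of_real r ^ n) t) \<longlongrightarrow> L) (at_left 1)"
      proof (rule convergent_from_uniform_approximations)
        fix e :: real assume e: "e > 0"
        have "(\<lambda>k. (1/2 :: real) ^ k) \<longlonglongrightarrow> 0" by (rule LIMSEQ_power_zero) simp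
        then have "eventually (\<lambda>k. (1/2 :: real) ^ k < e / 2) sequentially"
          using e by (intro order_tendstoD(2)) auto
        with elim have "eventually (\<lambda>k. t \<in> space lborel - E k \<and> (1/2 :: real) ^ k < e / 2) sequentially"
          by (rule eventually_conj)
        then obtain k where k: "t \<notin> E k" "(1/2 :: real) ^ k < e / 2"
          by (auto simp: eventually_sequentially)
        define b where "b n = a n * complex_of_real (\<rho> k) ^ n" for n
        have b: "summable (\<lambda>n. norm (b n))" unfolding b_def by (rule summable_dilation_l2[OF a \<rho>])
        have "eventually (\<lambda>r. dist (fseries (\<lambda>n. b n * of_real r ^ n) t) (fseries b t) < e / 2) (at_left 1)"
          using dilation_tendsto[OF b, of t] e by (intro tendstoD) auto
        moreover have "eventually (\<lambda>r::real. r \<in> {0<..<1}) (at_left 1)"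
          by (rule eventually_at_leftI[of 0]) auto
        ultimately have "eventually (\<lambda>r. dist (fseries (\<lambda>n. a n * of_real r ^ n) t) (fseries b t) < e) (at_left 1)"
        proof eventually_elim
          case (elim r)
          have r: "0 \<le> r" "r < 1" using elim by auto
          have s1: "summable (\<lambda>n. a n * of_real r ^ n * cis (real n * t))"
            by (rule summable_fseries[OF summable_dilation_l2[OF a r]])
          have s2: "summable (\<lambda>n. b n * of_real r ^ n * cis (real n * t))"
            using r by (intro summable_fseries summable_dilation b) auto
          have "fseries (\<lambda>n. c k n * of_real r ^ n) t = fseries (\<lambda>n. a n * of_real r ^ n) t - fseries (\<lambda>n. b n * of_real r ^ n) t"
            unfolding fseries_def suminf_diff[OF s1 s2] by (simp add: c_def b_def algebra_simps)
          moreover have "cmod (fseries (\<lambda>n. c k n * of_real r ^ n) t) \<le> (1/2) ^ k"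
            using k(1) t r by (auto simp: E_def exceptional_def not_less)
          ultimately have 1: "dist (fseries (\<lambda>n. a n * of_real r ^ n) t) (fseries (\<lambda>n. b n * of_real r ^ n) t) < e / 2"
            using k(2) by (simp add: dist_norm)
          have 2: "dist (fseries b t) (fseries (\<lambda>n. b n * of_real r ^ n) t) < e / 2"
            using elim(1) by (simp only: dist_commute)
          show ?case by (rule dist_triangle_half_l[OF 1 2])
        qed
        then show "\<exists>z. eventually (\<lambda>r. dist (fseries (\<lambda>n. a n * of_real r ^ n) t) z < e) (at_left 1)" by blast
      qed simp
    qed
  qed
  then show ?thesis by (rule AE_circle)
qed

section \<open>Bounded analytic functions\<close>

definition taylor :: "(complex \<Rightarrow> complex) \<Rightarrow> nat \<Rightarrow> complex" where
  "taylor f n = (deriv ^^ n) f 0 / fact n"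

definition radial_limit :: "(complex \<Rightarrow> complex) \<Rightarrow> complex \<Rightarrow> complex" where
  "radial_limit f z = Lim (at_left (1::real)) (\<lambda>r. f (of_real r * z))"

definition bounded_analytic :: "real \<Rightarrow> (complex \<Rightarrow> complex) \<Rightarrow> bool" where
  "bounded_analytic C f \<longleftrightarrow> f holomorphic_on ball 0 1 \<and> (\<forall>z\<in>ball 0 1. cmod (f z) \<le> C)"

lemma bounded_analytic_nonneg: "bounded_analytic C f \<Longrightarrow> C \<ge> 0"
proof -
  assume "bounded_analytic C f"
  then have "cmod (f 0) \<le> C" by (simp add: bounded_analytic_def)
  then show "C \<ge> 0" using norm_ge_zero[of "f 0"] by linarith
qed

lemma taylor_sums:
  assumes f: "bounded_analytic C f" and z: "cmod z < 1"
  shows "(\<lambda>n. taylor f n * z ^ n) sums f z"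
  using holomorphic_power_series[of f 0 1 z] f z by (simp add: bounded_analytic_def taylor_def)

lemma summable_taylor_dilation:
  assumes f: "bounded_analytic C f" and r: "0 \<le> r" "r < 1"
  shows "summable (\<lambda>n. norm (taylor f n * complex_of_real r ^ n))"
proof -
  have "summable (\<lambda>n. taylor f n * complex_of_real ((1 + r) / 2) ^ n)"
    by (rule sums_summable[OF taylor_sums[OF f]]) (use r in \<open>simp only: norm_of_real, simp\<close>)
  then show ?thesis
    by (rule powser_insidea) (use r in \<open>simp only: norm_of_real, simp\<close>)
qed

lemma circle_in_disc: "0 \<le> r \<Longrightarrow> r < 1 \<Longrightarrow> complex_of_real r * cis t \<in> ball 0 1"
  by (simp add: norm_mult)

lemma taylor_fseries:
  assumes f: "bounded_analytic C f" and r: "0 \<le> r" "r < 1"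
  shows "f (of_real r * cis t) = fseries (\<lambda>n. taylor f n * of_real r ^ n) t"
proof -
  have "(\<lambda>n. taylor f n * (of_real r * cis t) ^ n) sums f (of_real r * cis t)"
    by (rule taylor_sums[OF f]) (use r in \<open>simp add: norm_mult\<close>)
  then show ?thesis
    unfolding fseries_def by (simp add: sums_iff power_mult_distrib Complex.DeMoivre mult.assoc)
qed

lemma fseries_taylor_bound:
  assumes f: "bounded_analytic C f" and r: "0 \<le> r" "r < 1"
  shows "cmod (fseries (\<lambda>n. taylor f n * of_real r ^ n) t) \<le> C"
  using f circle_in_disc[OF r, of t] unfolding taylor_fseries[OF f r, symmetric] bounded_analytic_def by blast

lemma le_of_dilations_le:
  fixes y :: "nat \<Rightarrow> complex"
  assumes "\<And>r. 0 \<le> r \<Longrightarrow> r < 1 \<Longrightarrow> (\<Sum>n<N. (cmod (y n * of_real r ^ n))\<^sup>2) \<le> B"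
  shows "(\<Sum>n<N. (cmod (y n))\<^sup>2) \<le> B"
proof (rule tendsto_upperbound)
  have "((\<lambda>r. \<Sum>n<N. (cmod (y n * complex_of_real r ^ n))\<^sup>2) \<longlongrightarrow> (\<Sum>n<N. (cmod (y n * complex_of_real 1 ^ n))\<^sup>2)) (at_left 1)"
    by (intro tendsto_intros tendsto_of_real tendsto_ident_at)
  then show "((\<lambda>r. \<Sum>n<N. (cmod (y n * complex_of_real r ^ n))\<^sup>2) \<longlongrightarrow> (\<Sum>n<N. (cmod (y n))\<^sup>2)) (at_left 1)"
    by simp
  show "eventually (\<lambda>r. (\<Sum>n<N. (cmod (y n * complex_of_real r ^ n))\<^sup>2) \<le> B) (at_left 1)"
    by (rule eventually_at_leftI[of 0]) (auto intro: assms)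
qed simp

text \<open>The convolution with the Taylor coefficients is multiplication by \<open>f\<close>. On a circle of radius
  \<open>r < 1\<close> all series converge absolutely, the bound \<open>\<bar>f\<bar> \<le> C\<close> holds pointwise, and Parseval's identity
  carries it over to the coefficients. The first \<open>N\<close> entries of the output depend only on those of
  the input, which can thus be truncated; finally \<open>r\<close> tends to 1.\<close>

lemma convolution_bounded:
  assumes f: "bounded_analytic C f"
  shows "(\<Sum>n<N. (cmod (\<Sum>i\<le>n. taylor f i * x (n - i)))\<^sup>2) \<le> C\<^sup>2 * (\<Sum>n<N. (cmod (x n))\<^sup>2)"
proof (rule le_of_dilations_le)
  fix r :: real assume r: "0 \<le> r" "r < 1"
  define c where "c n = (if n < N then x n else 0) * complex_of_real r ^ n" for n
  define d where "d n = taylor f n * complex_of_real r ^ n" for n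
  define e where "e n = (\<Sum>i\<le>n. d i * c (n - i))" for n
  have c: "summable (\<lambda>n. norm (c n))" by (rule summable_finite[of "{..<N}"]) (auto simp: c_def)
  have d: "summable (\<lambda>n. norm (d n))" unfolding d_def by (rule summable_taylor_dilation[OF f r])
  have e: "summable (\<lambda>n. norm (e n))"
  proof (rule summable_comparison_test'[where N=0])
    show "summable (\<lambda>k. \<Sum>i\<le>k. norm (d i) * norm (c (k - i)))"
      using Cauchy_product_sums[of "\<lambda>k. norm (d k)" "\<lambda>k. norm (c k)"] c d by (simp add: sums_iff)
    show "norm (norm (e k)) \<le> (\<Sum>i\<le>k. norm (d i) * norm (c (k - i)))" for k
      unfolding e_def norm_mult[symmetric] by (simp add: norm_sum)
  qed
  have prod: "fseries e t = fseries d t * fseries c t" for t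
  proof -
    have "(\<lambda>k. \<Sum>i\<le>k. (d i * cis (real i * t)) * (c (k - i) * cis (real (k - i) * t)))
        sums ((\<Sum>k. d k * cis (real k * t)) * (\<Sum>k. c k * cis (real k * t)))"
      by (rule Cauchy_product_sums) (simp_all add: norm_mult c d)
    moreover have "(\<Sum>i\<le>k. (d i * cis (real i * t)) * (c (k - i) * cis (real (k - i) * t)))
        = e k * cis (real k * t)" for k
      unfolding e_def sum_distrib_right
    proof (rule sum.cong[OF refl])
      fix i assume "i \<in> {..k}"
      then have "cis (real i * t) * cis (real (k - i) * t) = cis (real k * t)"
        by (simp add: cis_mult of_nat_diff algebra_simps)
      then show "d i * cis (real i * t) * (c (k - i) * cis (real (k - i) * t)) = d i * c (k - i) * cis (real k * t)"
        by (metis (no_types, lifting) mult.assoc mult.commute)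
    qed
    ultimately show ?thesis unfolding fseries_def by (simp add: sums_iff)
  qed
  have Pe: "(\<lambda>n. 2 * pi * (cmod (e n))\<^sup>2) sums (LINT t|circle. (cmod (fseries e t))\<^sup>2)" by (rule parseval[OF e])
  have Pc: "(\<lambda>n. 2 * pi * (cmod (c n))\<^sup>2) sums (LINT t|circle. (cmod (fseries c t))\<^sup>2)" by (rule parseval[OF c])
  have "(\<Sum>n<N. 2 * pi * (cmod (e n))\<^sup>2) \<le> (LINT t|circle. (cmod (fseries e t))\<^sup>2)"
    using Pe by (intro sum_le_suminf[of _ "{..<N}", THEN order_trans]) (auto simp: sums_iff)
  also have "\<dots> \<le> (LINT t|circle. C\<^sup>2 * (cmod (fseries c t))\<^sup>2)"
  proof (rule integral_mono)
    show "integrable circle (\<lambda>t. (cmod (fseries e t))\<^sup>2)" "integrable circle (\<lambda>t. C\<^sup>2 * (cmod (fseries c t))\<^sup>2)"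
      by (intro integrable_circle continuous_intros continuous_fseries c e)+
    show "(cmod (fseries e t))\<^sup>2 \<le> C\<^sup>2 * (cmod (fseries c t))\<^sup>2" for t
      unfolding prod norm_mult power_mult_distrib d_def
      by (intro mult_right_mono power_mono fseries_taylor_bound[OF f r]) auto
  qed
  also have "\<dots> = C\<^sup>2 * (LINT t|circle. (cmod (fseries c t))\<^sup>2)" by simp
  also have "(LINT t|circle. (cmod (fseries c t))\<^sup>2) = (\<Sum>n<N. 2 * pi * (cmod (c n))\<^sup>2)"
    using sums_unique[OF Pc] suminf_finite[of "{..<N}" "\<lambda>n. 2 * pi * (cmod (c n))\<^sup>2"] by (simp add: c_def)
  finally have "2 * pi * (\<Sum>n<N. (cmod (e n))\<^sup>2) \<le> 2 * pi * (C\<^sup>2 * (\<Sum>n<N. (cmod (c n))\<^sup>2))"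
    by (simp only: sum_distrib_left[symmetric] mult.left_commute)
  then have "(\<Sum>n<N. (cmod (e n))\<^sup>2) \<le> C\<^sup>2 * (\<Sum>n<N. (cmod (c n))\<^sup>2)" by simp
  also have "\<dots> \<le> C\<^sup>2 * (\<Sum>n<N. (cmod (x n))\<^sup>2)"
    using r by (intro mult_left_mono sum_mono power_mono)
      (auto simp: c_def norm_mult norm_power power_le_one mult_left_le)
  also have "(\<Sum>n<N. (cmod (e n))\<^sup>2) = (\<Sum>n<N. (cmod ((\<Sum>i\<le>n. taylor f i * x (n - i)) * complex_of_real r ^ n))\<^sup>2)"
  proof (rule sum.cong[OF refl])
    fix n assume n: "n \<in> {..<N}"
    have "e n = (\<Sum>i\<le>n. taylor f i * x (n - i)) * complex_of_real r ^ n"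
      unfolding e_def sum_distrib_right
    proof (rule sum.cong[OF refl])
      fix i assume i: "i \<in> {..n}"
      have "complex_of_real r ^ i * complex_of_real r ^ (n - i) = complex_of_real r ^ n"
        using i by (simp flip: power_add)
      then show "d i * c (n - i) = taylor f i * x (n - i) * complex_of_real r ^ n"
        using n by (simp add: d_def c_def mult_ac flip: \<open>_ = complex_of_real r ^ n\<close>)
    qed
    then show "(cmod (e n))\<^sup>2 = (cmod ((\<Sum>i\<le>n. taylor f i * x (n - i)) * complex_of_real r ^ n))\<^sup>2" by simp
  qed
  finally show "(\<Sum>n<N. (cmod ((\<Sum>i\<le>n. taylor f i * x (n - i)) * complex_of_real r ^ n))\<^sup>2)
      \<le> C\<^sup>2 * (\<Sum>n<N. (cmod (x n))\<^sup>2)" .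
qed

text \<open>The Taylor coefficients of \<open>f\<close> are the product of \<open>f\<close> with the constant function 1.\<close>

lemma summable_taylor_square:
  assumes f: "bounded_analytic C f"
  shows "summable (\<lambda>n. (cmod (taylor f n))\<^sup>2)"
proof (rule summableI_nonneg_bounded)
  fix N
  have "(\<Sum>n<N. (cmod (\<Sum>i\<le>n. taylor f i * (if n - i = 0 then 1 else 0)))\<^sup>2) \<le> C\<^sup>2 * (\<Sum>n<N. (cmod (if n = 0 then 1 else 0))\<^sup>2)"
    by (rule convolution_bounded[OF f, of "\<lambda>n. if n = 0 then 1 else 0"])
  moreover have "(\<Sum>i\<le>n. taylor f i * (if n - i = 0 then 1 else 0)) = taylor f n" for n
  proof -
    have "(\<Sum>i\<le>n. taylor f i * (if n - i = 0 then 1 else 0)) = (\<Sum>i\<in>{n}. taylor f i * (if n - i = 0 then 1 else 0))"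
      by (rule sum.mono_neutral_right) auto
    then show ?thesis by simp
  qed
  moreover have "C\<^sup>2 * (\<Sum>n<N. (cmod (if n = 0 then 1 else 0))\<^sup>2) \<le> C\<^sup>2 * 1"
  proof (rule mult_left_mono)
    have "(\<Sum>n<N. (cmod (if n = 0 then 1 else 0))\<^sup>2) = (\<Sum>n<N. if n = 0 then 1 else 0)"
      by (rule sum.cong) auto
    also have "\<dots> \<le> (1::real)" by (simp add: sum.delta)
    finally show "(\<Sum>n<N. (cmod (if n = 0 then 1 else 0))\<^sup>2) \<le> 1" .
  qed simp
  ultimately show "(\<Sum>n<N. (cmod (taylor f n))\<^sup>2) \<le> C\<^sup>2" by simp
qed simp

subsection \<open>Boundary values\<close>

lemma radial_limit_tendsto:
  assumes f: "bounded_analytic C f"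
  shows "AE t in circle. ((\<lambda>r. f (of_real r * cis t)) \<longlongrightarrow> radial_limit f (cis t)) (at_left 1)"
  using fatou_radial_limit[OF summable_taylor_square[OF f]]
proof eventually_elim
  case (elim t)
  then obtain L where L: "((\<lambda>r. fseries (\<lambda>n. taylor f n * of_real r ^ n) t) \<longlongrightarrow> L) (at_left 1)" by blast
  have "eventually (\<lambda>r. fseries (\<lambda>n. taylor f n * of_real r ^ n) t = f (of_real r * cis t)) (at_left 1)"
    by (rule eventually_at_leftI[of 0]) (simp_all add: taylor_fseries[OF f])
  with L have L': "((\<lambda>r. f (of_real r * cis t)) \<longlongrightarrow> L) (at_left 1)"
    using tendsto_cong by fast
  then have "radial_limit f (cis t) = L" unfolding radial_limit_def by (rule tendsto_Lim[rotated]) simp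
  with L' show ?case by simp
qed

definition radii :: "nat \<Rightarrow> real" where "radii k = 1 - 1 / (real k + 2)"

lemma radii: "0 \<le> radii k" "radii k < 1" by (auto simp: radii_def)

lemma radii_tendsto: "radii \<longlonglongrightarrow> 1"
proof -
  have "(\<lambda>k. 1 - 1 / real (k + 2)) \<longlonglongrightarrow> 1 - 0"
    by (intro tendsto_diff tendsto_const LIMSEQ_ignore_initial_segment lim_const_over_n)
  then show ?thesis by (simp add: radii_def[abs_def] add.commute)
qed

lemma filterlim_radii: "filterlim radii (at_left 1) sequentially"
  unfolding filterlim_at using radii radii_tendsto by (auto simp: less_imp_neq)

definition dilated :: "(complex \<Rightarrow> complex) \<Rightarrow> nat \<Rightarrow> real \<Rightarrow> complex" where
  "dilated f k = fseries (\<lambda>n. taylor f n * of_real (radii k) ^ n)"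

lemma dilated_tendsto:
  assumes f: "bounded_analytic C f"
  shows "AE t in circle. (\<lambda>k. dilated f k t) \<longlonglongrightarrow> radial_limit f (cis t)"
  using radial_limit_tendsto[OF f]
proof eventually_elim
  case (elim t)
  have "(\<lambda>k. f (of_real (radii k) * cis t)) \<longlonglongrightarrow> radial_limit f (cis t)"
    by (rule filterlim_compose[OF elim filterlim_radii])
  then show ?case unfolding dilated_def taylor_fseries[OF f radii] .
qed

lemma summable_dilated: "bounded_analytic C f \<Longrightarrow> summable (\<lambda>n. norm (taylor f n * of_real (radii k) ^ n))"
  by (rule summable_taylor_dilation[OF _ radii])

lemma continuous_dilated: "bounded_analytic C f \<Longrightarrow> continuous_on S (dilated f k)"
  unfolding dilated_def by (intro continuous_fseries summable_dilated)

lemma dilated_bound: "bounded_analytic C f \<Longrightarrow> cmod (dilated f k t) \<le> C"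
  unfolding dilated_def by (intro fseries_taylor_bound radii)

lemma dilated_measurable: "bounded_analytic C f \<Longrightarrow> dilated f k \<in> borel_measurable circle"
  by (rule borel_measurable_integrable[OF integrable_circle[OF continuous_dilated]])

text \<open>Where radial limits fail to exist the values are arbitrary, but this happens on a null set only
  and Lebesgue measure is complete.\<close>

lemma radial_limit_measurable:
  assumes f: "bounded_analytic C f"
  shows "(\<lambda>t. radial_limit f (cis t)) \<in> borel_measurable circle"
proof -
  let ?S = "{0..2*pi}"
  have "(\<lambda>t. lim (\<lambda>k. dilated f k t)) \<in> borel_measurable circle"
    by (intro borel_measurable_lim_metric dilated_measurable[OF f])
  then have 1: "(\<lambda>t. if t \<in> ?S then lim (\<lambda>k. dilated f k t) else 0) \<in> borel_measurable lebesgue"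
    by (subst borel_measurable_if) auto
  have "AE t in circle. lim (\<lambda>k. dilated f k t) = radial_limit f (cis t)"
    using dilated_tendsto[OF f] by eventually_elim (rule limI)
  then have "AE t in lebesgue. t \<in> ?S \<longrightarrow> lim (\<lambda>k. dilated f k t) = radial_limit f (cis t)"
    by (subst (asm) AE_restrict_space_iff) auto
  then have "AE t in lebesgue. (if t \<in> ?S then lim (\<lambda>k. dilated f k t) else 0) = (if t \<in> ?S then radial_limit f (cis t) else 0)"
    by eventually_elim auto
  with 1 have "(\<lambda>t. if t \<in> ?S then radial_limit f (cis t) else 0) \<in> borel_measurable lebesgue"
    by (rule borel_measurable_AE)
  then show ?thesis by (subst (asm) borel_measurable_if) auto
qed

lemma integrable_circle_const: "integrable circle (\<lambda>t. c :: real)"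
  by (rule integrable_circle) simp

lemma dilated_coeff_tendsto: "(\<lambda>k. c n * complex_of_real (radii k) ^ n) \<longlonglongrightarrow> c n"
proof -
  have "(\<lambda>k. c n * complex_of_real (radii k) ^ n) \<longlonglongrightarrow> c n * complex_of_real 1 ^ n"
    by (intro tendsto_intros tendsto_of_real radii_tendsto)
  then show ?thesis by simp
qed

lemma zero_ext_dilated_tendsto:
  "(\<lambda>k. zero_ext (\<lambda>n. c n * complex_of_real (radii k) ^ n) j) \<longlonglongrightarrow> zero_ext c j"
  using dilated_coeff_tendsto[of c "nat j"] by (cases "j < 0") (simp_all add: zero_ext_def)

lemma radial_limit_fourier:
  assumes f: "bounded_analytic C f"
  shows "(LINT t|circle. radial_limit f (cis t) * cis (- of_int j * t)) = 2 * of_real pi * zero_ext (taylor f) j"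
proof -
  have "(\<lambda>k. LINT t|circle. dilated f k t * cis (- of_int j * t)) \<longlonglongrightarrow> (LINT t|circle. radial_limit f (cis t) * cis (- of_int j * t))"
  proof (rule integral_dominated_convergence[where w="\<lambda>t. C"])
    show "(\<lambda>t. radial_limit f (cis t) * cis (- of_int j * t)) \<in> borel_measurable circle"
      by (intro borel_measurable_times radial_limit_measurable[OF f] borel_measurable_integrable[OF integrable_circle] continuous_intros)
    show "(\<lambda>t. dilated f k t * cis (- of_int j * t)) \<in> borel_measurable circle" for k
      by (intro borel_measurable_times dilated_measurable[OF f] borel_measurable_integrable[OF integrable_circle] continuous_intros)
    show "AE t in circle. (\<lambda>k. dilated f k t * cis (- of_int j * t)) \<longlonglongrightarrow> radial_limit f (cis t) * cis (- of_int j * t)"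
      using dilated_tendsto[OF f] by eventually_elim (intro tendsto_intros)
    show "AE t in circle. norm (dilated f k t * cis (- of_int j * t)) \<le> C" for k
      by (rule AE_I2) (simp add: norm_mult dilated_bound[OF f])
  qed (rule integrable_circle_const)
  moreover have "(\<lambda>k. LINT t|circle. dilated f k t * cis (- of_int j * t)) \<longlonglongrightarrow> 2 * of_real pi * zero_ext (taylor f) j"
  proof -
    have "(LINT t|circle. dilated f k t * cis (- of_int j * t)) = 2 * of_real pi * zero_ext (\<lambda>n. taylor f n * of_real (radii k) ^ n) j" for k
      unfolding dilated_def by (rule fseries_coeff[OF summable_dilated[OF f]])
    then show ?thesis by (simp only:) (intro tendsto_intros zero_ext_dilated_tendsto)
  qed
  ultimately show ?thesis by (rule LIMSEQ_unique)
qed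

lemma summable_zero_ext_shift:
  assumes b: "summable (\<lambda>n. (cmod (b n))\<^sup>2)"
  shows "summable (\<lambda>n. (cmod (zero_ext b (int n - j)))\<^sup>2)"
proof (cases "j \<le> 0")
  case True
  then have "zero_ext b (int n - j) = b (n + nat (- j))" for n
  proof -
    have "nat (int n - j) = n + nat (- j)" using True by arith
    then show ?thesis using True by (simp add: zero_ext_def)
  qed
  then show ?thesis using summable_ignore_initial_segment[OF b, of "nat (- j)"] by simp
next
  case False
  then have "zero_ext b (int (n + nat j) - j) = b n" for n by (simp add: zero_ext_def)
  then have "summable (\<lambda>n. (cmod (zero_ext b (int (n + nat j) - j)))\<^sup>2)" using b by (simp del: of_nat_add)
  then show ?thesis by (rule iffD1[OF summable_iff_shift])
qed

lemma radial_limit_product_dominated: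
  assumes f: "bounded_analytic C f" and g: "bounded_analytic D g"
  shows "integrable circle (\<lambda>t. radial_limit f (cis t) * (cnj (radial_limit g (cis t)) * cis (- of_int j * t)))"
    and "(\<lambda>k. LINT t|circle. dilated f k t * (cnj (dilated g k t) * cis (- of_int j * t)))
        \<longlonglongrightarrow> (LINT t|circle. radial_limit f (cis t) * (cnj (radial_limit g (cis t)) * cis (- of_int j * t)))"
proof -
  have cnj_m: "(\<lambda>t. cnj (h t)) \<in> borel_measurable circle" if "h \<in> borel_measurable circle" for h
    by (rule borel_measurable_continuous_on[OF _ that]) (intro continuous_intros)
  have 1: "(\<lambda>t. radial_limit f (cis t) * (cnj (radial_limit g (cis t)) * cis (- of_int j * t))) \<in> borel_measurable circle"
    by (intro borel_measurable_times cnj_m radial_limit_measurable[OF f] radial_limit_measurable[OF g]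
        borel_measurable_integrable[OF integrable_circle] continuous_intros)
  have 2: "(\<lambda>t. dilated f k t * (cnj (dilated g k t) * cis (- of_int j * t))) \<in> borel_measurable circle" for k
    by (intro borel_measurable_times cnj_m dilated_measurable[OF f] dilated_measurable[OF g]
        borel_measurable_integrable[OF integrable_circle] continuous_intros)
  have 3: "AE t in circle. (\<lambda>k. dilated f k t * (cnj (dilated g k t) * cis (- of_int j * t)))
      \<longlonglongrightarrow> radial_limit f (cis t) * (cnj (radial_limit g (cis t)) * cis (- of_int j * t))"
    using dilated_tendsto[OF f] dilated_tendsto[OF g] by eventually_elim (intro tendsto_intros)
  have 4: "AE t in circle. norm (dilated f k t * (cnj (dilated g k t) * cis (- of_int j * t))) \<le> C * D" for k
    by (rule AE_I2) (simp add: norm_mult mult_mono dilated_bound[OF f] dilated_bound[OF g] bounded_analytic_nonneg[OF f])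
  show "integrable circle (\<lambda>t. radial_limit f (cis t) * (cnj (radial_limit g (cis t)) * cis (- of_int j * t)))"
    by (rule integrable_dominated_convergence[OF 1 2 integrable_circle_const 3 4])
  show "(\<lambda>k. LINT t|circle. dilated f k t * (cnj (dilated g k t) * cis (- of_int j * t)))
      \<longlonglongrightarrow> (LINT t|circle. radial_limit f (cis t) * (cnj (radial_limit g (cis t)) * cis (- of_int j * t)))"
    by (rule integral_dominated_convergence[OF 1 2 integrable_circle_const 3 4])
qed

text \<open>For the dilations this is \<open>fseries_inner\<close>. As the radius tends to 1 the integrals converge by
  dominated convergence, and the series by Tannery's theorem, since the Taylor coefficients are
  square summable.\<close>

lemma radial_limit_fourier_product:
  assumes f: "bounded_analytic C f" and g: "bounded_analytic D g"
  shows "(\<lambda>n. 2 * of_real pi * (taylor f n * cnj (zero_ext (taylor g) (int n - j))))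
           sums (LINT t|circle. radial_limit f (cis t) * (cnj (radial_limit g (cis t)) * cis (- of_int j * t)))"
proof -
  let ?I = "\<lambda>k. LINT t|circle. dilated f k t * (cnj (dilated g k t) * cis (- of_int j * t))"
  have 1: "?I \<longlonglongrightarrow> (LINT t|circle. radial_limit f (cis t) * (cnj (radial_limit g (cis t)) * cis (- of_int j * t)))"
    by (rule radial_limit_product_dominated(2)[OF f g])
  define b where "b n = 2 * of_real pi * (taylor f n * cnj (zero_ext (taylor g) (int n - j)))" for n
  define a where "a n k = 2 * of_real pi * (taylor f n * of_real (radii k) ^ n
      * cnj (zero_ext (\<lambda>n. taylor g n * of_real (radii k) ^ n) (int n - j)))" for n k
  have I: "?I k = (\<Sum>n. a n k)" for k
    unfolding a_def dilated_def by (rule sums_unique[OF fseries_inner[OF summable_dilated[OF f] summable_dilated[OF g]]])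
  define M where "M n = 2 * pi * ((cmod (taylor f n))\<^sup>2 + (cmod (zero_ext (taylor g) (int n - j)))\<^sup>2)" for n
  have bound: "norm (a n k) \<le> M n" for n k
  proof -
    have r: "cmod (complex_of_real (radii k) ^ i) \<le> 1" for i using radii[of k] by (simp add: norm_power power_le_one)
    have "cmod (zero_ext (\<lambda>n. taylor g n * of_real (radii k) ^ n) (int n - j)) \<le> cmod (zero_ext (taylor g) (int n - j))"
      using r by (auto simp: zero_ext_def norm_mult mult_left_le)
    moreover have "cmod (taylor f n * of_real (radii k) ^ n) \<le> cmod (taylor f n)"
      using r by (auto simp: norm_mult mult_left_le)
    ultimately have "norm (a n k) \<le> 2 * pi * (cmod (taylor f n) * cmod (zero_ext (taylor g) (int n - j)))"
      unfolding a_def norm_mult complex_mod_cnj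
      by (simp add: mult_mono)
    also have "\<dots> \<le> M n"
      unfolding M_def using sum_squares_bound[of "cmod (taylor f n)" "cmod (zero_ext (taylor g) (int n - j))"]
      by (intro mult_left_mono) (auto intro: order_trans[rotated])
    finally show ?thesis .
  qed
  have "eventually (\<lambda>k. summable (\<lambda>n. norm (a n k))) sequentially \<and> summable (\<lambda>n. norm (b n)) \<and>
      (\<lambda>k. suminf (\<lambda>n. a n k)) \<longlonglongrightarrow> suminf b"
  proof (rule tannerys_theorem)
    show "(\<lambda>k. a n k) \<longlonglongrightarrow> b n" for n
    proof -
      show ?thesis unfolding a_def b_def
        by (intro tendsto_intros zero_ext_dilated_tendsto dilated_coeff_tendsto)
    qed
    show "eventually (\<lambda>(n, k). norm (a n k) \<le> M n) (at_top \<times>\<^sub>F sequentially)"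
      by (rule always_eventually) (simp add: bound case_prod_unfold)
    show "summable M"
      unfolding M_def by (intro summable_mult summable_add summable_taylor_square[OF f]
          summable_zero_ext_shift summable_taylor_square[OF g])
  qed simp
  then have "summable b" "(\<lambda>k. suminf (\<lambda>n. a n k)) \<longlonglongrightarrow> suminf b" by (auto intro: summable_norm_cancel)
  moreover from this(2) 1 have "suminf b = (LINT t|circle. radial_limit f (cis t) * (cnj (radial_limit g (cis t)) * cis (- of_int j * t)))"
    unfolding I by (rule LIMSEQ_unique)
  ultimately show ?thesis unfolding b_def[symmetric] by (simp add: sums_iff)
qed

section \<open>Toeplitz and Hankel operators of bounded analytic functions\<close>

lemma coord_sum: "coord (sum f A) i = (\<Sum>x\<in>A. coord (f x) i)"
  by (induction A rule: infinite_finite_induct) auto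

lemma cbounded_sum:
  assumes "\<And>i. i \<in> I \<Longrightarrow> cbounded (T i)"
  shows "cbounded (\<lambda>x. \<Sum>i\<in>I. T i x)"
  using assms
proof (induction I rule: infinite_finite_induct)
  case (insert i I)
  have "cbounded (T i)" "cbounded (\<lambda>x. \<Sum>i\<in>I. T i x)" using insert by auto
  then have "cbounded (\<lambda>x. T i x + (\<Sum>i\<in>I. T i x))"
    unfolding cbounded_def by (auto intro: bounded_linear_add)
  then show ?case using insert by simp
qed (simp_all add: cbounded_0)

lemma sum_column_le:
  "(\<Sum>n<N. (cmod (coord x (n, b)))\<^sup>2) \<le> (norm x)\<^sup>2" for x :: seq2
proof -
  have "(\<Sum>n<N. (cmod (coord x (n, b)))\<^sup>2) = (\<Sum>i\<in>(\<lambda>n. (n, b)) ` {..<N}. (cmod (coord x i))\<^sup>2)"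
    by (subst sum.reindex) (auto simp: inj_on_def)
  also have "\<dots> \<le> (norm x)\<^sup>2" by (rule sum_coord_square_le) simp
  finally show ?thesis .
qed

lemma summable_column: "summable (\<lambda>n. (cmod (coord x (n, b)))\<^sup>2)" for x :: seq2
  by (rule summableI_nonneg_bounded[OF _ sum_column_le]) simp

text \<open>A scalar operator between two components has its output in the single component \<open>a\<close>, where a
  bound on the finite sections determines both membership and norm.\<close>

lemma column_op:
  assumes C: "C \<ge> 0" and y: "\<And>N. (\<Sum>n<N. (cmod (y n))\<^sup>2) \<le> (C * norm x)\<^sup>2"
  shows "coord (mk_l2 (\<lambda>i. if snd i = a then y (fst i) else 0)) (n, c) = (if c = a then y n else 0)"
    and "norm (mk_l2 (\<lambda>i :: nat \<times> nat. if snd i = a then y (fst i) else 0)) \<le> C * norm x"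
proof -
  let ?g = "\<lambda>i :: nat \<times> nat. if snd i = a then y (fst i) else 0"
  have bound: "(\<Sum>i\<in>F. (cmod (?g i))\<^sup>2) \<le> (C * norm x)\<^sup>2" if F: "finite F" for F
  proof -
    obtain N where N: "\<And>i. i \<in> F \<Longrightarrow> fst i < N"
    proof
      fix i assume "i \<in> F"
      then show "fst i < Suc (Max (fst ` F))" using F by (simp add: less_Suc_eq_le)
    qed
    have "(\<Sum>i\<in>F. (cmod (?g i))\<^sup>2) \<le> (\<Sum>i\<in>F \<union> (\<lambda>n. (n, a)) ` {..<N}. (cmod (?g i))\<^sup>2)"
      by (rule sum_mono2) (use F in auto)
    also have "\<dots> = (\<Sum>i\<in>(\<lambda>n. (n, a)) ` {..<N}. (cmod (?g i))\<^sup>2)"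
    proof (rule sum.mono_neutral_right)
      show "\<forall>i\<in>F \<union> (\<lambda>n. (n, a)) ` {..<N} - (\<lambda>n. (n, a)) ` {..<N}. (cmod (?g i))\<^sup>2 = 0"
      proof
        fix i assume i: "i \<in> F \<union> (\<lambda>n. (n, a)) ` {..<N} - (\<lambda>n. (n, a)) ` {..<N}"
        then have "fst i < N" using N by blast
        then have "snd i \<noteq> a" using i by (cases i) auto
        then show "(cmod (?g i))\<^sup>2 = 0" by simp
      qed
    qed (use F in auto)
    also have "\<dots> = (\<Sum>n<N. (cmod (y n))\<^sup>2)"
      by (subst sum.reindex) (auto simp: inj_on_def)
    also have "\<dots> \<le> (C * norm x)\<^sup>2" by (rule y)
    finally show ?thesis .
  qed
  obtain z where z: "coord z = ?g" "norm z \<le> C * norm x"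
    by (rule l2_from_bounded_sums[of ?g "C * norm x", OF bound]) (use C in auto)
  then have "mk_l2 ?g = z" using coord_inverse[of z] by simp
  with z show "coord (mk_l2 ?g) (n, c) = (if c = a then y n else 0)" "norm (mk_l2 ?g) \<le> C * norm x"
    by simp_all
qed

definition conv_op :: "(complex \<Rightarrow> complex) \<Rightarrow> nat \<Rightarrow> nat \<Rightarrow> seq2 \<Rightarrow> seq2" where
  "conv_op f a b x = mk_l2 (\<lambda>i. if snd i = a then \<Sum>l\<le>fst i. taylor f l * coord x (fst i - l, b) else 0)"

lemma conv_op_aux:
  assumes f: "bounded_analytic C f"
  shows "coord (conv_op f a b x) (n, c) = (if c = a then \<Sum>l\<le>n. taylor f l * coord x (n - l, b) else 0)"
    and "norm (conv_op f a b x) \<le> C * norm x"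
proof -
  have "(\<Sum>n<N. (cmod (\<Sum>l\<le>n. taylor f l * coord x (n - l, b)))\<^sup>2) \<le> (C * norm x)\<^sup>2" for N
  proof -
    have "(\<Sum>n<N. (cmod (\<Sum>l\<le>n. taylor f l * coord x (n - l, b)))\<^sup>2) \<le> C\<^sup>2 * (\<Sum>n<N. (cmod (coord x (n, b)))\<^sup>2)"
      by (rule convolution_bounded[OF f])
    also have "\<dots> \<le> C\<^sup>2 * (norm x)\<^sup>2" by (intro mult_left_mono sum_column_le) auto
    finally show ?thesis by (simp add: power_mult_distrib)
  qed
  note * = column_op[where y="\<lambda>n. \<Sum>l\<le>n. taylor f l * coord x (n - l, b)", OF bounded_analytic_nonneg[OF f] this]
  show "coord (conv_op f a b x) (n, c) = (if c = a then \<Sum>l\<le>n. taylor f l * coord x (n - l, b) else 0)"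
    "norm (conv_op f a b x) \<le> C * norm x"
    unfolding conv_op_def by (rule *)+
qed

lemma coord_conv_op:
  "bounded_analytic C f \<Longrightarrow>
    coord (conv_op f a b x) i = (if snd i = a then \<Sum>l\<le>fst i. taylor f l * coord x (fst i - l, b) else 0)"
  by (cases i) (simp add: conv_op_aux)

lemma cbounded_conv_op:
  assumes f: "bounded_analytic C f"
  shows "cbounded (conv_op f a b)"
proof (rule cboundedI)
  show "conv_op f a b (x + y) = conv_op f a b x + conv_op f a b y" for x y
    by (rule l2_eqI) (simp add: coord_conv_op[OF f] distrib_left sum.distrib)
  show "conv_op f a b (cscale c x) = cscale c (conv_op f a b x)" for c x
    by (rule l2_eqI) (simp add: coord_conv_op[OF f] sum_distrib_left mult.left_commute)
  show "norm (conv_op f a b x) \<le> C * norm x" for x by (rule conv_op_aux[OF f])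
qed

lemma conv_op_shift:
  assumes f: "bounded_analytic C f"
  shows "conv_op f a b (shift x) = shift (conv_op f a b x)"
proof (rule l2_eqI)
  fix i :: "nat \<times> nat"
  obtain n c where i: "i = (n, c)" by (cases i)
  show "coord (conv_op f a b (shift x)) i = coord (shift (conv_op f a b x)) i"
  proof (cases n)
    case 0
    then show ?thesis by (simp add: i coord_conv_op[OF f] coord_shift)
  next
    case (Suc k)
    have "(\<Sum>l\<le>Suc k. taylor f l * coord (shift x) (Suc k - l, b)) = (\<Sum>l\<le>k. taylor f l * coord (shift x) (Suc k - l, b))"
      by (simp add: coord_shift)
    also have "\<dots> = (\<Sum>l\<le>k. taylor f l * coord x (k - l, b))"
      by (rule sum.cong) (auto simp: coord_shift Suc_diff_le)
    finally show ?thesis by (simp add: i Suc coord_conv_op[OF f] coord_shift[of "conv_op f a b x"])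
  qed
qed

lemma hankel_finite_bounded:
  assumes f: "bounded_analytic C f"
  shows "(\<Sum>n<N. (cmod (\<Sum>j<J. taylor f (n + j + 1) * x j))\<^sup>2) \<le> C\<^sup>2 * (\<Sum>j<J. (cmod (x j))\<^sup>2)"
proof -
  \<comment> \<open>reversing a finite input turns the Hankel action into a tail of the Toeplitz one\<close>
  define y where "y k = (if k < J then x (J - 1 - k) else 0)" for k
  have conv: "(\<Sum>i\<le>n + J. taylor f i * y (n + J - i)) = (\<Sum>j<J. taylor f (n + j + 1) * x j)" for n
  proof -
    have "(\<Sum>i\<le>n + J. taylor f i * y (n + J - i)) = (\<Sum>i\<in>{n+1..n+J}. taylor f i * y (n + J - i))"
      by (rule sum.mono_neutral_right) (auto simp: y_def)
    also have "\<dots> = (\<Sum>j<J. taylor f (n + j + 1) * x j)"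
      by (rule sum.reindex_bij_witness[of _ "\<lambda>j. n + j + 1" "\<lambda>i. i - n - 1"]) (auto simp: y_def)
    finally show ?thesis .
  qed
  have "(\<Sum>n<N. (cmod (\<Sum>j<J. taylor f (n + j + 1) * x j))\<^sup>2)
      = (\<Sum>n\<in>{J..<N+J}. (cmod (\<Sum>i\<le>n. taylor f i * y (n - i)))\<^sup>2)"
    by (rule sum.reindex_bij_witness[of _ "\<lambda>n. n - J" "\<lambda>n. n + J"]) (auto simp: conv)
  also have "\<dots> \<le> (\<Sum>n<N+J. (cmod (\<Sum>i\<le>n. taylor f i * y (n - i)))\<^sup>2)"
    by (rule sum_mono2) auto
  also have "\<dots> \<le> C\<^sup>2 * (\<Sum>n<N+J. (cmod (y n))\<^sup>2)" by (rule convolution_bounded[OF f])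
  also have "(\<Sum>n<N+J. (cmod (y n))\<^sup>2) = (\<Sum>n<J. (cmod (y n))\<^sup>2)"
    by (rule sum.mono_neutral_right) (auto simp: y_def)
  also have "\<dots> = (\<Sum>j<J. (cmod (x j))\<^sup>2)"
    by (rule sum.reindex_bij_witness[of _ "\<lambda>j. J - 1 - j" "\<lambda>j. J - 1 - j"]) (auto simp: y_def)
  finally show ?thesis .
qed

lemma summable_hankel:
  fixes x :: seq2
  assumes f: "bounded_analytic C f"
  shows "summable (\<lambda>j. taylor f (n + j + 1) * coord x (j, b))"
proof (rule summable_comparison_test'[where N=0])
  have "summable (\<lambda>j. (cmod (taylor f (j + (n + 1))))\<^sup>2)"
    by (rule summable_ignore_initial_segment[OF summable_taylor_square[OF f]])
  then show "summable (\<lambda>j. (cmod (taylor f (n + j + 1)))\<^sup>2 + (cmod (coord x (j, b)))\<^sup>2)"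
    using summable_column[of x b] by (intro summable_add) (simp_all add: add_ac)
  fix j
  show "norm (taylor f (n + j + 1) * coord x (j, b)) \<le> (cmod (taylor f (n + j + 1)))\<^sup>2 + (cmod (coord x (j, b)))\<^sup>2"
    using sum_squares_bound[of "cmod (taylor f (n + j + 1))" "cmod (coord x (j, b))"]
      mult_nonneg_nonneg[OF norm_ge_zero[of "taylor f (n + j + 1)"] norm_ge_zero[of "coord x (j, b)"]]
    unfolding norm_mult by linarith
qed

definition hank_op :: "(complex \<Rightarrow> complex) \<Rightarrow> nat \<Rightarrow> nat \<Rightarrow> seq2 \<Rightarrow> seq2" where
  "hank_op f a b x = mk_l2 (\<lambda>i. if snd i = a then \<Sum>j. taylor f (fst i + j + 1) * coord x (j, b) else 0)"

text \<open>The bound for finite inputs does not depend on their length and so passes to the limit.\<close>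

lemma hank_op_aux:
  assumes f: "bounded_analytic C f"
  shows "coord (hank_op f a b x) (n, c) = (if c = a then \<Sum>j. taylor f (n + j + 1) * coord x (j, b) else 0)"
    and "norm (hank_op f a b x) \<le> C * norm x"
proof -
  have "(\<Sum>n<N. (cmod (\<Sum>j. taylor f (n + j + 1) * coord x (j, b)))\<^sup>2) \<le> (C * norm x)\<^sup>2" for N
  proof (rule LIMSEQ_le_const2)
    show "(\<lambda>J. \<Sum>n<N. (cmod (\<Sum>j<J. taylor f (n + j + 1) * coord x (j, b)))\<^sup>2)
        \<longlonglongrightarrow> (\<Sum>n<N. (cmod (\<Sum>j. taylor f (n + j + 1) * coord x (j, b)))\<^sup>2)"
      by (intro tendsto_intros summable_LIMSEQ summable_hankel[OF f])
    have "(\<Sum>n<N. (cmod (\<Sum>j<J. taylor f (n + j + 1) * coord x (j, b)))\<^sup>2) \<le> (C * norm x)\<^sup>2" for J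
    proof -
      have "(\<Sum>n<N. (cmod (\<Sum>j<J. taylor f (n + j + 1) * coord x (j, b)))\<^sup>2) \<le> C\<^sup>2 * (\<Sum>j<J. (cmod (coord x (j, b)))\<^sup>2)"
        by (rule hankel_finite_bounded[OF f])
      also have "\<dots> \<le> C\<^sup>2 * (norm x)\<^sup>2" by (intro mult_left_mono sum_column_le) auto
      finally show ?thesis by (simp add: power_mult_distrib)
    qed
    then show "\<exists>K. \<forall>J\<ge>K. (\<Sum>n<N. (cmod (\<Sum>j<J. taylor f (n + j + 1) * coord x (j, b)))\<^sup>2) \<le> (C * norm x)\<^sup>2"
      by blast
  qed
  note * = column_op[where y="\<lambda>n. \<Sum>j. taylor f (n + j + 1) * coord x (j, b)", OF bounded_analytic_nonneg[OF f] this]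
  show "coord (hank_op f a b x) (n, c) = (if c = a then \<Sum>j. taylor f (n + j + 1) * coord x (j, b) else 0)"
    "norm (hank_op f a b x) \<le> C * norm x"
    unfolding hank_op_def by (rule *)+
qed

lemma coord_hank_op:
  "bounded_analytic C f \<Longrightarrow>
    coord (hank_op f a b x) i = (if snd i = a then \<Sum>j. taylor f (fst i + j + 1) * coord x (j, b) else 0)"
  using hank_op_aux(1)[of C f a b x "fst i" "snd i"] by simp

lemma cbounded_hank_op:
  assumes f: "bounded_analytic C f"
  shows "cbounded (hank_op f a b)"
proof (rule cboundedI)
  show "hank_op f a b (x + y) = hank_op f a b x + hank_op f a b y" for x y
  proof (rule l2_eqI)
    fix i
    show "coord (hank_op f a b (x + y)) i = coord (hank_op f a b x + hank_op f a b y) i"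
      using suminf_add[OF summable_hankel[OF f, of "fst i" x b] summable_hankel[OF f, of "fst i" y b]]
      by (simp add: coord_hank_op[OF f] distrib_left)
  qed
  show "hank_op f a b (cscale c x) = cscale c (hank_op f a b x)" for c x
  proof (rule l2_eqI)
    fix i
    show "coord (hank_op f a b (cscale c x)) i = coord (cscale c (hank_op f a b x)) i"
      using suminf_mult[OF summable_hankel[OF f, of "fst i" x b], of c]
      by (simp add: coord_hank_op[OF f] mult.left_commute)
  qed
  show "norm (hank_op f a b x) \<le> C * norm x" for x by (rule hank_op_aux[OF f])
qed

subsection \<open>Matrix-valued symbols\<close>

abbreviation entry :: "(complex \<Rightarrow> complex mat) \<Rightarrow> nat \<Rightarrow> nat \<Rightarrow> complex \<Rightarrow> complex" where
  "entry V a b \<equiv> \<lambda>z. V z $$ (a, b)"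

lemma Hinf_entry:
  assumes "V \<in> Hinf m p"
  obtains C where "\<And>a b. a < m \<Longrightarrow> b < p \<Longrightarrow> bounded_analytic C (entry V a b)"
  using assms unfolding Hinf_def bounded_analytic_def by blast

definition toep_op :: "nat \<Rightarrow> nat \<Rightarrow> (complex \<Rightarrow> complex mat) \<Rightarrow> seq2 \<Rightarrow> seq2" where
  "toep_op m p V x = (\<Sum>a<m. \<Sum>b<p. conv_op (entry V a b) a b x)"

definition hankel_op :: "nat \<Rightarrow> nat \<Rightarrow> (complex \<Rightarrow> complex mat) \<Rightarrow> seq2 \<Rightarrow> seq2" where
  "hankel_op m p V x = (\<Sum>a<m. \<Sum>b<p. hank_op (entry V a b) a b x)"

lemma cbounded_toep_op: "V \<in> Hinf m p \<Longrightarrow> cbounded (toep_op m p V)"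
  unfolding toep_op_def
  by (erule Hinf_entry) (intro cbounded_sum, rule cbounded_conv_op, auto)

lemma cbounded_hankel_op: "V \<in> Hinf m p \<Longrightarrow> cbounded (hankel_op m p V)"
  unfolding hankel_op_def
  by (erule Hinf_entry) (intro cbounded_sum, rule cbounded_hank_op, auto)

lemma coord_toep_op:
  assumes V: "V \<in> Hinf m p"
  shows "coord (toep_op m p V x) (n, c) =
    (if c < m then \<Sum>b<p. \<Sum>l\<le>n. taylor (entry V c b) l * coord x (n - l, b) else 0)"
proof -
  obtain C where C: "\<And>a b. a < m \<Longrightarrow> b < p \<Longrightarrow> bounded_analytic C (entry V a b)" using Hinf_entry[OF V] by metis
  have "coord (toep_op m p V x) (n, c)
      = (\<Sum>a<m. if c = a then \<Sum>b<p. \<Sum>l\<le>n. taylor (entry V a b) l * coord x (n - l, b) else 0)"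
    unfolding toep_op_def coord_sum by (intro sum.cong refl) (simp add: coord_conv_op[OF C])
  then show ?thesis by (simp add: sum.delta)
qed

lemma coord_hankel_op:
  assumes V: "V \<in> Hinf m p"
  shows "coord (hankel_op m p V x) (n, c) =
    (if c < m then \<Sum>b<p. \<Sum>j. taylor (entry V c b) (n + j + 1) * coord x (j, b) else 0)"
proof -
  obtain C where C: "\<And>a b. a < m \<Longrightarrow> b < p \<Longrightarrow> bounded_analytic C (entry V a b)" using Hinf_entry[OF V] by metis
  have "coord (hankel_op m p V x) (n, c)
      = (\<Sum>a<m. if c = a then \<Sum>b<p. \<Sum>j. taylor (entry V a b) (n + j + 1) * coord x (j, b) else 0)"
    unfolding hankel_op_def coord_sum by (intro sum.cong refl) (simp add: coord_hank_op[OF C])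
  then show ?thesis by (simp add: sum.delta)
qed

lemma toep_op_shift:
  assumes V: "V \<in> Hinf m p"
  shows "toep_op m p V (shift x) = shift (toep_op m p V x)"
proof -
  obtain C where C: "\<And>a b. a < m \<Longrightarrow> b < p \<Longrightarrow> bounded_analytic C (entry V a b)" using Hinf_entry[OF V] by metis
  show ?thesis unfolding toep_op_def cbounded_simps(5)[OF cbounded_shift]
    by (intro sum.cong refl) (simp add: conv_op_shift[OF C])
qed

lemma coord_toep_op_unit:
  assumes V: "V \<in> Hinf m p"
  shows "coord (toep_op m p V (unit_l2 (j, b))) (n, c) =
    (if c < m \<and> b < p then zero_ext (taylor (entry V c b)) (int n - int j) else 0)"
proof -
  have *: "(\<Sum>l\<le>n. t l * coord (unit_l2 (j, b)) (n - l, b')) = (if b' = b then zero_ext t (int n - int j) else 0)" for t b'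
  proof (cases "b' = b \<and> j \<le> n")
    case True
    have "(\<Sum>l\<le>n. t l * coord (unit_l2 (j, b)) (n - l, b')) = (\<Sum>l\<in>{n - j}. t l * coord (unit_l2 (j, b)) (n - l, b'))"
      by (rule sum.mono_neutral_right) (use True in \<open>auto simp: coord_unit\<close>)
    also have "\<dots> = t (n - j)" using True by (simp add: coord_unit)
    also have "n - j = nat (int n - int j)" by simp
    finally show ?thesis using True by (simp add: zero_ext_def)
  next
    case False
    then have "t l * coord (unit_l2 (j, b)) (n - l, b') = 0" if "l \<in> {..n}" for l
      using that by (auto simp: coord_unit)
    then have "(\<Sum>l\<le>n. t l * coord (unit_l2 (j, b)) (n - l, b')) = 0" by (rule sum.neutral[rule_format])
    then show ?thesis using False by (auto simp: zero_ext_def)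
  qed
  show ?thesis unfolding coord_toep_op[OF V] * by (simp add: sum.delta)
qed

section \<open>The spaces \<open>ell2\<close> and the operators on them\<close>

text \<open>Restricted to \<open>cvec_seqs m\<close>, \<open>emb m\<close> is an isometric isomorphism onto \<open>ell2 m\<close>. The size \<open>m\<close> thus
  becomes a condition on the support.\<close>

definition emb :: "nat \<Rightarrow> seq2 \<Rightarrow> nat \<Rightarrow> complex vec" where
  "emb m x = (\<lambda>n. vec m (\<lambda>a. coord x (n, a)))"

definition cvec_seqs :: "nat \<Rightarrow> seq2 set" where
  "cvec_seqs m = {x. \<forall>n a. a \<ge> m \<longrightarrow> coord x (n, a) = 0}"

lemma cvec_seqsD: "x \<in> cvec_seqs m \<Longrightarrow> a \<ge> m \<Longrightarrow> coord x (n, a) = 0"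
  by (simp add: cvec_seqs_def)

lemma emb_diff: "emb m (x - y) = emb m x - emb m y"
  by (rule ext) (auto simp: emb_def)

lemma emb_add: "(\<lambda>n. emb m x n + emb m y n) = emb m (x + y)"
  by (rule ext) (auto simp: emb_def)

lemma emb_inj: "x \<in> cvec_seqs m \<Longrightarrow> y \<in> cvec_seqs m \<Longrightarrow> emb m x = emb m y \<Longrightarrow> x = y"
proof (rule l2_eqI)
  fix i :: "nat \<times> nat" assume *: "x \<in> cvec_seqs m" "y \<in> cvec_seqs m" "emb m x = emb m y"
  obtain n a where i: "i = (n, a)" by (cases i)
  show "coord x i = coord y i"
  proof (cases "a < m")
    case True
    have "emb m x n $ a = emb m y n $ a" by (simp only: *)
    then show ?thesis using True by (simp add: emb_def i)
  next
    case False
    then show ?thesis using * by (simp add: i cvec_seqsD)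
  qed
qed

lemma sum_block_le:
  "(\<Sum>n<N. \<Sum>a<m. (cmod (coord x (n, a)))\<^sup>2) \<le> (norm x)\<^sup>2" for x :: seq2
proof -
  have "(\<Sum>n<N. \<Sum>a<m. (cmod (coord x (n, a)))\<^sup>2) = (\<Sum>i\<in>{..<N} \<times> {..<m}. (cmod (coord x i))\<^sup>2)"
    by (simp add: sum.cartesian_product case_prod_unfold)
  also have "\<dots> \<le> (norm x)\<^sup>2" by (rule sum_coord_square_le) simp
  finally show ?thesis .
qed

lemma emb_in_ell2: "emb m x \<in> ell2 m"
proof -
  have "summable (\<lambda>n. \<Sum>a<m. (cmod (coord x (n, a)))\<^sup>2)"
    by (rule summableI_nonneg_bounded[OF _ sum_block_le]) (simp add: sum_nonneg)
  then show ?thesis by (simp add: ell2_def emb_def)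
qed

lemma ell2_is_emb:
  assumes y: "y \<in> ell2 m"
  obtains x where "x \<in> cvec_seqs m" "emb m x = y"
proof -
  let ?g = "\<lambda>i. if snd i < m then y (fst i) $ snd i else 0"
  have s: "summable (\<lambda>n. \<Sum>a<m. (cmod (y n $ a))\<^sup>2)" using y by (simp add: ell2_def)
  define B where "B = (\<Sum>n. \<Sum>a<m. (cmod (y n $ a))\<^sup>2)"
  have B: "B \<ge> 0" unfolding B_def by (intro suminf_nonneg s sum_nonneg) auto
  have bound: "(\<Sum>i\<in>F. (cmod (?g i))\<^sup>2) \<le> (sqrt B)\<^sup>2" if F: "finite F" for F
  proof -
    obtain N where N: "\<And>i. i \<in> F \<Longrightarrow> fst i < N"
    proof
      fix i assume "i \<in> F"
      then show "fst i < Suc (Max (fst ` F))" using F by (simp add: less_Suc_eq_le)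
    qed
    have "(\<Sum>i\<in>F. (cmod (?g i))\<^sup>2) = (\<Sum>i\<in>F \<inter> {i. snd i < m}. (cmod (?g i))\<^sup>2)"
      using F by (intro sum.mono_neutral_right) auto
    also have "\<dots> \<le> (\<Sum>i\<in>{..<N} \<times> {..<m}. (cmod (?g i))\<^sup>2)"
      by (rule sum_mono2) (use N in auto)
    also have "\<dots> = (\<Sum>n<N. \<Sum>a<m. (cmod (y n $ a))\<^sup>2)"
      unfolding sum.cartesian_product by (rule sum.cong) auto
    also have "\<dots> \<le> B" unfolding B_def by (intro sum_le_suminf s) (auto intro: sum_nonneg)
    finally show ?thesis using B by simp
  qed
  obtain x where x: "coord x = ?g"
    by (rule l2_from_bounded_sums[of ?g "sqrt B", OF bound]) (use B in auto)
  have "emb m x = y"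
  proof
    fix n
    have "dim_vec (y n) = m" using y by (auto simp: ell2_def)
    then show "emb m x n = y n" by (intro eq_vecI) (simp_all add: emb_def x)
  qed
  then show ?thesis by (intro that[of x]) (simp_all add: cvec_seqs_def x)
qed

lemma cinner_sums:
  assumes x: "x \<in> cvec_seqs m"
  shows "(\<lambda>n. \<Sum>a<m. coord x (n, a) * cnj (coord y (n, a))) sums cinner x y"
proof (rule has_sum_imp_sums, rule has_sum_SigmaD)
  have z: "coord x i = 0" if "i \<notin> UNIV \<times> {..<m}" for i
    using cvec_seqsD[OF x, of "snd i" "fst i"] that by (cases i) auto
  have "((\<lambda>i. coord x i * cnj (coord y i)) has_sum cinner x y) UNIV"
    unfolding cinner_eq by (rule has_sum_infsum[OF summable_on_cinner])
  then show "((\<lambda>i. coord x i * cnj (coord y i)) has_sum cinner x y) (UNIV \<times> {..<m})"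
    by (rule has_sum_cong_neutral[THEN iffD1, rotated -1]) (simp_all add: z)
  show "((\<lambda>a. coord x (n, a) * cnj (coord y (n, a))) has_sum (\<Sum>a<m. coord x (n, a) * cnj (coord y (n, a)))) {..<m}" for n
    by (rule has_sum_finite) simp
qed

lemma ell2_inner_emb:
  assumes "x \<in> cvec_seqs m \<or> y \<in> cvec_seqs m"
  shows "ell2_inner (emb m x) (emb m y) = cinner x y"
proof -
  have e: "emb m x n \<bullet>c emb m y n = (\<Sum>a<m. coord x (n, a) * cnj (coord y (n, a)))" for x y n
    by (simp add: scalar_prod_def emb_def atLeast0LessThan)
  have 1: "ell2_inner (emb m x) (emb m y) = cinner x y" if "x \<in> cvec_seqs m" for x y
    unfolding ell2_inner_def e by (rule sums_unique[OF cinner_sums[OF that], symmetric])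
  have "(\<lambda>n. \<Sum>a<m. coord x (n, a) * cnj (coord y (n, a))) sums cinner x y" if "y \<in> cvec_seqs m"
  proof -
    have "(\<lambda>n. cnj (\<Sum>a<m. coord y (n, a) * cnj (coord x (n, a)))) sums cnj (cinner y x)"
      using cinner_sums[OF that, of x] by (simp only: sums_cnj)
    then show ?thesis by (simp add: mult.commute flip: cinner_commute)
  qed
  then have 2: "ell2_inner (emb m x) (emb m y) = cinner x y" if "y \<in> cvec_seqs m"
    unfolding ell2_inner_def e using that by (intro sums_unique[symmetric])
  from assms show ?thesis using 1 2 by (elim disjE)
qed

lemma cvec_seqs_csubspace: "csubspace (cvec_seqs m)"
  by (rule csubspaceI) (auto simp: cvec_seqs_def)

lemma cvec_seqs_closed: "closed (cvec_seqs m)"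
proof -
  have "cvec_seqs m = (\<Inter>i\<in>{i. snd i \<ge> m}. {x. coord x i = 0})" by (auto simp: cvec_seqs_def)
  moreover have "closed {x. coord x i = 0}" for i :: "nat \<times> nat"
    using continuous_closed_preimage[OF continuous_coord[of i] closed_UNIV, of "{0}"] by (simp add: vimage_def)
  ultimately show ?thesis by auto
qed

lemma ell2_norm_emb: "x \<in> cvec_seqs m \<Longrightarrow> ell2_norm (emb m x) = norm x"
  by (simp add: ell2_norm_def ell2_inner_emb cinner_self)

lemma ell2_closure_emb:
  assumes S: "S \<subseteq> cvec_seqs m"
  shows "ell2_closure m (emb m ` S) = emb m ` closure S"
proof -
  have cl: "closure S \<subseteq> cvec_seqs m" by (rule closure_minimal[OF S cvec_seqs_closed])
  have n: "ell2_norm (emb m x - emb m y) = dist x y" if "x \<in> cvec_seqs m" "y \<in> S" for x y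
  proof -
    have "x - y \<in> cvec_seqs m" using that S csubspaceD(4)[OF cvec_seqs_csubspace] by blast
    then show ?thesis by (simp add: ell2_norm_emb dist_norm flip: emb_diff)
  qed
  show ?thesis
  proof (intro equalityI subsetI)
    fix z assume z: "z \<in> ell2_closure m (emb m ` S)"
    then have "z \<in> ell2 m" by (simp add: ell2_closure_def)
    then obtain x where x: "x \<in> cvec_seqs m" "emb m x = z" by (rule ell2_is_emb)
    have "\<exists>y\<in>S. dist y x < e" if e: "e > 0" for e
    proof -
      obtain y where "y \<in> S" "ell2_norm (emb m x - emb m y) < e"
        using z e x(2) by (auto simp: ell2_closure_def)
      then show ?thesis using n[OF x(1)] by (auto simp: dist_commute)
    qed
    then have "x \<in> closure S" by (simp add: closure_approachable)
    then show "z \<in> emb m ` closure S" using x(2) by blast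
  next
    fix z assume "z \<in> emb m ` closure S"
    then obtain x where x: "x \<in> closure S" "z = emb m x" by blast
    have "\<exists>y\<in>emb m ` S. ell2_norm (z - y) < e" if e: "e > 0" for e
    proof -
      obtain y where "y \<in> S" "dist y x < e" using x(1) e by (auto simp: closure_approachable)
      then show ?thesis using n[of x y] x cl by (auto simp: dist_commute intro!: bexI[of _ y])
    qed
    then show "z \<in> ell2_closure m (emb m ` S)" using x(2) emb_in_ell2 by (simp add: ell2_closure_def)
  qed
qed

subsection \<open>Dimension\<close>

lemma orthonormal_emb:
  assumes "B \<subseteq> cvec_seqs m"
  shows "orthonormal (emb m ` B) \<longleftrightarrow> onfamily id B"
proof -
  have "ell2_inner (emb m x) (emb m y) = cinner x y" "emb m x = emb m y \<longleftrightarrow> x = y" if "x \<in> B" "y \<in> B" for x y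
    using that assms by (auto intro!: ell2_inner_emb dest: emb_inj)
  then show ?thesis unfolding orthonormal_def onfamily_def by simp
qed

text \<open>By Zorn's lemma. The dimension is defined through an arbitrary choice of a basis, which this
  makes a choice of an actual one.\<close>

lemma orthonormal_basis_exists: "\<exists>B. orthonormal_basis B S"
proof -
  let ?A = "{B. B \<subseteq> S \<and> orthonormal B}"
  have "\<exists>M\<in>?A. \<forall>X\<in>?A. M \<subseteq> X \<longrightarrow> X = M"
  proof (rule subset_Zorn)
    fix C assume C: "subset.chain ?A C"
    have "orthonormal (\<Union>C)"
      unfolding orthonormal_def
    proof (intro ballI)
      fix x y assume "x \<in> \<Union>C" "y \<in> \<Union>C"
      then obtain X Y where XY: "X \<in> C" "x \<in> X" "Y \<in> C" "y \<in> Y" by blast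
      then have "X \<subseteq> Y \<or> Y \<subseteq> X" using C by (auto simp: subset_chain_def)
      then obtain Z where "Z \<in> C" "x \<in> Z" "y \<in> Z" using XY by blast
      moreover have "orthonormal Z" using \<open>Z \<in> C\<close> C by (auto simp: subset_chain_def)
      ultimately show "ell2_inner x y = (if x = y then 1 else 0)" unfolding orthonormal_def by blast
    qed
    moreover have "\<Union>C \<subseteq> S" using C by (auto simp: subset_chain_def)
    ultimately show "\<exists>U\<in>?A. \<forall>X\<in>C. X \<subseteq> U" by blast
  qed
  then obtain B where B: "B \<in> ?A" "\<forall>X\<in>?A. B \<subseteq> X \<longrightarrow> X = B" by (elim bexE)
  have "orthonormal_basis B S"
    unfolding orthonormal_basis_def
  proof (intro conjI allI impI)
    show "B \<subseteq> S" "orthonormal B" using B(1) by auto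
    fix X assume "B \<subseteq> X \<and> X \<subseteq> S \<and> orthonormal X"
    then show "X = B" using B(2) by auto
  qed
  then show ?thesis by blast
qed

text \<open>By Bessel's inequality for a unit vector, at most \<open>(n + 1)\<^sup>2\<close> members of the family have a coordinate
  of modulus at least \<open>1 / (n + 1)\<close> at a given index; and no member is 0.\<close>

lemma onfamily_countable:
  fixes B :: "seq2 set"
  assumes B: "onfamily id B"
  shows "countable B"
proof -
  have fin: "finite {b \<in> B. cmod (coord b i) \<ge> 1 / real (Suc n)}" for i n
  proof (rule finite_if_finite_subsets_card_bdd[THEN conjunct1])
    fix F assume F: "F \<subseteq> {b \<in> B. cmod (coord b i) \<ge> 1 / real (Suc n)}" "finite F"
    have "real (card F) * (1 / real (Suc n))\<^sup>2 = (\<Sum>b\<in>F. (1 / real (Suc n))\<^sup>2)" by simp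
    also have "\<dots> \<le> (\<Sum>b\<in>F. (cmod (cinner (unit_l2 i) (id b)))\<^sup>2)"
      using F by (intro sum_mono power_mono) (auto simp: cinner_unit_left)
    also have "\<dots> \<le> (norm (unit_l2 i))\<^sup>2"
      using F by (intro bessel onfamily_subset[OF B]) auto
    finally have "real (card F) * (1 / real (Suc n))\<^sup>2 \<le> 1" by simp
    then have "real (card F) \<le> (real (Suc n))\<^sup>2" by (simp add: field_simps power_divide)
    then have "real (card F) \<le> real ((Suc n)\<^sup>2)" by simp
    then show "card F \<le> (Suc n)\<^sup>2" by (simp only: of_nat_le_iff)
  qed
  have "B \<subseteq> (\<Union>i. \<Union>n. {b \<in> B. cmod (coord b i) \<ge> 1 / real (Suc n)})"
  proof
    fix b assume b: "b \<in> B"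
    have "b \<noteq> 0" using onfamilyD[OF B b b] by auto
    then obtain i where "coord b i \<noteq> 0" by (metis coord_zero l2_eqI)
    then obtain n where "inverse (real (Suc n)) < cmod (coord b i)"
      using reals_Archimedean[of "cmod (coord b i)"] by auto
    then have "b \<in> {b \<in> B. cmod (coord b i) \<ge> 1 / real (Suc n)}"
      using b by (simp add: inverse_eq_divide)
    then show "b \<in> (\<Union>i. \<Union>n. {b \<in> B. cmod (coord b i) \<ge> 1 / real (Suc n)})" by blast
  qed
  moreover have "countable (\<Union>i::nat \<times> nat. \<Union>n. {b \<in> B. cmod (coord b i) \<ge> 1 / real (Suc n)})"
    by (intro countable_UN countable_finite[OF fin]) auto
  ultimately show ?thesis by (rule countable_subset)
qed

text \<open>A finite maximal family \<open>C\<close> spans \<open>Y\<close>, so the squared coefficients of each \<open>b \<in> B\<close> with respect to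
  \<open>C\<close> add up to 1. Summing over \<open>B\<close> and exchanging the sums, Bessel's inequality for each \<open>c \<in> C\<close>
  gives at most 1.\<close>

lemma onfamily_maximal_card_le:
  fixes B C :: "'a l2 set"
  assumes Y: "csubspace Y" and C: "onfamily id C" "C \<subseteq> Y" "finite C"
    and max: "\<And>C'. C \<subseteq> C' \<Longrightarrow> C' \<subseteq> Y \<Longrightarrow> onfamily id C' \<Longrightarrow> C' = C"
    and B: "onfamily id B" "B \<subseteq> Y" "finite B"
  shows "card B \<le> card C"
proof -
  have expand: "b = (\<Sum>c\<in>C. cscale (cinner b c) c)" if b: "b \<in> Y" for b
  proof (rule ccontr)
    define p where "p = (\<Sum>c\<in>C. cscale (cinner b c) c)"
    define z where "z = b - p"
    assume "b \<noteq> (\<Sum>c\<in>C. cscale (cinner b c) c)"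
    then have z0: "norm z > 0" by (simp add: z_def p_def)
    have pY: "p \<in> Y" unfolding p_def using C(3,2)
      by (induction C rule: finite_induct) (auto intro: csubspaceD[OF Y])
    then have zY: "z \<in> Y" unfolding z_def using b csubspaceD(4)[OF Y] by blast
    have zc: "cinner z c = 0" if "c \<in> C" for c
      using cinner_onfamily_sum[OF C(1,3) that, of "cinner b"] by (simp add: z_def p_def cinner_diff_left)
    define w where "w = cscale (of_real (1 / norm z)) z"
    have "norm w = 1" using z0 by (simp add: w_def norm_divide)
    then have ww: "cinner w w = 1" by (simp add: cinner_self)
    have wc: "cinner w c = 0" if "c \<in> C" for c
      using zc[OF that] unfolding w_def cinner_cscale_left by simp
    have cw: "cinner c w = 0" if "c \<in> C" for c using wc[OF that] cinner_commute[of c w] by simp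
    have wY: "w \<in> Y" unfolding w_def by (rule csubspaceD(3)[OF Y zY])
    have "w \<notin> C" using wc[of w] ww by auto
    have "onfamily id (insert w C)"
      using C(1) ww wc cw \<open>w \<notin> C\<close> unfolding onfamily_def by auto
    then have "insert w C = C" using C(2) wY by (intro max) auto
    with \<open>w \<notin> C\<close> show False by blast
  qed
  have norm1: "(\<Sum>c\<in>C. (cmod (cinner b c))\<^sup>2) = 1" if b: "b \<in> B" for b
  proof -
    have bb: "cinner b b = 1" using onfamilyD[OF B(1) b b] by simp
    have "cinner b b = cinner b (\<Sum>c\<in>C. cscale (cinner b c) c)"
      using expand[of b] b B(2) by auto
    also have "\<dots> = (\<Sum>c\<in>C. cnj (cinner b c) * cinner b c)"
      using cinner_onfamily_sum_right[of b "cinner b" id C] by simp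
    also have "\<dots> = (\<Sum>c\<in>C. of_real ((cmod (cinner b c))\<^sup>2))"
      by (intro sum.cong[OF refl]) (metis complex_norm_square mult.commute)
    finally have "complex_of_real (\<Sum>c\<in>C. (cmod (cinner b c))\<^sup>2) = of_real 1" using bb by simp
    then show ?thesis by (simp only: of_real_eq_iff)
  qed
  have "real (card B) = (\<Sum>b\<in>B. \<Sum>c\<in>C. (cmod (cinner b c))\<^sup>2)" using norm1 by simp
  also have "\<dots> = (\<Sum>c\<in>C. \<Sum>b\<in>B. (cmod (cinner b c))\<^sup>2)" by (rule sum.swap)
  also have "\<dots> \<le> (\<Sum>c\<in>C. 1)"
  proof (rule sum_mono)
    fix c assume c: "c \<in> C"
    have "(\<Sum>b\<in>B. (cmod (cinner b c))\<^sup>2) = (\<Sum>b\<in>B. (cmod (cinner c (id b)))\<^sup>2)"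
    proof (rule sum.cong[OF refl])
      fix b show "(cmod (cinner b c))\<^sup>2 = (cmod (cinner c (id b)))\<^sup>2"
        unfolding cinner_commute[of b c] by simp
    qed
    also have "\<dots> \<le> (norm c)\<^sup>2" by (rule bessel[OF B(1,3)])
    also have "\<dots> = 1"
    proof -
      have "cinner c c = 1" using onfamilyD[OF C(1) c c] by simp
      then show ?thesis by (metis cinner_self of_real_eq_1_iff)
    qed
    finally show "(\<Sum>b\<in>B. (cmod (cinner b c))\<^sup>2) \<le> 1" .
  qed
  finally show ?thesis by simp
qed

text \<open>The two bases are arbitrary, so this includes the independence of the dimension from the basis.
  If the basis of the larger space is infinite, it suffices that orthonormal families are countable.
  If it is finite, \<open>onfamily_maximal_card_le\<close> bounds all finite subsets of the other basis.\<close>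

lemma hilbert_dim_mono:
  assumes XY: "X \<subseteq> Y" and Y: "csubspace Y" "Y \<subseteq> cvec_seqs m"
  shows "hilbert_dim (emb m ` X) \<le>o hilbert_dim (emb m ` Y)"
proof -
  define BX where "BX = (SOME B. orthonormal_basis B (emb m ` X))"
  define BY where "BY = (SOME B. orthonormal_basis B (emb m ` Y))"
  have BX: "orthonormal_basis BX (emb m ` X)" unfolding BX_def by (rule someI_ex[OF orthonormal_basis_exists])
  have BY: "orthonormal_basis BY (emb m ` Y)" unfolding BY_def by (rule someI_ex[OF orthonormal_basis_exists])
  from BX obtain B where B: "B \<subseteq> X" "BX = emb m ` B" unfolding orthonormal_basis_def by (meson subset_imageE)
  from BY obtain C where C: "C \<subseteq> Y" "BY = emb m ` C" unfolding orthonormal_basis_def by (meson subset_imageE)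
  have sub: "B \<subseteq> cvec_seqs m" "C \<subseteq> cvec_seqs m" "B \<subseteq> Y" using B C XY Y by auto
  have Bon: "onfamily id B" using BX sub(1) unfolding orthonormal_basis_def B by (simp add: orthonormal_emb)
  have Con: "onfamily id C" using BY sub(2) unfolding orthonormal_basis_def C by (simp add: orthonormal_emb)
  have max: "C' = C" if "C \<subseteq> C'" "C' \<subseteq> Y" "onfamily id C'" for C'
  proof -
    have c': "C' \<subseteq> cvec_seqs m" using that Y by auto
    have "orthonormal (emb m ` C')" using that c' by (simp add: orthonormal_emb)
    moreover have "emb m ` C \<subseteq> emb m ` C'" "emb m ` C' \<subseteq> emb m ` Y" using that by auto
    ultimately have eq: "emb m ` C' = emb m ` C" using BY unfolding orthonormal_basis_def C by blast
    have "C' \<subseteq> C"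
    proof
      fix x assume x: "x \<in> C'"
      then obtain y where "y \<in> C" "emb m x = emb m y" using eq by blast
      then show "x \<in> C" using x c' sub(2) emb_inj[of x m y] by auto
    qed
    with that(1) show ?thesis by auto
  qed
  have inj: "inj_on (emb m) (cvec_seqs m)" by (auto intro!: inj_onI dest: emb_inj)
  have "|BX| \<le>o |BY|"
  proof (cases "finite C")
    case False
    then have "infinite BY" unfolding C using inj_on_subset[OF inj sub(2)] by (simp add: finite_image_iff)
    then have "|UNIV :: nat set| \<le>o |BY|" using infinite_iff_card_of_nat[of BY] by blast
    moreover have "|BX| \<le>o |UNIV :: nat set|"
    proof -
      have "countable BX" unfolding B by (rule countable_image[OF onfamily_countable[OF Bon]])
      then obtain f :: "_ \<Rightarrow> nat" where "inj_on f BX" by (rule countableE)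
      then have "\<exists>f :: _ \<Rightarrow> nat. inj_on f BX \<and> f ` BX \<subseteq> UNIV" by (intro exI conjI subset_UNIV)
      then show ?thesis by (rule iffD1[OF card_of_ordLeq])
    qed
    ultimately show ?thesis by (rule ordLeq_transitive[rotated])
  next
    case True
    have card: "card F \<le> card C" if "F \<subseteq> B" "finite F" for F
      by (rule onfamily_maximal_card_le[OF Y(1) Con C(1) True max onfamily_subset[OF Bon that(1)] _ that(2)])
         (use that sub in auto)
    then have fB: "finite B" "card B \<le> card C"
      using finite_if_finite_subsets_card_bdd[of B "card C"] by auto
    have "card BX \<le> card BY"
      unfolding B C using fB inj_on_subset[OF inj sub(1)] inj_on_subset[OF inj sub(2)] by (simp add: card_image)
    moreover have "finite BX" "finite BY" using fB True by (auto simp: B C)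
    ultimately have "\<exists>f. f ` BX \<subseteq> BY \<and> inj_on f BX" by (intro card_le_inj)
    then have "\<exists>f. inj_on f BX \<and> f ` BX \<subseteq> BY" by (elim exE conjE) (intro exI conjI)
    then show ?thesis by (rule iffD1[OF card_of_ordLeq])
  qed
  then show ?thesis unfolding hilbert_dim_def BX_def BY_def .
qed

section \<open>Representing operators between sequence spaces\<close>

text \<open>The operator \<open>U\<close> does not see components of the input from \<open>p\<close> on and produces none from \<open>m\<close> on.
  These two conditions are exchanged by taking adjoints, so that compositions and adjoints of
  representing operators need no projections between the spaces.\<close>

definition represents :: "nat \<Rightarrow> nat \<Rightarrow> oper \<Rightarrow> (seq2 \<Rightarrow> seq2) \<Rightarrow> bool" where
  "represents m p T U \<longleftrightarrow> cbounded U \<and> (\<forall>x. T (emb p x) = emb m (U x)) \<and>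
     (\<forall>x. U x \<in> cvec_seqs m) \<and> (\<forall>n b. b \<ge> p \<longrightarrow> U (unit_l2 (n, b)) = 0)"

lemma representsD:
  assumes "represents m p T U"
  shows "cbounded U" "T (emb p x) = emb m (U x)" "U x \<in> cvec_seqs m" "b \<ge> p \<Longrightarrow> U (unit_l2 (n, b)) = 0"
  using assms by (auto simp: represents_def)

text \<open>The adjoint is given by a definite description, so uniqueness has to be shown as well; it holds
  because every element of \<open>ell2 p\<close> is some \<open>emb p x\<close>.\<close>

lemma represents_adjoint:
  assumes r: "represents m p T U"
  shows "represents p m (adjoint_op p T) (cadj U)"
proof -
  note U = representsD(1)[OF r]
  have ran: "cadj U y \<in> cvec_seqs p" for y
  proof -
    have "coord (cadj U y) (n, b) = 0" if "b \<ge> p" for n b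
      unfolding cinner_unit_right[symmetric] cadj'[OF U] representsD(4)[OF r that] by simp
    then show ?thesis by (simp add: cvec_seqs_def)
  qed
  have dom: "cadj U (unit_l2 (n, a)) = 0" if a: "a \<ge> m" for n a
  proof (rule eq_from_cinner)
    fix z
    show "cinner z (cadj U (unit_l2 (n, a))) = cinner z 0"
      unfolding cadj[OF U, symmetric] cinner_unit_right using cvec_seqsD[OF representsD(3)[OF r] a] by simp
  qed
  have "adjoint_op p T (emb m y) = emb p (cadj U y)" for y
    unfolding adjoint_op_def
  proof (rule the_equality)
    have eq: "ell2_inner (T (emb p x)) (emb m y) = ell2_inner (emb p x) (emb p (cadj U y))" for x
      unfolding representsD(2)[OF r]
      by (simp add: ell2_inner_emb representsD(3)[OF r] ran cadj[OF U])
    show "emb p (cadj U y) \<in> ell2 p \<and>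
        (\<forall>u\<in>ell2 p. ell2_inner (T u) (emb m y) = ell2_inner u (emb p (cadj U y)))"
      using eq emb_in_ell2 by (auto elim!: ell2_is_emb)
    fix v assume v: "v \<in> ell2 p \<and> (\<forall>u\<in>ell2 p. ell2_inner (T u) (emb m y) = ell2_inner u v)"
    then obtain w where w: "w \<in> cvec_seqs p" "v = emb p w" by (auto elim!: ell2_is_emb)
    have "cinner x w = cinner x (cadj U y)" for x
    proof -
      have "ell2_inner (T (emb p x)) (emb m y) = ell2_inner (emb p x) v" using v emb_in_ell2 by blast
      then show ?thesis using w ran unfolding eq by (simp add: ell2_inner_emb)
    qed
    then have "w = cadj U y" by (rule eq_from_cinner)
    then show "v = emb p (cadj U y)" using w by simp
  qed
  then show ?thesis unfolding represents_def using ran dom cbounded_cadj[OF U] by auto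
qed

lemma represents_compose:
  assumes "represents m p T U" "represents p q T' U'"
  shows "represents m q (T \<circ> T') (\<lambda>x. U (U' x))"
  unfolding represents_def
  using cbounded_compose[OF representsD(1)[OF assms(1)] representsD(1)[OF assms(2)]]
  by (simp add: representsD(2,3)[OF assms(1)] representsD(2,4)[OF assms(2)]
      cbounded_simps(3)[OF representsD(1)[OF assms(1)]])

lemma represents_diff:
  assumes "represents m p T U" "represents m p T' U'"
  shows "represents m p (T - T') (\<lambda>x. U x - U' x)"
  unfolding represents_def
  using cbounded_diff[OF representsD(1)[OF assms(1)] representsD(1)[OF assms(2)]]
    csubspaceD(4)[OF cvec_seqs_csubspace representsD(3)[OF assms(1)] representsD(3)[OF assms(2)]]
  by (simp add: representsD(2,4)[OF assms(1)] representsD(2,4)[OF assms(2)] emb_diff)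

lemma represents_positive:
  assumes r: "represents m m T U"
  shows "positive_op m T \<longleftrightarrow> (\<forall>x. 0 \<le> cinner (U x) x)"
proof -
  have *: "ell2_inner (T (emb m x)) (emb m x) = cinner (U x) x" for x
    unfolding representsD(2)[OF r] by (simp add: ell2_inner_emb representsD(3)[OF r])
  show ?thesis
  proof
    assume "positive_op m T"
    then show "\<forall>x. 0 \<le> cinner (U x) x" unfolding positive_op_def using emb_in_ell2 by (metis *)
  next
    assume p: "\<forall>x. 0 \<le> cinner (U x) x"
    show "positive_op m T"
      unfolding positive_op_def
    proof
      fix u assume "u \<in> ell2 m"
      then obtain x where "emb m x = u" by (rule ell2_is_emb)
      then show "0 \<le> ell2_inner (T u) u" using * p by metis
    qed
  qed
qed

lemma represents_image:
  assumes r: "represents m p T U"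
  shows "T ` ell2 p = emb m ` range U"
proof (intro equalityI subsetI)
  fix y assume "y \<in> T ` ell2 p"
  then obtain u where u: "u \<in> ell2 p" "y = T u" by blast
  from u(1) obtain x where "emb p x = u" by (rule ell2_is_emb)
  then show "y \<in> emb m ` range U" using u representsD(2)[OF r, of x] by simp
next
  fix y assume "y \<in> emb m ` range U"
  then obtain x where "y = emb m (U x)" by blast
  then show "y \<in> T ` ell2 p" using representsD(2)[OF r, of x] emb_in_ell2[of p x] by (metis imageI)
qed

lemma fourier_bdry:
  assumes V: "V \<in> Hinf m p" and ab: "a < m" "b < p"
  shows "fourier_coeff m p (bdry m p V) j $$ (a, b) = zero_ext (taylor (entry V a b)) j"
proof -
  obtain C where C: "\<And>a b. a < m \<Longrightarrow> b < p \<Longrightarrow> bounded_analytic C (entry V a b)" using Hinf_entry[OF V] by metis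
  have "bdry m p V z $$ (a, b) = radial_limit (entry V a b) z" for z
    using ab by (simp add: bdry_def radial_limit_def)
  then have "fourier_coeff m p (bdry m p V) j $$ (a, b)
      = (LINT t|circle. radial_limit (entry V a b) (cis t) * cis (- of_int j * t)) / (2 * of_real pi)"
    using ab by (simp add: fourier_coeff_def)
  then show ?thesis unfolding radial_limit_fourier[OF C[OF ab]] by simp
qed

lemma mult_vec_entry:
  assumes "A \<in> carrier_mat m p" "c < m"
  shows "(A *\<^sub>v vec p f) $ c = (\<Sum>b<p. A $$ (c, b) * f b)"
  using assms by (simp add: scalar_prod_def atLeast0LessThan)

text \<open>The Fourier coefficients vanish at negative indices, so every row of the block matrix is finite
  and acts as a convolution with Taylor coefficients.\<close>

lemma represents_toeplitz:
  assumes V: "V \<in> Hinf m p"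
  shows "represents m p (toeplitz_H m p V) (toep_op m p V)"
proof -
  have "toeplitz_H m p V (emb p x) = emb m (toep_op m p V x)" for x
  proof
    fix n
    have "(\<Sum>j. (fourier_coeff m p (bdry m p V) (int n - int j) *\<^sub>v emb p x j) $ c) = coord (toep_op m p V x) (n, c)"
      if c: "c < m" for c
    proof -
      have e: "(fourier_coeff m p (bdry m p V) (int n - int j) *\<^sub>v emb p x j) $ c
          = (\<Sum>b<p. zero_ext (taylor (entry V c b)) (int n - int j) * coord x (j, b))" for j
      proof -
        have "fourier_coeff m p (bdry m p V) k \<in> carrier_mat m p" for k by (simp add: fourier_coeff_def)
        then show ?thesis unfolding emb_def mult_vec_entry[OF _ c]
          by (subst mult_vec_entry[OF _ c]) (simp_all add: fourier_bdry[OF V c])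
      qed
      have "(\<Sum>j. \<Sum>b<p. zero_ext (taylor (entry V c b)) (int n - int j) * coord x (j, b))
          = (\<Sum>j\<le>n. \<Sum>b<p. zero_ext (taylor (entry V c b)) (int n - int j) * coord x (j, b))"
        by (rule suminf_finite) (auto simp: zero_ext_def)
      also have "\<dots> = (\<Sum>j\<le>n. \<Sum>b<p. taylor (entry V c b) (n - j) * coord x (j, b))"
        by (intro sum.cong refl) (auto simp: zero_ext_def nat_diff_distrib)
      also have "\<dots> = (\<Sum>b<p. \<Sum>j\<le>n. taylor (entry V c b) (n - j) * coord x (j, b))" by (rule sum.swap)
      also have "\<dots> = (\<Sum>b<p. \<Sum>l\<le>n. taylor (entry V c b) l * coord x (n - l, b))"
        by (intro sum.cong[OF refl] sum.reindex_bij_witness[of _ "\<lambda>j. n - j" "\<lambda>j. n - j"]) auto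
      also have "\<dots> = coord (toep_op m p V x) (n, c)" using c by (simp add: coord_toep_op[OF V])
      finally show ?thesis unfolding e .
    qed
    then show "toeplitz_H m p V (emb p x) n = emb m (toep_op m p V x) n"
      unfolding toeplitz_H_def toeplitz_def block_op_def by (intro eq_vecI) (simp_all add: emb_def)
  qed
  moreover have "toep_op m p V x \<in> cvec_seqs m" for x by (simp add: cvec_seqs_def coord_toep_op[OF V])
  moreover have "toep_op m p V (unit_l2 (n, b)) = 0" if "b \<ge> p" for n b
  proof (rule l2_eqI)
    fix i show "coord (toep_op m p V (unit_l2 (n, b))) i = coord 0 i"
      using that by (cases i) (simp add: coord_toep_op_unit[OF V])
  qed
  ultimately show ?thesis by (simp add: represents_def cbounded_toep_op[OF V])
qed

lemma represents_hankel:
  assumes V: "V \<in> Hinf m p"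
  shows "represents m p (hankel m p V) (hankel_op m p V)"
proof -
  obtain C where C: "\<And>a b. a < m \<Longrightarrow> b < p \<Longrightarrow> bounded_analytic C (entry V a b)" using Hinf_entry[OF V] by metis
  have "hankel m p V (emb p x) = emb m (hankel_op m p V x)" for x
  proof
    fix n
    have "(\<Sum>j. (taylor_coeff m p V (n + j + 1) *\<^sub>v emb p x j) $ c) = coord (hankel_op m p V x) (n, c)"
      if c: "c < m" for c
    proof -
      have e: "(taylor_coeff m p V (n + j + 1) *\<^sub>v emb p x j) $ c
          = (\<Sum>b<p. taylor (entry V c b) (n + j + 1) * coord x (j, b))" for j
        unfolding emb_def by (subst mult_vec_entry[of _ m]) (simp_all add: taylor_coeff_def c taylor_def)
      have "(\<Sum>j. \<Sum>b<p. taylor (entry V c b) (n + j + 1) * coord x (j, b))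
          = (\<Sum>b<p. \<Sum>j. taylor (entry V c b) (n + j + 1) * coord x (j, b))"
        by (rule suminf_sum) (rule summable_hankel[OF C[OF c]], simp)
      also have "\<dots> = coord (hankel_op m p V x) (n, c)" using c by (simp add: coord_hankel_op[OF V])
      finally show ?thesis unfolding e .
    qed
    then show "hankel m p V (emb p x) n = emb m (hankel_op m p V x) n"
      unfolding hankel_def block_op_def by (intro eq_vecI) (simp_all add: emb_def)
  qed
  moreover have "hankel_op m p V x \<in> cvec_seqs m" for x by (simp add: cvec_seqs_def coord_hankel_op[OF V])
  moreover have "hankel_op m p V (unit_l2 (n, b)) = 0" if "b \<ge> p" for n b
  proof (rule l2_eqI)
    fix i
    have "coord (unit_l2 (n, b)) (j, b') = 0" if "b' < p" for j b' using that \<open>b \<ge> p\<close> by (simp add: coord_unit)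
    then show "coord (hankel_op m p V (unit_l2 (n, b))) i = coord 0 i"
      by (cases i) (simp add: coord_hankel_op[OF V])
  qed
  ultimately show ?thesis by (simp add: represents_def cbounded_hankel_op[OF V])
qed

text \<open>The backward shift drops the first block from the column \<open>V\<^sub>0, V\<^sub>1, \<dots>\<close> of the Toeplitz matrix,
  which leaves the first column of the Hankel matrix.\<close>

lemma bshift_toep_op:
  assumes V: "V \<in> Hinf m p"
  shows "bshift (toep_op m p V (unit_l2 (0, b))) = hankel_op m p V (unit_l2 (0, b))"
proof (rule l2_eqI)
  fix i :: "nat \<times> nat"
  obtain n c where i: "i = (n, c)" by (cases i)
  have "(\<Sum>j. t (n + j + 1) * coord (unit_l2 (0, b)) (j, b')) = (if b' = b then t (n + 1) else 0)" for t b'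
  proof -
    have "(\<Sum>j. t (n + j + 1) * coord (unit_l2 (0, b)) (j, b')) = (\<Sum>j\<in>{0}. t (n + j + 1) * coord (unit_l2 (0, b)) (j, b'))"
      by (rule suminf_finite) (auto simp: coord_unit)
    then show ?thesis by (simp add: coord_unit)
  qed
  note * = this
  show "coord (bshift (toep_op m p V (unit_l2 (0, b)))) i = coord (hankel_op m p V (unit_l2 (0, b))) i"
    unfolding i coord_hankel_op[OF V] * coord_bshift fst_conv snd_conv coord_toep_op_unit[OF V]
    by (simp add: sum.delta zero_ext_def nat_add_distrib)
qed

text \<open>The Hankel matrix depends on \<open>i + j\<close> only, so the backward shift of its rows is a shift of its
  columns. In particular its range is invariant under the backward shift.\<close>

lemma bshift_hankel_op:
  assumes V: "V \<in> Hinf m p"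
  shows "bshift (hankel_op m p V x) = hankel_op m p V (shift x)"
proof (rule l2_eqI)
  fix i :: "nat \<times> nat"
  obtain C where C: "\<And>a b. a < m \<Longrightarrow> b < p \<Longrightarrow> bounded_analytic C (entry V a b)" using Hinf_entry[OF V] by metis
  obtain n c where i: "i = (n, c)" by (cases i)
  have "(\<Sum>j. taylor (entry V c b) (n + j + 1) * coord (shift x) (j, b)) = (\<Sum>j. taylor (entry V c b) (Suc n + j + 1) * coord x (j, b))"
    if "c < m" "b < p" for b
    using suminf_split_head[OF summable_hankel[OF C[OF that], of n "shift x" b]] by (simp add: coord_shift)
  then show "coord (bshift (hankel_op m p V x)) i = coord (hankel_op m p V (shift x)) i"
    unfolding i coord_bshift fst_conv snd_conv coord_hankel_op[OF V] by simp
qed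

section \<open>The symbol of the difference of Toeplitz squares\<close>

lemma cadj_toep_op_unit:
  assumes V: "V \<in> Hinf m p"
  shows "coord (cadj (toep_op m p V) (unit_l2 (k, a))) (l, b) =
    (if a < m \<and> b < p then cnj (zero_ext (taylor (entry V a b)) (int k - int l)) else 0)"
proof -
  have "coord (cadj (toep_op m p V) (unit_l2 (k, a))) (l, b) = cinner (unit_l2 (k, a)) (toep_op m p V (unit_l2 (l, b)))"
    by (simp add: cinner_unit_right[symmetric] cadj'[OF cbounded_toep_op[OF V]])
  then show ?thesis by (simp add: cinner_unit_left coord_toep_op_unit[OF V])
qed

text \<open>Along a diagonal, the entries of \<open>T\<^sub>V T\<^sub>V\<^sup>*\<close> are the partial sums of the series that
  \<open>radial_limit_fourier_product\<close> evaluates.\<close>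

lemma toeplitz_square_limit:
  assumes V: "V \<in> Hinf m p" and aa: "a < m" "a' < m"
  shows "(\<lambda>n. coord (toep_op m p V (cadj (toep_op m p V) (unit_l2 (i + n, a')))) (j + n, a))
    \<longlonglongrightarrow> (\<Sum>b<p. (LINT t|circle. radial_limit (entry V a b) (cis t) *
          (cnj (radial_limit (entry V a' b) (cis t)) * cis (- of_int (int j - int i) * t))) / (2 * of_real pi))"
proof -
  obtain C where C: "\<And>a b. a < m \<Longrightarrow> b < p \<Longrightarrow> bounded_analytic C (entry V a b)" using Hinf_entry[OF V] by metis
  define J where "J b = (LINT t|circle. radial_limit (entry V a b) (cis t) *
          (cnj (radial_limit (entry V a' b) (cis t)) * cis (- of_int (int j - int i) * t)))" for b
  define s where "s b l = taylor (entry V a b) l * cnj (zero_ext (taylor (entry V a' b)) (int l - (int j - int i)))" for b l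
  have s: "s b sums (J b / (2 * of_real pi))" if b: "b < p" for b
  proof -
    have "(\<lambda>l. 2 * of_real pi * s b l) sums J b"
      unfolding s_def J_def by (rule radial_limit_fourier_product[OF C[OF aa(1) b] C[OF aa(2) b]])
    from sums_divide[OF this, of "2 * of_real pi"] show ?thesis by simp
  qed
  have "coord (toep_op m p V (cadj (toep_op m p V) (unit_l2 (i + n, a')))) (j + n, a) = (\<Sum>b<p. \<Sum>l<Suc (j + n). s b l)" for n
  proof -
    have "coord (toep_op m p V (cadj (toep_op m p V) (unit_l2 (i + n, a')))) (j + n, a)
        = (\<Sum>b<p. \<Sum>l\<le>j + n. taylor (entry V a b) l * cnj (zero_ext (taylor (entry V a' b)) (int (i + n) - int (j + n - l))))"
      unfolding coord_toep_op[OF V] using aa by (simp add: cadj_toep_op_unit[OF V])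
    also have "\<dots> = (\<Sum>b<p. \<Sum>l\<le>j + n. s b l)"
    proof (intro sum.cong refl)
      fix b l assume "l \<in> {..j + n}"
      then have "int (i + n) - int (j + n - l) = int l - (int j - int i)" by simp
      then show "taylor (entry V a b) l * cnj (zero_ext (taylor (entry V a' b)) (int (i + n) - int (j + n - l))) = s b l"
        by (simp only: s_def)
    qed
    finally show ?thesis by (simp only: lessThan_Suc_atMost)
  qed
  moreover have "(\<lambda>n. \<Sum>b<p. \<Sum>l<Suc (j + n). s b l) \<longlonglongrightarrow> (\<Sum>b<p. J b / (2 * of_real pi))"
  proof (rule tendsto_sum)
    fix b assume "b \<in> {..<p}"
    then have "(\<lambda>N. \<Sum>l<N. s b l) \<longlonglongrightarrow> J b / (2 * of_real pi)" using s by (simp add: sums_def)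
    from LIMSEQ_ignore_initial_segment[OF this, of "Suc j"]
    show "(\<lambda>n. \<Sum>l<Suc (j + n). s b l) \<longlonglongrightarrow> J b / (2 * of_real pi)" by (simp add: add.commute)
  qed
  ultimately show ?thesis unfolding J_def by (simp only:)
qed

section \<open>Bounded operators commuting with the shift\<close>

lemma norm_mono_l2:
  assumes "\<And>i. cmod (coord x i) \<le> cmod (coord y i)"
  shows "norm x \<le> norm y"
proof -
  have "(norm x)\<^sup>2 \<le> (norm y)\<^sup>2"
    unfolding norm_square_l2 by (intro infsum_mono coord_summable power_mono assms) auto
  then show ?thesis by (rule power2_le_imp_le) simp
qed

text \<open>The reproducing kernel of the Hardy space at the point \<open>z\<close>, placed in component \<open>a\<close>.\<close>

definition kernel_vec :: "complex \<Rightarrow> nat \<Rightarrow> seq2" where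
  "kernel_vec z a = mk_l2 (\<lambda>i. if snd i = a then cnj z ^ fst i else 0)"

lemma coord_kernel_vec:
  assumes z: "cmod z < 1"
  shows "coord (kernel_vec z a) (n, c) = (if c = a then cnj z ^ n else 0)"
proof -
  have z2: "(cmod z)\<^sup>2 < 1" using z by (simp add: power_less_one_iff abs_square_less_1)
  define C where "C = 1 / sqrt (1 - (cmod z)\<^sup>2)"
  have C: "C \<ge> 0" "C\<^sup>2 = 1 / (1 - (cmod z)\<^sup>2)" using z2 by (auto simp: C_def power_divide)
  have "(\<Sum>n<N. (cmod (cnj z ^ n))\<^sup>2) \<le> (C * norm (unit_l2 (0::nat)))\<^sup>2" for N
  proof -
    have "(\<Sum>n<N. (cmod (cnj z ^ n))\<^sup>2) = (\<Sum>n<N. ((cmod z)\<^sup>2) ^ n)"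
      by (simp add: norm_power power_mult[symmetric] mult.commute)
    also have "\<dots> \<le> (\<Sum>n. ((cmod z)\<^sup>2) ^ n)"
      using z2 by (intro sum_le_suminf summable_geometric) auto
    also have "\<dots> = C\<^sup>2" using z2 C(2) by (simp add: suminf_geometric)
    finally show ?thesis by simp
  qed
  from column_op(1)[OF C(1) this] show ?thesis by (simp add: kernel_vec_def)
qed

lemma cinner_kernel_vec:
  assumes z: "cmod z < 1"
  shows "(\<lambda>n. cnj z ^ n * cnj (coord x (n, a))) sums cinner (kernel_vec z a) x"
proof -
  have "kernel_vec z a \<in> cvec_seqs (Suc a)" by (simp add: cvec_seqs_def coord_kernel_vec[OF z])
  from cinner_sums[OF this, of x]
  have "(\<lambda>n. \<Sum>c<Suc a. (if c = a then cnj z ^ n else 0) * cnj (coord x (n, c))) sums cinner (kernel_vec z a) x"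
    by (simp only: coord_kernel_vec[OF z])
  moreover have "(\<Sum>c<Suc a. (if c = a then cnj z ^ n else 0) * cnj (coord x (n, c))) = cnj z ^ n * cnj (coord x (n, a))" for n
  proof -
    have "(\<Sum>c<Suc a. (if c = a then cnj z ^ n else 0) * cnj (coord x (n, c)))
        = (\<Sum>c<Suc a. if c = a then cnj z ^ n * cnj (coord x (n, c)) else 0)"
      by (rule sum.cong) auto
    then show ?thesis by (simp add: sum.delta)
  qed
  ultimately show ?thesis by simp
qed

lemma norm_kernel_vec:
  assumes z: "cmod z < 1"
  shows "norm (kernel_vec z a) = norm (kernel_vec z b)" "norm (kernel_vec z a) > 0"
proof -
  have s: "(\<lambda>n. cnj z ^ n * cnj (cnj z ^ n)) sums cinner (kernel_vec z a) (kernel_vec z a)" for a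
    using cinner_kernel_vec[OF z, of "kernel_vec z a" a] by (simp add: coord_kernel_vec[OF z])
  have "cinner (kernel_vec z a) (kernel_vec z a) = cinner (kernel_vec z b) (kernel_vec z b)"
    by (rule sums_unique2[OF s s])
  then have "(norm (kernel_vec z a))\<^sup>2 = (norm (kernel_vec z b))\<^sup>2"
    unfolding cinner_self of_real_eq_iff .
  then show "norm (kernel_vec z a) = norm (kernel_vec z b)" by (simp add: power2_eq_iff_nonneg)
  have "1 \<le> norm (kernel_vec z a)"
    using norm_coord_le[of "kernel_vec z a" "(0, a)"] by (simp add: coord_kernel_vec[OF z])
  then show "norm (kernel_vec z a) > 0" by linarith
qed

text \<open>A kernel vector is an eigenvector of the backward shift, with the conjugate of \<open>z\<close> as eigenvalue.
  The adjoint of \<open>T\<close> commutes with the backward shift, so it maps the kernel vector to an eigenvector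
  for the same eigenvalue. Its component \<open>b\<close> is then the kernel sequence times its coordinate in
  block 0, which is the conjugate of \<open>w\<close>. Comparing norms bounds \<open>w\<close>.\<close>

lemma symbol_bound:
  assumes T: "cbounded T" and comm: "\<And>x. T (shift x) = shift (T x)"
    and C: "C \<ge> 0" "\<And>x. norm (cadj T x) \<le> C * norm x" and z: "cmod z < 1"
    and f: "(\<lambda>n. coord (T (unit_l2 (0, b))) (n, a) * z ^ n) sums w"
  shows "cmod w \<le> C"
proof -
  define v where "v = cadj T (kernel_vec z a)"
  have bk: "bshift (kernel_vec z a) = cscale (cnj z) (kernel_vec z a)"
  proof (rule l2_eqI)
    fix i show "coord (bshift (kernel_vec z a)) i = coord (cscale (cnj z) (kernel_vec z a)) i"
      by (cases i) (simp add: coord_kernel_vec[OF z])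
  qed
  have "bshift v = cadj T (bshift (kernel_vec z a))"
    unfolding v_def
    by (rule eq_from_cinner) (simp add: cinner_shift[symmetric] cadj[OF T, symmetric] comm)
  then have bv: "bshift v = cscale (cnj z) v"
    unfolding bk cbounded_simps(4)[OF cbounded_cadj[OF T]] v_def[symmetric] .
  have vn: "coord v (n, b) = cnj z ^ n * coord v (0, b)" for n
  proof (induction n)
    case (Suc n)
    have "coord v (Suc n, b) = coord (bshift v) (n, b)" by simp
    also have "\<dots> = cnj z * coord v (n, b)" unfolding bv by simp
    finally show ?case using Suc by simp
  qed simp
  have "coord v (0, b) = cinner (kernel_vec z a) (T (unit_l2 (0, b)))"
    unfolding v_def cinner_unit_right[symmetric] cadj'[OF T] ..
  moreover have "(\<lambda>n. cnj z ^ n * cnj (coord (T (unit_l2 (0, b))) (n, a))) sums cnj w"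
  proof -
    have "(\<lambda>n. cnj (coord (T (unit_l2 (0, b))) (n, a) * z ^ n)) sums cnj w" using f by (simp only: sums_cnj)
    then show ?thesis by (simp add: mult.commute)
  qed
  ultimately have v0: "coord v (0, b) = cnj w"
    using sums_unique2[OF cinner_kernel_vec[OF z]] by simp
  have cv: "coord v (n, b) = cnj z ^ n * cnj w" for n
    unfolding v0[symmetric] by (rule vn)
  have "norm (cscale (cnj w) (kernel_vec z b)) \<le> norm v"
  proof (rule norm_mono_l2)
    fix i :: "nat \<times> nat"
    obtain n c where i: "i = (n, c)" by (cases i)
    show "cmod (coord (cscale (cnj w) (kernel_vec z b)) i) \<le> cmod (coord v i)"
      by (cases "c = b") (simp_all add: i coord_kernel_vec[OF z] cv mult.commute)
  qed
  also have "\<dots> \<le> C * norm (kernel_vec z a)" unfolding v_def by (rule C)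
  finally have "cmod w * norm (kernel_vec z b) \<le> C * norm (kernel_vec z b)"
    using norm_kernel_vec(1)[OF z, of a b] by simp
  then show ?thesis using norm_kernel_vec(2)[OF z, of b] by simp
qed

text \<open>The block in position 0 determines everything: an operator commuting with the shift is determined
  by its values at the unit vectors of block 0, and these values list the Taylor coefficients of the
  entries of \<open>F\<close>. The entries are bounded by \<open>symbol_bound\<close>.\<close>

theorem shift_commuting_is_toeplitz:
  assumes T: "cbounded T" and comm: "\<And>x. T (shift x) = shift (T x)"
    and ran: "\<And>x n a. a \<ge> m \<Longrightarrow> coord (T x) (n, a) = 0"
    and dom: "\<And>n b. b \<ge> k \<Longrightarrow> T (unit_l2 (n, b)) = 0"
  obtains F where "F \<in> Hinf m k" "represents m k (toeplitz_H m k F) T"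
proof -
  define c where "c a b n = coord (T (unit_l2 (0, b))) (n, a)" for a b n
  define f where "f a b z = (\<Sum>n. c a b n * z ^ n)" for a b z
  define F where "F z = mat m k (\<lambda>(a, b). f a b z)" for z
  obtain C where C: "C \<ge> 0" "\<And>x. norm (cadj T x) \<le> C * norm x" using cbounded_bound[OF cbounded_cadj[OF T]] by blast
  have c2: "summable (\<lambda>n. (cmod (c a b n))\<^sup>2)" for a b unfolding c_def by (rule summable_column)
  have f: "(\<lambda>n. c a b n * z ^ n) sums f a b z" if z: "cmod z < 1" for a b z
  proof -
    have "summable (\<lambda>n. norm (c a b n * complex_of_real (cmod z) ^ n))"
      by (rule summable_dilation_l2[OF c2]) (use z in auto)
    then have "summable (\<lambda>n. norm (c a b n * z ^ n))" by (simp add: norm_mult norm_power)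
    then have "summable (\<lambda>n. c a b n * z ^ n)" by (rule summable_norm_cancel)
    then show ?thesis unfolding f_def by (rule summable_sums)
  qed
  have ba: "bounded_analytic C (f a b)" for a b
    unfolding bounded_analytic_def
  proof (intro conjI ballI)
    show "f a b holomorphic_on ball 0 1"
      by (rule power_series_holomorphic[where a="c a b"]) (use f in simp)
    fix z :: complex assume "z \<in> ball 0 1"
    then have z: "cmod z < 1" by simp
    show "cmod (f a b z) \<le> C" by (rule symbol_bound[OF T comm C z f[OF z, unfolded c_def]])
  qed
  have entry: "entry F a b = f a b" if "a < m" "b < k" for a b
    using that by (auto simp: F_def)
  have FH: "F \<in> Hinf m k"
    unfolding Hinf_def mem_Collect_eq
  proof (intro conjI ballI allI impI exI[of _ C])
    show "F z \<in> carrier_mat m k" for z by (simp add: F_def)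
    show "entry F a b holomorphic_on ball 0 1" if "a < m" "b < k" for a b
      unfolding entry[OF that] using ba by (simp add: bounded_analytic_def)
    show "cmod (F z $$ (a, b)) \<le> C" if "z \<in> ball 0 1" "a < m" "b < k" for z a b
      using fun_cong[OF entry[OF that(2,3)], of z] ba[of a b] that(1) by (simp add: bounded_analytic_def)
  qed
  \<comment> \<open>on the circle of radius 1/2 both sequences give the same absolutely convergent Fourier series\<close>
  have tcf: "taylor (f a b) n = c a b n" for a b n
  proof -
    let ?r = "1 / 2 :: real"
    have s: "summable (\<lambda>n. norm (c a b n * complex_of_real ?r ^ n))" by (rule summable_dilation_l2[OF c2]) auto
    have "fseries (\<lambda>n. taylor (f a b) n * of_real ?r ^ n) t = fseries (\<lambda>n. c a b n * of_real ?r ^ n) t" for t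
    proof -
      have "cmod (complex_of_real ?r * cis t) < 1" by (simp add: norm_mult norm_divide)
      from sums_unique[OF f[OF this, of a b]]
      have "f a b (of_real ?r * cis t) = fseries (\<lambda>n. c a b n * of_real ?r ^ n) t"
        unfolding fseries_def power_mult_distrib Complex.DeMoivre mult.assoc .
      then show ?thesis using taylor_fseries[OF ba, of ?r a b t] by simp
    qed
    then have "zero_ext (\<lambda>n. taylor (f a b) n * of_real ?r ^ n) (int n) = zero_ext (\<lambda>n. c a b n * of_real ?r ^ n) (int n)"
      using fseries_coeff[OF s, of "int n"] fseries_coeff[OF summable_taylor_dilation[OF ba, of ?r a b], of "int n"] by simp
    then show ?thesis by (simp add: zero_ext_def)
  qed
  have T0: "toep_op m k F (unit_l2 (0, b)) = T (unit_l2 (0, b))" for b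
  proof (rule l2_eqI)
    fix i :: "nat \<times> nat"
    obtain n a where i: "i = (n, a)" by (cases i)
    consider "a < m" "b < k" | "a \<ge> m" | "b \<ge> k" by linarith
    then show "coord (toep_op m k F (unit_l2 (0, b))) i = coord (T (unit_l2 (0, b))) i"
    proof cases
      case 1
      then show ?thesis by (simp add: i coord_toep_op_unit[OF FH] entry tcf zero_ext_def c_def)
    next
      case 2
      then show ?thesis by (simp add: i coord_toep_op_unit[OF FH] ran)
    next
      case 3
      then show ?thesis by (simp add: i coord_toep_op_unit[OF FH] dom)
    qed
  qed
  have comm_pow: "U ((shift ^^ n) x) = (shift ^^ n) (U x)" if "\<And>x. U (shift x) = shift (U x)" for U n x
    by (induction n) (simp_all add: that)
  have "toep_op m k F x = T x" for x
  proof (rule cbounded_eqI[OF cbounded_toep_op[OF FH] T])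
    fix i :: "nat \<times> nat"
    obtain n b where i: "i = (n, b)" by (cases i)
    have u: "unit_l2 i = (shift ^^ n) (unit_l2 (0, b))" by (simp add: i shift_power_unit)
    show "toep_op m k F (unit_l2 i) = T (unit_l2 i)"
      unfolding u comm_pow[of "toep_op m k F", OF toep_op_shift[OF FH]] comm_pow[of T, OF comm] T0 ..
  qed
  then have "toep_op m k F = T" by (rule ext)
  with represents_toeplitz[OF FH] have "represents m k (toeplitz_H m k F) T" by simp
  with FH show ?thesis by (rule that)
qed

section \<open>Fourier coefficients of the symbol\<close>

lemma mat_adjoint_entry:
  assumes "A \<in> carrier_mat m p" "b < m" "c < p"
  shows "mat_adjoint A $$ (c, b) = cnj (A $$ (b, c))"
  using assms by (simp add: mat_adjoint_def mat_of_rows_def)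

lemma mult_adjoint_entry:
  assumes "A \<in> carrier_mat m p" "a < m" "b < m"
  shows "(A * mat_adjoint A) $$ (a, b) = (\<Sum>c<p. A $$ (a, c) * cnj (A $$ (b, c)))"
proof -
  have "mat_adjoint A \<in> carrier_mat p m" using assms(1) by (simp add: mat_adjoint_def mat_of_rows_def)
  then show ?thesis
    using assms mat_adjoint_entry[OF assms(1,3)] by (simp add: scalar_prod_def atLeast0LessThan)
qed

text \<open>This brings the Fourier coefficients of the symbol into the form in which they arise as limits in
  \<open>toeplitz_square_limit\<close>.\<close>

lemma fourier_coeff_symbol:
  assumes G: "G \<in> Hinf m p" and K: "K \<in> Hinf m q" and R: "R \<in> Linf m m"
    and R_eq: "AE t in circle. R (cis t) = bdry m p G (cis t) * mat_adjoint (bdry m p G (cis t))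
        - bdry m q K (cis t) * mat_adjoint (bdry m q K (cis t))"
    and ab: "a < m" "b < m"
  shows "fourier_coeff m m R j $$ (a, b) =
    (\<Sum>c<p. (LINT t|circle. radial_limit (entry G a c) (cis t) * (cnj (radial_limit (entry G b c) (cis t)) * cis (- of_int j * t))) / (2 * of_real pi)) -
    (\<Sum>c<q. (LINT t|circle. radial_limit (entry K a c) (cis t) * (cnj (radial_limit (entry K b c) (cis t)) * cis (- of_int j * t))) / (2 * of_real pi))"
proof -
  define h where "h V c t = radial_limit (entry V a c) (cis t) * (cnj (radial_limit (entry V b c) (cis t)) * cis (- of_int j * t))" for V c t
  have hint: "integrable circle (h V c)" if V: "V \<in> Hinf m l" and c: "c < l" for V l c
  proof -
    obtain C where C: "\<And>a b. a < m \<Longrightarrow> b < l \<Longrightarrow> bounded_analytic C (entry V a b)" using Hinf_entry[OF V] by metis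
    show ?thesis unfolding h_def by (rule radial_limit_product_dominated(1)[OF C[OF ab(1) c] C[OF ab(2) c]])
  qed
  have e: "(bdry m l V z * mat_adjoint (bdry m l V z)) $$ (a, b)
      = (\<Sum>c<l. radial_limit (entry V a c) z * cnj (radial_limit (entry V b c) z))" for l V z
  proof -
    have c: "bdry m l V z \<in> carrier_mat m l" by (simp add: bdry_def)
    have en: "bdry m l V z $$ (i, c) = radial_limit (entry V i c) z" if "i < m" "c < l" for i c
      using that by (simp add: bdry_def radial_limit_def)
    show ?thesis unfolding mult_adjoint_entry[OF c ab] by (intro sum.cong refl) (simp add: en ab)
  qed
  have "AE t in circle. R (cis t) $$ (a, b) * cis (- of_int j * t) = (\<Sum>c<p. h G c t) - (\<Sum>c<q. h K c t)"
    using R_eq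
  proof eventually_elim
    case (elim t)
    have d: "mat_adjoint (bdry m l V z) \<in> carrier_mat l m" for l V z
      by (simp add: bdry_def mat_adjoint_def mat_of_rows_def)
    have "R (cis t) $$ (a, b) = (bdry m p G (cis t) * mat_adjoint (bdry m p G (cis t))) $$ (a, b)
        - (bdry m q K (cis t) * mat_adjoint (bdry m q K (cis t))) $$ (a, b)"
      unfolding elim using ab d[of q K "cis t"] by (simp add: bdry_def[of m q])
    then show ?case unfolding e h_def by (simp add: left_diff_distrib sum_distrib_right mult.assoc)
  qed
  then have "(LINT t|circle. R (cis t) $$ (a, b) * cis (- of_int j * t)) = (LINT t|circle. (\<Sum>c<p. h G c t) - (\<Sum>c<q. h K c t))"
  proof (rule integral_cong_AE[rotated -1])
    have Rm: "(\<lambda>t. R (cis t) $$ (a, b)) \<in> borel_measurable circle" using R ab by (simp add: Linf_def)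
    have cm: "(\<lambda>t. cis (- of_int j * t)) \<in> borel_measurable circle"
      by (rule borel_measurable_integrable[OF integrable_circle]) (intro continuous_intros)
    show "(\<lambda>t. R (cis t) $$ (a, b) * cis (- of_int j * t)) \<in> borel_measurable circle"
      by (rule borel_measurable_times[OF Rm cm])
    show "(\<lambda>t. (\<Sum>c<p. h G c t) - (\<Sum>c<q. h K c t)) \<in> borel_measurable circle"
      by (intro borel_measurable_integrable Bochner_Integration.integrable_diff Bochner_Integration.integrable_sum)
         (auto intro: hint G K)
  qed
  also have "\<dots> = (LINT t|circle. (\<Sum>c<p. h G c t)) - (LINT t|circle. (\<Sum>c<q. h K c t))"
    by (intro Bochner_Integration.integral_diff Bochner_Integration.integrable_sum) (auto intro: hint G K)
  also have "\<dots> = (\<Sum>c<p. LINT t|circle. h G c t) - (\<Sum>c<q. LINT t|circle. h K c t)"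
    by (subst (1 2) Bochner_Integration.integral_sum) (auto intro: hint G K)
  finally show ?thesis
    using ab unfolding fourier_coeff_def h_def by (simp add: diff_divide_distrib sum_divide_distrib)
qed

lemma toeplitz_unit:
  assumes ab: "a < m" "b < m"
  shows "toeplitz m m R (emb m (unit_l2 (i, b))) j $ a = fourier_coeff m m R (int j - int i) $$ (a, b)"
proof -
  have e: "(fourier_coeff m m R k *\<^sub>v emb m (unit_l2 (i, b)) l) $ a = (if l = i then fourier_coeff m m R k $$ (a, b) else 0)" for k l
  proof -
    have "fourier_coeff m m R k \<in> carrier_mat m m" by (simp add: fourier_coeff_def)
    then have "(fourier_coeff m m R k *\<^sub>v emb m (unit_l2 (i, b)) l) $ a
        = (\<Sum>c<m. fourier_coeff m m R k $$ (a, c) * coord (unit_l2 (i, b)) (l, c))"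
      unfolding emb_def by (rule mult_vec_entry[OF _ ab(1)])
    also have "\<dots> = (\<Sum>c<m. if c = b then if l = i then fourier_coeff m m R k $$ (a, b) else 0 else 0)"
      by (rule sum.cong) (auto simp: coord_unit)
    finally show ?thesis using ab by (simp add: sum.delta)
  qed
  have "(\<Sum>l. if l = i then fourier_coeff m m R (int j - int l) $$ (a, b) else 0) = fourier_coeff m m R (int j - int i) $$ (a, b)"
    using suminf_finite[of "{i}" "\<lambda>l. if l = i then fourier_coeff m m R (int j - int l) $$ (a, b) else 0"] by simp
  then show ?thesis unfolding toeplitz_def block_op_def using ab by (simp add: e)
qed

text \<open>The entries of the compressions converge to the Fourier coefficients of \<open>R\<close>, and these are the
  entries of \<open>T\<^sub>R = T\<^sub>\<Phi>\<^sup>* T\<^sub>\<Phi>\<close>. At components from \<open>m\<close> on both sides are 0.\<close>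

lemma limit_of_shifted_compressions:
  assumes G: "G \<in> Hinf m p" and K: "K \<in> Hinf m q" and \<Phi>: "\<Phi> \<in> Hinf r m" and R: "R \<in> Linf m m"
    and R_eq: "AE t in circle. R (cis t) = bdry m p G (cis t) * mat_adjoint (bdry m p G (cis t))
        - bdry m q K (cis t) * mat_adjoint (bdry m q K (cis t))"
    and factor: "\<And>x. x \<in> ell2 m \<Longrightarrow>
        toeplitz m m R x = adjoint_op m (toeplitz_H r m \<Phi>) (toeplitz_H r m \<Phi> x)"
    and A_def: "A = (\<lambda>y. toep_op m p G (cadj (toep_op m p G) y) - toep_op m q K (cadj (toep_op m q K) y))"
  shows "(\<lambda>n. cinner (A ((shift ^^ n) (unit_l2 x))) ((shift ^^ n) (unit_l2 y)))
      \<longlonglongrightarrow> cinner (toep_op r m \<Phi> (unit_l2 x)) (toep_op r m \<Phi> (unit_l2 y))"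
proof -
  obtain i b j a where xy: "x = (i, b)" "y = (j, a)" by (cases x, cases y)
  note rP = represents_toeplitz[OF \<Phi>] and rG = represents_toeplitz[OF G] and rK = represents_toeplitz[OF K]
  define P where "P = toep_op r m \<Phi>"
  have P: "cbounded P" unfolding P_def by (rule cbounded_toep_op[OF \<Phi>])
  have compr: "cinner (A ((shift ^^ n) (unit_l2 x))) ((shift ^^ n) (unit_l2 y))
      = coord (toep_op m p G (cadj (toep_op m p G) (unit_l2 (i + n, b)))) (j + n, a)
        - coord (toep_op m q K (cadj (toep_op m q K) (unit_l2 (i + n, b)))) (j + n, a)" for n
    by (simp add: xy shift_power_unit cinner_unit_right A_def)
  show ?thesis
  proof (cases "a < m \<and> b < m")
    case True
    then have ab: "a < m" "b < m" by auto
    have "toeplitz m m R (emb m (unit_l2 x)) = emb m (cadj P (P (unit_l2 x)))"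
      unfolding factor[OF emb_in_ell2] representsD(2)[OF rP] representsD(2)[OF represents_adjoint[OF rP]] P_def ..
    then have "fourier_coeff m m R (int j - int i) $$ (a, b) = coord (cadj P (P (unit_l2 x))) (j, a)"
      using toeplitz_unit[OF ab, of R i j] ab(1) by (simp add: xy emb_def)
    also have "\<dots> = cinner (P (unit_l2 x)) (P (unit_l2 y))"
      by (simp add: cinner_unit_right[symmetric] cadj'[OF P] xy)
    finally have "cinner (P (unit_l2 x)) (P (unit_l2 y)) = fourier_coeff m m R (int j - int i) $$ (a, b)" ..
    then show ?thesis
      unfolding compr P_def[symmetric]
      unfolding fourier_coeff_symbol[OF G K R R_eq ab]
      by (simp only:) (intro tendsto_diff toeplitz_square_limit G K ab)
  next
    case False
    have "cinner (P (unit_l2 x)) (P (unit_l2 y)) = 0"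
      using False representsD(4)[OF rP] by (auto simp: xy P_def not_less)
    moreover have "cinner (A ((shift ^^ n) (unit_l2 x))) ((shift ^^ n) (unit_l2 y)) = 0" for n
    proof (cases "a < m")
      case True
      then have b: "b \<ge> m" using False by simp
      show ?thesis
        unfolding compr representsD(4)[OF represents_adjoint[OF rG] b] representsD(4)[OF represents_adjoint[OF rK] b]
          cbounded_simps(3)[OF representsD(1)[OF rG]] cbounded_simps(3)[OF representsD(1)[OF rK]] by simp
    next
      case False
      then show ?thesis unfolding compr by (simp add: coord_toep_op[OF G] coord_toep_op[OF K])
    qed
    ultimately show ?thesis unfolding P_def by simp
  qed
qed

theorem theorem0p1:
  fixes m p q :: nat and G K R :: "complex \<Rightarrow> complex mat"
  assumes G: "G \<in> Hinf m p" and K: "K \<in> Hinf m q"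
    and pos: "positive_op m (toeplitz_sq m p G - toeplitz_sq m q K)"
    and R: "R \<in> Linf m m"
    and R_eq: "AE t in lebesgue_on {0..2*pi}.
      R (cis t) = bdry m p G (cis t) * mat_adjoint (bdry m p G (cis t))
                - bdry m q K (cis t) * mat_adjoint (bdry m q K (cis t))"
    and factor: "\<exists>r \<Phi>. outer_spectral_factor m R r \<Phi>"
  shows "\<exists>k\<le>m. \<exists>F\<in>Hinf m k.
      positive_op m (toeplitz_sq m p G - toeplitz_sq m q K - toeplitz_sq m k F) \<and>
      rank_op m m (toeplitz_sq m p G - toeplitz_sq m q K - toeplitz_sq m k F)
        \<le>o hilbert_dim (ell2_closure m
              (set_sum (hankel m p G ` ell2 p) (hankel m q K ` ell2 q)))"
proof -
  obtain r \<Phi> where r: "r \<le> m" and \<Phi>: "\<Phi> \<in> Hinf r m"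
    and fac: "\<And>x. x \<in> ell2 m \<Longrightarrow>
        toeplitz m m R x = adjoint_op m (toeplitz_H r m \<Phi>) (toeplitz_H r m \<Phi> x)"
    using factor unfolding outer_spectral_factor_def by blast
  define TG TK P HG HK where "TG = toep_op m p G" and "TK = toep_op m q K" and "P = toep_op r m \<Phi>"
    and "HG = hankel_op m p G" and "HK = hankel_op m q K"
  note defs = TG_def TK_def P_def HG_def HK_def
  define A where "A = (\<lambda>y. TG (cadj TG y) - TK (cadj TK y))"
  have rG: "represents m p (toeplitz_H m p G) TG" and rK: "represents m q (toeplitz_H m q K) TK"
    and rP: "represents r m (toeplitz_H r m \<Phi>) P"
    and rHG: "represents m p (hankel m p G) HG" and rHK: "represents m q (hankel m q K) HK"
    unfolding defs by (intro represents_toeplitz represents_hankel G K \<Phi>)+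
  note TG = representsD(1)[OF rG] and TK = representsD(1)[OF rK] and P = representsD(1)[OF rP]
    and HG = representsD(1)[OF rHG] and HK = representsD(1)[OF rHK]
  have rA: "represents m m (toeplitz_sq m p G - toeplitz_sq m q K) A"
    unfolding A_def toeplitz_sq_def
    by (rule represents_diff[OF represents_compose[OF rG represents_adjoint[OF rG]]
          represents_compose[OF rK represents_adjoint[OF rK]]])
  have A_pos: "0 \<le> inner (A y) y" for y
    using pos unfolding represents_positive[OF rA] by (simp add: inner_l2_def less_eq_complex_def)

  define S where "S = {x + y | x y. x \<in> range HG \<and> y \<in> range HK}"
  have S_mem: "HG x + HK y \<in> S" for x y unfolding S_def by blast
  have S_sub: "S \<subseteq> cvec_seqs m"
    using csubspaceD(2)[OF cvec_seqs_csubspace representsD(3)[OF rHG] representsD(3)[OF rHK]] by (auto simp: S_def)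
  have S: "csubspace S"
  proof (rule csubspaceI)
    show "0 \<in> S" using S_mem[of 0 0] by (simp add: cbounded_simps(3)[OF HG] cbounded_simps(3)[OF HK])
    fix u c assume "u \<in> S"
    then obtain x y where u: "u = HG x + HK y" by (auto simp: S_def)
    show "cscale c u \<in> S"
      using S_mem[of "cscale c x" "cscale c y"] by (simp add: u cbounded_simps(4)[OF HG] cbounded_simps(4)[OF HK])
    fix v assume "v \<in> S"
    then obtain x' y' where v: "v = HG x' + HK y'" by (auto simp: S_def)
    show "u + v \<in> S"
      using S_mem[of "x + x'" "y + y'"] by (simp add: u v cbounded_simps(1)[OF HG] cbounded_simps(1)[OF HK] add_ac)
  qed
  define M where "M = closure S"
  have M: "csubspace M" "closed M" unfolding M_def by (auto intro: csubspace_closure S)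
  have SM: "x \<in> S \<Longrightarrow> x \<in> M" for x unfolding M_def using closure_subset by (rule subsetD)
  have M_sub: "M \<subseteq> cvec_seqs m" unfolding M_def by (rule closure_minimal[OF S_sub cvec_seqs_closed])
  have M_inv: "bshift x \<in> M" if "x \<in> M" for x
  proof -
    have "M \<subseteq> bshift -` M"
      unfolding M_def
    proof (rule closure_minimal)
      show "closed (bshift -` closure S)"
        using continuous_closed_preimage[OF cbounded_continuous[OF cbounded_bshift, of UNIV] closed_UNIV closed_closure]
        by simp
      show "S \<subseteq> bshift -` closure S"
      proof
        fix u assume "u \<in> S"
        then obtain x y where u: "u = HG x + HK y" by (auto simp: S_def)
        have "bshift u = HG (shift x) + HK (shift y)"
          unfolding u cbounded_simps(1)[OF cbounded_bshift] HG_def HK_def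
          by (simp only: bshift_hankel_op[OF G] bshift_hankel_op[OF K])
        then have "bshift u \<in> M" using S_mem SM by simp
        then show "u \<in> bshift -` closure S" by (simp add: M_def)
      qed
    qed
    then show ?thesis using that by blast
  qed
  have MG: "bshift (TG (unit_l2 (0, b))) \<in> M" for b
    using SM[OF S_mem[of "unit_l2 (0, b)" 0]]
    by (simp add: cbounded_simps(3)[OF HK] TG_def HG_def bshift_toep_op[OF G])
  have MK: "bshift (TK (unit_l2 (0, b))) \<in> M" for b
    using SM[OF S_mem[of 0 "unit_l2 (0, b)"]]
    by (simp add: cbounded_simps(3)[OF HG] TK_def HK_def bshift_toep_op[OF K])

  have lim: "(\<lambda>n. cinner (A ((shift ^^ n) (unit_l2 i))) ((shift ^^ n) (unit_l2 j)))
      \<longlonglongrightarrow> cinner (P (unit_l2 i)) (P (unit_l2 j))" for i j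
    unfolding P_def by (rule limit_of_shifted_compressions[OF G K \<Phi> R R_eq fac A_def[unfolded TG_def TK_def]])
  have comm: "TG (shift x) = shift (TG x)" "TK (shift x) = shift (TK x)" "P (shift x) = shift (P x)" for x
    unfolding defs by (rule toep_op_shift[OF G] toep_op_shift[OF K] toep_op_shift[OF \<Phi>])+
  have P_ran: "coord (P x) (n, a) = 0" if "a \<ge> r" for x n a
    by (rule cvec_seqsD[OF representsD(3)[OF rP] that])
  have P_dom: "P (unit_l2 (n, a)) = 0" if "a \<ge> m" for n a by (rule representsD(4)[OF rP that])
  obtain k \<Gamma> where k: "k \<le> r" and \<Gamma>: "cbounded \<Gamma>" and \<Gamma>_comm: "\<And>x. \<Gamma> (shift x) = shift (\<Gamma> x)"
    and \<Gamma>_dom: "\<And>n b. b \<ge> k \<Longrightarrow> \<Gamma> (unit_l2 (n, b)) = 0"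
    and \<Gamma>_ran: "\<And>x n a. a \<ge> m \<Longrightarrow> coord (\<Gamma> x) (n, a) = 0"
    and D_pos: "\<And>y. 0 \<le> inner (A y - \<Gamma> (cadj \<Gamma> y)) y"
    and D_M: "\<And>y. A y - \<Gamma> (cadj \<Gamma> y) \<in> M"
    by (rule toeplitz_square_splitting[OF TG TK P comm A_def A_pos lim M M_inv MG MK P_ran P_dom]) blast+
  obtain F where F: "F \<in> Hinf m k" and rF: "represents m k (toeplitz_H m k F) \<Gamma>"
    by (rule shift_commuting_is_toeplitz[OF \<Gamma> \<Gamma>_comm \<Gamma>_ran \<Gamma>_dom])
  define D where "D = (\<lambda>y. A y - \<Gamma> (cadj \<Gamma> y))"
  let ?T = "toeplitz_sq m p G - toeplitz_sq m q K - toeplitz_sq m k F"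
  have rD: "represents m m ?T D"
    unfolding D_def toeplitz_sq_def[of m k F]
    by (rule represents_diff[OF rA represents_compose[OF rF represents_adjoint[OF rF]]])
  have "positive_op m ?T"
    unfolding represents_positive[OF rD]
  proof
    fix x
    have "cinner (D x) x = cinner x (D x)"
      by (simp add: D_def A_def cinner_diff_left cinner_diff_right cadj[OF TG] cadj[OF TK] cadj[OF \<Gamma>]
          cadj'[OF TG] cadj'[OF TK] cadj'[OF \<Gamma>])
    also have "\<dots> = cnj (cinner (D x) x)" by (rule cinner_commute)
    finally have "Im (cinner (D x) x) = 0" by (simp add: complex_eq_iff)
    moreover have "0 \<le> Re (cinner (D x) x)" using D_pos[of x] by (simp add: D_def inner_l2_def)
    ultimately show "0 \<le> cinner (D x) x" by (simp add: less_eq_complex_def)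
  qed
  moreover have "rank_op m m ?T \<le>o hilbert_dim (ell2_closure m (set_sum (hankel m p G ` ell2 p) (hankel m q K ` ell2 q)))"
  proof -
    have DM: "range D \<subseteq> M" using D_M by (auto simp: D_def)
    have "ell2_closure m (?T ` ell2 m) = emb m ` closure (range D)"
      unfolding represents_image[OF rD] using DM M_sub by (intro ell2_closure_emb) auto
    moreover have "set_sum (hankel m p G ` ell2 p) (hankel m q K ` ell2 q) = emb m ` S"
    proof (intro equalityI subsetI)
      fix z assume "z \<in> set_sum (hankel m p G ` ell2 p) (hankel m q K ` ell2 q)"
      then obtain x y where "z = (\<lambda>n. emb m (HG x) n + emb m (HK y) n)"
        unfolding represents_image[OF rHG] represents_image[OF rHK] set_sum_def by blast
      then show "z \<in> emb m ` S" unfolding emb_add using S_mem by blast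
    next
      fix z assume "z \<in> emb m ` S"
      then obtain x y where "z = emb m (HG x + HK y)" by (auto simp: S_def)
      then have "z = (\<lambda>n. emb m (HG x) n + emb m (HK y) n)" by (simp only: emb_add)
      then show "z \<in> set_sum (hankel m p G ` ell2 p) (hankel m q K ` ell2 q)"
        unfolding represents_image[OF rHG] represents_image[OF rHK] set_sum_def by blast
    qed
    moreover have "hilbert_dim (emb m ` closure (range D)) \<le>o hilbert_dim (emb m ` M)"
      by (rule hilbert_dim_mono[OF closure_minimal[OF DM M(2)] M(1) M_sub])
    ultimately show ?thesis by (simp add: rank_op_def ell2_closure_emb[OF S_sub] M_def)
  qed
  ultimately show ?thesis using F k r by (intro exI[of _ k] conjI bexI[of _ F]) auto
qed

end
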